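(* The cobracket $\theta:\mathcal G\to\mathcal G\otimes\mathcal G$ is trivial on the level of homology with respect to $\partial_E$: if $X\in\mathcal G$ satisfies $\partial_EX=0$, then $\theta(X)$ is a boundary in $\mathcal G\otimes\mathcal G$, where $\partial_E(X\otimes Y)=\partial_EX\otimes Y+(-1)^xX\otimes\partial_EY$ ($X$ having $x$ vertices).
   Context: Graphs. A graph is a finite 1-dimensional CW complex (not necessarily connected, multiple edges allowed, the empty graph allowed) all of whose vertices have valence at least 3. A labelling of a graph is a numbering $1,2,\dots$ of its vertices together with an arrow on each edge. An orientation is an equivalence class of labellings: reversing the arrow on one edge, or switching the numbers of two vertices, changes the orientation to the opposite one. $\mathcal G$ is the vector space, over a fixed field of characteristic zero, of linear combinations of (isomorphism classes of) oriented graphs modulo $(X,or)=-(X,-or)$; it is graded by the number of vertices. A graph with a loop is zero in $\mathcal G$, so graphs may be assumed loopless. The orientation is suppressed from the notation. Collapse. For a (non-loop) edge $e$ of $X$, $X_e$ is obtained by collapsing $e$ to a point. Induced orientation: represent the orientation of $X$ by a labelling in which the initial vertex of $e$ is 1 and the terminal vertex is 2; in $X_e$ the vertex resulting from the collapse is numbered 1, the numbers of all other vertices are reduced by one, and arrows on uncontracted edges are unchanged. $\partial_EX=\sum_eX_e$ over all edges $e$ of $X$, extended linearly; $\partial_E^2=0$. Half-edges. Each half-edge $h$ begins at a vertex $v(h)$, lies in an edge $e(h)$, and has a complementary half-edge $\bar h$ with $e(h)=h\cup\bar h$. For distinct half-edges $h,k$ with $k\ne\bar h$, $X\langle hk\rangle$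 is obtained by cutting $e(h)$ and $e(k)$ at their midpoints and gluing $h$ to $k$ and $\bar h$ to $\bar k$; orientation: represent the orientation of $X$ so that $h$ is the initial half-edge of $e(h)$ and $k$ is the terminal half-edge of $e(k)$; in $X\langle hk\rangle$ the edge $h\cup k$ is directed from $h$ to $k$ and the edge $\bar h\cup\bar k$ from $\bar k$ to $\bar h$, all else unchanged. If $v(h)\ne v(k)$, $X_{hk}:=(X\langle hk\rangle)_{h\cup k}$; if $v(h)=v(k)$, $X_{hk}:=0$. $\partial_H X=\sum X_{hk}$, sum over all unordered pairs $\{h,k\}$ of distinct half-edges of $X$ with $k\neq\bar h$. On $\mathcal G\otimes\mathcal G$, $\partial_H(X\otimes Y)=\partial_H X\otimes Y+(-1)^xX\otimes\partial_HY$. Product and coproduct. If $X$ has vertices numbered $1,\dots,x$ and $Y$ has vertices numbered $1,\dots,y$, then $X\cdot Y$ is the disjoint union with the vertex numbers of $Y$ shifted to $x+1,\dots,x+y$, extended bilinearly; the unit $1$ is the empty graph. $\mathcal G\otimes\mathcal G$ is an algebra by $(X\otimes Y)(Z\otimes W)=(-1)^{yz}X\cdot Z\otimes Y\cdot W$. $\Delta:\mathcal G\to\mathcal G\otimes\mathcal G$ is linear with $\Delta(1)=1\otimes1$, $\Delta(X)=X\otimes1+1\otimes X$ for connected $X$, and $\Delta(X\cdot Y)=\Delta(X)\Delta(Y)$. Cobracket. $\theta(X)=\Delta(\partial_HX)-\partial_H\Delta(X)$. *)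

theory Defs
  imports Complex_Main "HOL-Library.Poly_Mapping" "HOL-Combinatorics.Permutations"
begin

text \<open>
  A type whose elements \<open>x\<close> stand for oriented objects: \<open>same_or x y\<close> means that \<open>x\<close> and \<open>y\<close> are
  isomorphic with the same orientation, \<open>opp_or x y\<close> that they are isomorphic with opposite
  orientations.  The two relations need only be generating; \<open>ospace\<close> below is the vector space on
  the elements of the type modulo \<open>x = y\<close> if \<open>same_or x y\<close> and \<open>x = - y\<close> if \<open>opp_or x y\<close>.
\<close>

class oriented =
  fixes same_or :: "'a \<Rightarrow> 'a \<Rightarrow> bool"
    and opp_or :: "'a \<Rightarrow> 'a \<Rightarrow> bool"

definition pscale :: "'k::field \<Rightarrow> ('a \<Rightarrow>\<^sub>0 'k) \<Rightarrow> ('a \<Rightarrow>\<^sub>0 'k)" where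
  "pscale c f = Poly_Mapping.map ((*) c) f"

lemma lookup_pscale [simp]: "Poly_Mapping.lookup (pscale c f) a = c * Poly_Mapping.lookup f a"
  by (simp add: pscale_def Poly_Mapping.map.rep_eq when_def)

interpretation pm: vector_space "pscale :: 'k::field \<Rightarrow> ('a \<Rightarrow>\<^sub>0 'k) \<Rightarrow> ('a \<Rightarrow>\<^sub>0 'k)"
  by unfold_locales (auto intro!: poly_mapping_eqI simp: lookup_add algebra_simps)

definition or_relators :: "('a::oriented \<Rightarrow>\<^sub>0 'k::field) set" where
  "or_relators =
     {Poly_Mapping.single x 1 - Poly_Mapping.single y 1 | x y. same_or x y} \<union>
     {Poly_Mapping.single x 1 + Poly_Mapping.single y 1 | x y. opp_or x y}"

quotient_type (overloaded) ('a, 'k) ospace = "'a::oriented \<Rightarrow>\<^sub>0 'k::field_char_0"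
  / "\<lambda>f g. f - g \<in> pm.span or_relators"
proof (rule equivpI)
  show "reflp (\<lambda>f g::'a \<Rightarrow>\<^sub>0 'k. f - g \<in> pm.span or_relators)"
    by (rule reflpI) (simp add: pm.span_zero)
  show "symp (\<lambda>f g::'a \<Rightarrow>\<^sub>0 'k. f - g \<in> pm.span or_relators)"
    by (rule sympI) (metis minus_diff_eq pm.span_neg)
  show "transp (\<lambda>f g::'a \<Rightarrow>\<^sub>0 'k. f - g \<in> pm.span or_relators)"
  proof (rule transpI)
    fix f g h :: "'a \<Rightarrow>\<^sub>0 'k"
    assume "f - g \<in> pm.span or_relators" "g - h \<in> pm.span or_relators"
    then show "f - h \<in> pm.span or_relators"
      using pm.span_add by fastforce
  qed
qed

instantiation ospace :: (oriented, field_char_0) ab_group_add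
begin

lift_definition zero_ospace :: "('a, 'b) ospace" is 0 .
lift_definition plus_ospace :: "('a, 'b) ospace \<Rightarrow> ('a, 'b) ospace \<Rightarrow> ('a, 'b) ospace" is "(+)"
proof -
  fix f1 f2 g1 g2 :: "'a \<Rightarrow>\<^sub>0 'b"
  assume "f1 - f2 \<in> pm.span or_relators" "g1 - g2 \<in> pm.span or_relators"
  then have "(f1 - f2) + (g1 - g2) \<in> pm.span or_relators" by (rule pm.span_add)
  then show "f1 + g1 - (f2 + g2) \<in> pm.span or_relators" by (simp add: algebra_simps)
qed
lift_definition minus_ospace :: "('a, 'b) ospace \<Rightarrow> ('a, 'b) ospace \<Rightarrow> ('a, 'b) ospace" is "(-)"
proof -
  fix f1 f2 g1 g2 :: "'a \<Rightarrow>\<^sub>0 'b"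
  assume "f1 - f2 \<in> pm.span or_relators" "g1 - g2 \<in> pm.span or_relators"
  then have "(f1 - f2) - (g1 - g2) \<in> pm.span or_relators" by (rule pm.span_diff)
  then show "f1 - g1 - (f2 - g2) \<in> pm.span or_relators" by (simp add: algebra_simps)
qed
lift_definition uminus_ospace :: "('a, 'b) ospace \<Rightarrow> ('a, 'b) ospace" is uminus
proof -
  fix f g :: "'a \<Rightarrow>\<^sub>0 'b"
  assume "f - g \<in> pm.span or_relators"
  then have "- (f - g) \<in> pm.span or_relators" by (rule pm.span_neg)
  then show "- f - - g \<in> pm.span or_relators" by (simp add: algebra_simps)
qed

instance
  by standard (transfer; simp add: algebra_simps pm.span_zero)+

end

lift_definition oscale :: "'k::field_char_0 \<Rightarrow> ('a::oriented, 'k) ospace \<Rightarrow> ('a, 'k) ospace"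
    (infixr "\<bullet>" 75) is pscale
  by (metis pm.scale_right_diff_distrib pm.span_scale)

interpretation os: vector_space "oscale :: 'k::field_char_0 \<Rightarrow> ('a::oriented, 'k) ospace \<Rightarrow> _"
  by unfold_locales
    (transfer; simp add: pm.scale_right_distrib pm.scale_left_distrib pm.span_zero)+

lift_definition gen :: "'a::oriented \<Rightarrow> ('a, 'k::field_char_0) ospace" is
  "\<lambda>x. Poly_Mapping.single x 1" .

definition lin_ext :: "('a::oriented \<Rightarrow> ('b::oriented, 'k) ospace) \<Rightarrow> ('a, 'k::field_char_0) ospace
    \<Rightarrow> ('b, 'k) ospace" where
  "lin_ext \<phi> x = (\<Sum>a\<in>Poly_Mapping.keys (rep_ospace x). Poly_Mapping.lookup (rep_ospace x) a \<bullet> \<phi> a)"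

text \<open>
  For \<open>\<phi>\<close> with \<open>or_respects \<phi>\<close>, \<open>lin_ext \<phi>\<close> is the unique linear map with \<open>gen a \<mapsto> \<phi> a\<close>
  (see \<open>lin_ext_gen\<close>, \<open>lin_ext_linear\<close>, \<open>olinear_eqI\<close>); otherwise it is a junk value.
  Each use below comes with a proof of \<open>or_respects\<close>.
\<close>

definition or_respects :: "('a::oriented \<Rightarrow> ('b::oriented, 'k::field_char_0) ospace) \<Rightarrow> bool" where
  "or_respects \<phi> \<longleftrightarrow> (\<forall>x y. same_or x y \<longrightarrow> \<phi> x = \<phi> y) \<and> (\<forall>x y. opp_or x y \<longrightarrow> \<phi> x = - \<phi> y)"

abbreviation olinear :: "(('a::oriented, 'k::field_char_0) ospace \<Rightarrow> ('b::oriented, 'k) ospace) \<Rightarrow> bool" where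
  "olinear f \<equiv> Vector_Spaces.linear oscale oscale f"

lemma gen_same: "same_or x y \<Longrightarrow> gen x = (gen y :: ('a::oriented, 'k::field_char_0) ospace)"
  by transfer (rule pm.span_base, auto simp: or_relators_def)

lemma gen_opp: "opp_or x y \<Longrightarrow> gen x = - (gen y :: ('a::oriented, 'k::field_char_0) ospace)"
  by transfer (rule pm.span_base, auto simp: or_relators_def)

definition lin0 :: "('a \<Rightarrow> ('b::oriented, 'k) ospace) \<Rightarrow> ('a \<Rightarrow>\<^sub>0 'k::field_char_0) \<Rightarrow> ('b, 'k) ospace" where
  "lin0 \<phi> f = (\<Sum>a\<in>Poly_Mapping.keys f. Poly_Mapping.lookup f a \<bullet> \<phi> a)"

lemma lin0_superset: "finite A \<Longrightarrow> Poly_Mapping.keys f \<subseteq> A \<Longrightarrow> lin0 \<phi> f = (\<Sum>a\<in>A. Poly_Mapping.lookup f a \<bullet> \<phi> a)"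
  unfolding lin0_def
  by (rule sum.mono_neutral_left) (auto simp: in_keys_iff)

lemma lin0_add: "lin0 \<phi> (f + g) = lin0 \<phi> f + lin0 \<phi> g"
proof -
  let ?A = "Poly_Mapping.keys f \<union> Poly_Mapping.keys g"
  have "Poly_Mapping.keys (f + g) \<subseteq> ?A" by (rule keys_add)
  then show ?thesis
    by (simp add: lin0_superset[of ?A] lookup_add os.scale_left_distrib sum.distrib)
qed

lemma lin0_scale: "lin0 \<phi> (pscale c f) = c \<bullet> lin0 \<phi> f"
proof -
  have "Poly_Mapping.keys (pscale c f) \<subseteq> Poly_Mapping.keys f" by (auto simp: in_keys_iff)
  then show ?thesis
    by (simp add: lin0_superset[of "Poly_Mapping.keys f"] os.scale_sum_right)
qed

lemma lin0_single: "lin0 \<phi> (Poly_Mapping.single a c) = c \<bullet> \<phi> a"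
  by (subst lin0_superset[of "{a}"]) (auto simp: lookup_single)

lemma lin0_diff: "lin0 \<phi> (f - g) = lin0 \<phi> f - lin0 \<phi> g"
  using lin0_add[of \<phi> "f - g" g] by simp

lemma lin0_span:
  assumes "or_respects \<phi>" "f \<in> pm.span or_relators"
  shows "lin0 \<phi> f = 0"
  using assms(2)
proof (induction rule: pm.span_induct_alt)
  case base
  then show ?case by (simp add: lin0_def)
next
  case (step c x y)
  have "lin0 \<phi> x = 0"
    using step(1) assms(1)
    by (auto simp: or_relators_def or_respects_def lin0_diff lin0_add lin0_single)
  then show ?case using step by (simp add: lin0_add lin0_scale)
qed

lemma lin_ext_abs:
  assumes "or_respects \<phi>"
  shows "lin_ext \<phi> (abs_ospace f) = lin0 \<phi> f"
proof -
  have "rep_ospace (abs_ospace f) - f \<in> pm.span or_relators"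
    by (simp add: ospace.abs_eq_iff[symmetric] Quotient3_abs_rep[OF Quotient3_ospace])
  then have "lin0 \<phi> (rep_ospace (abs_ospace f)) = lin0 \<phi> f"
    using lin0_span[OF assms] by (metis lin0_diff eq_iff_diff_eq_0)
  then show ?thesis by (simp add: lin_ext_def lin0_def)
qed

lemma lin_ext_gen: "or_respects \<phi> \<Longrightarrow> lin_ext \<phi> (gen a) = \<phi> a"
  by (simp add: gen_def lin_ext_abs lin0_single)

lemma lin_ext_linear: assumes "or_respects \<phi>" shows "olinear (lin_ext \<phi>)"
proof -
  have a: "lin_ext \<phi> (x + y) = lin_ext \<phi> x + lin_ext \<phi> y" for x y
    by (induction x; induction y) (simp add: plus_ospace.abs_eq lin_ext_abs[OF assms] lin0_add)
  have s: "lin_ext \<phi> (c \<bullet> x) = c \<bullet> lin_ext \<phi> x" for x c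
    by (induction x) (simp add: oscale.abs_eq lin_ext_abs[OF assms] lin0_scale)
  show ?thesis
    by unfold_locales (simp_all add: a s)
qed

lemma ospace_induct [case_names add scale gen]:
  fixes x :: "('a::oriented, 'k::field_char_0) ospace"
  assumes "\<And>x y. P x \<Longrightarrow> P y \<Longrightarrow> P (x + y)" "\<And>c x. P x \<Longrightarrow> P (c \<bullet> x)" "\<And>a. P (gen a)" 
  shows "P x"
proof -
  have z: "P 0" using assms(2)[OF assms(3), of 0] by simp
  have "P (\<Sum>a\<in>A. c a \<bullet> gen a)" if "finite A" for A and c :: "'a \<Rightarrow> 'k"
    using that by induction (use z assms in auto)
  moreover have "\<exists>A c. finite A \<and> x = (\<Sum>a\<in>A. c a \<bullet> gen a)"
  proof (induction x rule: ospace.abs_induct)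
    fix f :: "'a \<Rightarrow>\<^sub>0 'k"
    have "f = (\<Sum>a\<in>Poly_Mapping.keys f. pscale (Poly_Mapping.lookup f a) (Poly_Mapping.single a 1))"
      by (rule poly_mapping_eqI) (auto simp: lookup_sum lookup_single when_def if_distrib sum.delta' in_keys_iff cong: if_cong)
    moreover have "abs_ospace (\<Sum>a\<in>A. pscale (Poly_Mapping.lookup f a) (Poly_Mapping.single a 1)) = (\<Sum>a\<in>A. Poly_Mapping.lookup f a \<bullet> (gen a :: ('a,'k) ospace))"
      if "finite A" for A
      using that
      by induction (auto simp: zero_ospace_def gen_def oscale.abs_eq plus_ospace.abs_eq[symmetric])
    ultimately have "abs_ospace f = (\<Sum>a\<in>Poly_Mapping.keys f. Poly_Mapping.lookup f a \<bullet> (gen a :: ('a,'k) ospace))"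
      by (metis finite_keys)
    then show "\<exists>A c. finite A \<and> abs_ospace f = (\<Sum>a\<in>A. c a \<bullet> gen a)" by (metis finite_keys)
  qed
  ultimately show ?thesis by auto
qed

lemma olinear_eqI:
  assumes "olinear f" "olinear g" "\<And>a. f (gen a) = g (gen a)"
  shows "f = g"
proof
  interpret f: Vector_Spaces.linear oscale oscale f by fact
  interpret g: Vector_Spaces.linear oscale oscale g by fact
  fix x show "f x = g x"
    by (induction x rule: ospace_induct) (simp_all add: f.add g.add f.scale g.scale assms(3))
qed

definition bilift :: "('a::oriented \<Rightarrow> 'b::oriented \<Rightarrow> ('c::oriented, 'k) ospace)
    \<Rightarrow> ('a, 'k::field_char_0) ospace \<Rightarrow> ('b, 'k) ospace \<Rightarrow> ('c, 'k) ospace" where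
  "bilift \<phi> x y = lin_ext (\<lambda>a. lin_ext (\<lambda>b. \<phi> a b) y) x"

definition or_respects2 :: "('a::oriented \<Rightarrow> 'b::oriented \<Rightarrow> ('c::oriented, 'k::field_char_0) ospace) \<Rightarrow> bool" where
  "or_respects2 \<phi> \<longleftrightarrow> (\<forall>a. or_respects (\<phi> a)) \<and> (\<forall>b. or_respects (\<lambda>a. \<phi> a b))"

lemma olinearI:
  "(\<And>x y. f (x + y) = f x + f y) \<Longrightarrow> (\<And>c x. f (c \<bullet> x) = c \<bullet> f x) \<Longrightarrow> olinear f"
  by unfold_locales auto

lemma olinearD:
  assumes "olinear f"
  shows "f (x + y) = f x + f y" "f (c \<bullet> x) = c \<bullet> f x" "f 0 = 0" "f (- x) = - f x" "f (x - y) = f x - f y"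
    "f (sum g A) = (\<Sum>a\<in>A. f (g a))"
proof -
  interpret f: Vector_Spaces.linear oscale oscale f by fact
  show "f (x + y) = f x + f y" "f (c \<bullet> x) = c \<bullet> f x" "f 0 = 0" "f (- x) = - f x" "f (x - y) = f x - f y"
    "f (sum g A) = (\<Sum>a\<in>A. f (g a))"
    by (rule f.add f.scale f.zero f.neg f.diff f.sum)+
qed

lemma olinear_id: "olinear (\<lambda>x. x)"
  by (rule olinearI) auto
lemma olinear_add: "olinear f \<Longrightarrow> olinear g \<Longrightarrow> olinear (\<lambda>x. f x + g x)"
  by (rule olinearI) (auto simp: olinearD algebra_simps os.scale_right_distrib)
lemma olinear_diff: "olinear f \<Longrightarrow> olinear g \<Longrightarrow> olinear (\<lambda>x. f x - g x)"
  by (rule olinearI) (auto simp: olinearD algebra_simps os.scale_right_diff_distrib)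
lemma olinear_scale: "olinear f \<Longrightarrow> olinear (\<lambda>x. c \<bullet> f x)"
  by (rule olinearI) (auto simp: olinearD os.scale_right_distrib mult.commute)
lemma olinear_compose: "olinear f \<Longrightarrow> olinear g \<Longrightarrow> olinear (\<lambda>x. g (f x))"
  by (rule olinearI) (auto simp: olinearD)

lemma lin_ext_phi_linear:
  assumes "or_respects \<phi>" "or_respects \<psi>"
  shows "lin_ext (\<lambda>a. \<phi> a + \<psi> a) x = lin_ext \<phi> x + lin_ext \<psi> x"
    "lin_ext (\<lambda>a. c \<bullet> \<phi> a) x = c \<bullet> lin_ext \<phi> x"
    "lin_ext (\<lambda>a. - \<phi> a) x = - lin_ext \<phi> x"
  by (simp_all add: lin_ext_def sum.distrib os.scale_right_distrib os.scale_sum_right mult.commute sum_negf)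

lemma or_respects2_ext:
  assumes "or_respects2 \<phi>"
  shows "or_respects (\<lambda>a. lin_ext (\<phi> a) y)"
  using assms lin_ext_phi_linear(3) unfolding or_respects2_def
  by (auto simp: or_respects_def lin_ext_def sum_negf)

lemma bilift_gen: "or_respects2 \<phi> \<Longrightarrow> bilift \<phi> (gen a) (gen b) = \<phi> a b"
  unfolding bilift_def
  by (subst lin_ext_gen) (auto simp: or_respects2_ext lin_ext_gen or_respects2_def)

lemma bilift_linear1: "or_respects2 \<phi> \<Longrightarrow> olinear (\<lambda>x. bilift \<phi> x y)"
  unfolding bilift_def
  by (intro lin_ext_linear or_respects2_ext)

lemma bilift_linear2: assumes "or_respects2 \<phi>" shows "olinear (\<lambda>y. bilift \<phi> x y)"
proof (induction x rule: ospace_induct)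
  case (add x y)
  then show ?case
    using olinear_add[of "bilift \<phi> x" "bilift \<phi> y"] 
    by (simp add: olinearD[OF bilift_linear1[OF assms]])
next
  case (scale c x)
  then show ?case
    using olinear_scale[of "bilift \<phi> x"] 
    by (simp add: olinearD[OF bilift_linear1[OF assms]])
next
  case (gen a)
  have "bilift \<phi> (gen a) = lin_ext (\<phi> a)"
    unfolding bilift_def by (rule HOL.ext) (simp add: or_respects2_ext[OF assms] lin_ext_gen)
  then show ?case using assms by (simp add: or_respects2_def lin_ext_linear)
qed

lemma bilinear_eqI:
  assumes "\<And>y. olinear (\<lambda>x. f x y)" "\<And>x. olinear (f x)" "\<And>y. olinear (\<lambda>x. g x y)" "\<And>x. olinear (g x)"
    and "\<And>a b. f (gen a) (gen b) = g (gen a) (gen b)"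
  shows "f x y = g x y"
proof -
  have "f (gen a) = g (gen a)" for a
    using assms by (intro olinear_eqI) auto
  then have "(\<lambda>x. f x y) = (\<lambda>x. g x y)"
    using assms by (intro olinear_eqI) auto
  then show ?thesis by metis
qed

text \<open>
  The tensor product of the spaces on \<open>'a\<close> and \<open>'b\<close> is the space on \<open>'a \<times> 'b\<close>, where the relations
  are imposed in each factor separately; \<open>tensor_universal\<close> below is its universal property.
\<close>

instantiation prod :: (oriented, oriented) oriented
begin

definition same_or_prod :: "'a \<times> 'b \<Rightarrow> 'a \<times> 'b \<Rightarrow> bool" where
  "same_or_prod p q \<longleftrightarrow>
     same_or (fst p) (fst q) \<and> snd p = snd q \<or> fst p = fst q \<and> same_or (snd p) (snd q)"

definition opp_or_prod :: "'a \<times> 'b \<Rightarrow> 'a \<times> 'b \<Rightarrow> bool" where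
  "opp_or_prod p q \<longleftrightarrow>
     opp_or (fst p) (fst q) \<and> snd p = snd q \<or> fst p = fst q \<and> opp_or (snd p) (snd q)"

instance ..

end

lemma or_respects_gen: "or_respects gen"
  by (simp add: or_respects_def gen_same gen_opp)

lemma or_respects_prod:
  assumes "or_respects2 \<phi>"
  shows "or_respects (\<lambda>(a, b). \<phi> a b)"
  using assms by (auto simp: or_respects_def or_respects2_def same_or_prod_def opp_or_prod_def)

definition tensor :: "('a::oriented, 'k::field_char_0) ospace \<Rightarrow> ('b::oriented, 'k) ospace
    \<Rightarrow> ('a \<times> 'b, 'k) ospace" (infixr "\<otimes>" 72) where
  "x \<otimes> y = bilift (\<lambda>a b. gen (a, b)) x y"

lemma tensor_respects: "or_respects2 (\<lambda>a b. gen (a::'a::oriented, b::'b::oriented))"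
  unfolding or_respects2_def
  by (auto simp: or_respects_def same_or_prod_def opp_or_prod_def intro!: gen_same gen_opp)

lemma tensor_gen: "gen a \<otimes> gen b = gen (a, b)"
  by (simp add: tensor_def bilift_gen tensor_respects)

lemma tensor_linear1: "olinear (\<lambda>x. x \<otimes> y)"
  unfolding tensor_def by (intro bilift_linear1 tensor_respects)

lemma tensor_linear2: "olinear (\<lambda>y. x \<otimes> y)"
  unfolding tensor_def by (intro bilift_linear2 tensor_respects)

lemmas tensor_simps1 = olinearD[OF tensor_linear1]
lemmas tensor_simps2 = olinearD[OF tensor_linear2]

lemma or_respects_linear: "olinear f \<Longrightarrow> or_respects \<phi> \<Longrightarrow> or_respects (\<lambda>X. f (\<phi> X))"
  by (simp add: or_respects_def olinearD)

lemma tensor_universal: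
  fixes B :: "('a::oriented, 'k::field_char_0) ospace \<Rightarrow> ('b::oriented, 'k) ospace \<Rightarrow> ('c::oriented, 'k) ospace"
  assumes "\<And>y. olinear (\<lambda>x. B x y)" "\<And>x. olinear (B x)"
  shows "\<exists>!L. olinear L \<and> (\<forall>x y. L (x \<otimes> y) = B x y)"
proof (rule ex1I, intro conjI allI)
  let ?L = "lin_ext (\<lambda>(a, b). B (gen a) (gen b))"
  have "or_respects2 (\<lambda>a b. B (gen a) (gen b))"
    unfolding or_respects2_def
    by (intro conjI allI or_respects_linear[OF assms(1)] or_respects_linear[OF assms(2)] or_respects_gen)
  then have r: "or_respects (\<lambda>(a, b). B (gen a) (gen b))" by (rule or_respects_prod)
  show l: "olinear ?L" by (rule lin_ext_linear[OF r])
  show "?L (x \<otimes> y) = B x y" for x y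
  proof (rule bilinear_eqI[where f = "\<lambda>x y. ?L (x \<otimes> y)"])
    show "?L (gen a \<otimes> gen b) = B (gen a) (gen b)" for a b
      by (simp add: tensor_gen lin_ext_gen[OF r])
  qed (intro assms olinear_compose[OF tensor_linear1 l] olinear_compose[OF tensor_linear2 l])+
  fix L assume L: "olinear L \<and> (\<forall>x y. L (x \<otimes> y) = B x y)"
  show "L = ?L"
  proof (rule olinear_eqI)
    fix p :: "'a \<times> 'b"
    obtain a b where p: "p = (a, b)" by fastforce
    have "L (gen p) = L (gen a \<otimes> gen b)" by (simp add: p tensor_gen)
    then show "L (gen p) = ?L (gen p)" using L by (simp add: p lin_ext_gen[OF r])
  qed (use L l in auto)
qed

definition valence :: "(nat \<times> nat) list \<Rightarrow> nat \<Rightarrow> nat" where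
  "valence es v = length (filter (\<lambda>e. fst e = v) es) + length (filter (\<lambda>e. snd e = v) es)"

definition is_lgraph :: "nat \<times> (nat \<times> nat) list \<Rightarrow> bool" where
  "is_lgraph = (\<lambda>(n, es). set es \<subseteq> {1..n} \<times> {1..n} \<and> (\<forall>v\<in>{1..n}. 3 \<le> valence es v))"

text \<open>
  A labelled graph \<open>(n, es)\<close> has vertices \<open>1, \<dots>, n\<close> and one edge for each position \<open>i\<close> of \<open>es\<close>; the
  arrow on the edge \<open>es ! i = (u, v)\<close> points from \<open>u\<close> to \<open>v\<close>.  A loop contributes 2 to the valence of
  its vertex.  The order of the list \<open>es\<close> only serves to name the edges and is divided out by \<open>same_or\<close>.
\<close>

typedef lgraph = "{X. is_lgraph X}"
  by (rule exI[of _ "(0, [])"]) (simp add: is_lgraph_def)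

setup_lifting type_definition_lgraph

lift_definition nverts :: "lgraph \<Rightarrow> nat" is fst .
lift_definition edges :: "lgraph \<Rightarrow> (nat \<times> nat) list" is snd .

definition ends :: "(nat \<times> nat) multiset \<Rightarrow> nat multiset" where
  "ends M = image_mset fst M + image_mset snd M"

definition valid_ends :: "nat \<Rightarrow> nat multiset \<Rightarrow> bool" where
  "valid_ends n E \<longleftrightarrow> set_mset E \<subseteq> {1..n} \<and> (\<forall>v\<in>{1..n}. 3 \<le> count E v)"

lemma ends_simps [simp]:
  "ends {#} = {#}" "ends (M + N) = ends M + ends N" "ends (add_mset e M) = {#fst e, snd e#} + ends M"
  by (simp_all add: ends_def)

lemma ends_image: "ends (image_mset (map_prod \<sigma> \<sigma>) M) = image_mset \<sigma> (ends M)"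
  by (induction M) auto

lemma valence_ends: "valence es v = count (ends (mset es)) v"
  by (induction es) (auto simp: valence_def)

lemma set_ends: "set_mset (ends M) = fst ` set_mset M \<union> snd ` set_mset M"
  by (auto simp: ends_def)

lemma is_lgraph_iff: "is_lgraph (n, es) \<longleftrightarrow> valid_ends n (ends (mset es))"
  by (fastforce simp: is_lgraph_def valid_ends_def set_ends valence_ends)

lemma count_image_inj: "inj f \<Longrightarrow> count (image_mset f M) (f x) = count M x"
  by (induction M) (auto simp: inj_eq)

lemma valid_ends_image:
  assumes "\<sigma> permutes {1..n}"
  shows "valid_ends n (image_mset \<sigma> E) \<longleftrightarrow> valid_ends n E"
proof -
  have 1: "valid_ends n (image_mset \<sigma> E)" if "valid_ends n E" "\<sigma> permutes {1..n}" for E \<sigma>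
  proof -
    have c: "count (image_mset \<sigma> E) v = count E (inv \<sigma> v)" for v
      using count_image_inj[OF permutes_inj[OF that(2)], of E "inv \<sigma> v"]
      by (simp add: permutes_inverses(1)[OF that(2)])
    have "inv \<sigma> v \<in> {1..n}" if "v \<in> {1..n}" for v
      using permutes_in_image[OF permutes_inv[OF \<open>\<sigma> permutes {1..n}\<close>], of v] that by simp
    moreover have "\<sigma> v \<in> {1..n}" if "v \<in> {1..n}" for v
      using permutes_in_image[OF \<open>\<sigma> permutes {1..n}\<close>, of v] that by simp
    ultimately show ?thesis
      using that(1) unfolding valid_ends_def c by auto
  qed
  have "image_mset (inv \<sigma>) (image_mset \<sigma> E) = E"
    by (simp add: multiset.map_comp permutes_inv_o[OF assms])
  then show ?thesis
    using 1[OF _ assms] 1[OF _ permutes_inv[OF assms], of "image_mset \<sigma> E"] by metis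
qed

lift_definition relabel :: "(nat \<Rightarrow> nat) \<Rightarrow> lgraph \<Rightarrow> lgraph" is
  "\<lambda>\<sigma> (n, es). if \<sigma> permutes {1..n} then (n, map (map_prod \<sigma> \<sigma>) es) else (n, es)"
  by (auto simp: is_lgraph_iff ends_image valid_ends_image split: prod.splits)

lemma mset_update2:
  assumes "i < length es"
  shows "mset (es[i := e]) = add_mset e (mset es - {#es ! i#})"
    and "mset es = add_mset (es ! i) (mset es - {#es ! i#})"
  using assms by (simp_all add: mset_update)

lemma is_lgraph_rev:
  assumes "is_lgraph (n, es)" and i: "i < length es"
  shows "is_lgraph (n, es[i := prod.swap (es ! i)])"
proof -
  have "ends (mset (es[i := prod.swap (es ! i)])) = ends (mset es)"
    unfolding mset_update2(1)[OF i] by (subst (2) mset_update2(2)[OF i]) (simp add: add_mset_commute)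
  then show ?thesis using assms by (simp add: is_lgraph_iff)
qed

lift_definition rev_arrow :: "nat \<Rightarrow> lgraph \<Rightarrow> lgraph" is
  "\<lambda>i (n, es). if i < length es then (n, es[i := prod.swap (es ! i)]) else (n, es)"
  by (auto simp: is_lgraph_rev split: prod.splits)

instantiation lgraph :: oriented
begin

definition same_or_lgraph :: "lgraph \<Rightarrow> lgraph \<Rightarrow> bool" where
  "same_or_lgraph X Y \<longleftrightarrow> nverts X = nverts Y \<and> mset (edges X) = mset (edges Y)"

definition opp_or_lgraph :: "lgraph \<Rightarrow> lgraph \<Rightarrow> bool" where
  "opp_or_lgraph X Y \<longleftrightarrow>
     (\<exists>i<length (edges X). Y = rev_arrow i X) \<or>
     (\<exists>a\<in>{1..nverts X}. \<exists>b\<in>{1..nverts X}. a \<noteq> b \<and> Y = relabel (transpose a b) X)"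

instance ..

end

definition merge12 :: "nat \<Rightarrow> nat" where
  "merge12 v = (if v = 1 then 1 else v - 1)"

definition remove_nth :: "nat \<Rightarrow> 'a list \<Rightarrow> 'a list" where
  "remove_nth i xs = take i xs @ drop (Suc i) xs"

lemma mset_remove_nth: "i < length xs \<Longrightarrow> mset (remove_nth i xs) = mset xs - {#xs ! i#}"
proof -
  assume i: "i < length xs"
  have "mset xs = mset (take i xs @ xs ! i # drop (Suc i) xs)"
    using i by (simp add: Cons_nth_drop_Suc del: mset_append)
  then show ?thesis by (simp add: remove_nth_def)
qed

lemma valid_ends_merge:
  assumes "valid_ends n ({#1, 2#} + E)"
  shows "valid_ends (n - 1) (image_mset merge12 E)"
proof -
  have n: "2 \<le> n" and E: "set_mset E \<subseteq> {1..n}"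
    and v: "\<And>v. v \<in> {1..n} \<Longrightarrow> 3 \<le> count ({#1, 2#} + E) v"
    using assms by (auto simp: valid_ends_def)
  have m: "merge12 ` {1..n} \<subseteq> {1..n-1}" using n by (auto simp: merge12_def)
  have "3 \<le> count (image_mset merge12 E) w" if w: "w \<in> {1..n-1}" for w
  proof (cases "w = 1")
    case True
    have "count E 1 + count E 2 \<le> count (image_mset merge12 E) 1"
      by (induction E) (auto simp: merge12_def)
    then show ?thesis using True v[of 1] v[of 2] n by auto
  next
    case False
    then have "w = merge12 (Suc w)" using w by (auto simp: merge12_def)
    then have "count E (Suc w) \<le> count (image_mset merge12 E) w"
      by (induction E) auto
    moreover have "Suc w \<in> {1..n}" "Suc w \<noteq> 1" "Suc w \<noteq> 2" using False w by auto
    ultimately show ?thesis using v[of "Suc w"] by auto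
  qed
  then show ?thesis using E m by (auto simp: valid_ends_def)
qed

lemma is_lgraph_contract12:
  assumes "is_lgraph (n, es)" and i: "i < length es" and e: "es ! i = (1, 2)"
  shows "is_lgraph (n - 1, map (map_prod merge12 merge12) (remove_nth i es))"
proof -
  have "ends (mset es) = {#1, 2#} + ends (mset es - {#(1, 2)#})"
    by (subst mset_update2(2)[OF i]) (simp add: e)
  then show ?thesis
    using assms valid_ends_merge[of n "ends (mset es - {#(1, 2)#})"]
    by (simp add: is_lgraph_iff ends_image mset_remove_nth)
qed

lift_definition contract12 :: "nat \<Rightarrow> lgraph \<Rightarrow> lgraph" is
  "\<lambda>i (n, es). if i < length es \<and> es ! i = (1, 2)
     then (n - 1, map (map_prod merge12 merge12) (remove_nth i es)) else (n, es)"
  using is_lgraph_contract12 by (auto split: prod.splits)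

text \<open>
  \<open>(i, True)\<close> is the initial and \<open>(i, False)\<close> the terminal half of the \<open>i\<close>-th edge.
\<close>

type_synonym half_edge = "nat \<times> bool"

definition half_edges :: "lgraph \<Rightarrow> half_edge set" where
  "half_edges X = {..<length (edges X)} \<times> UNIV"

definition hbar :: "half_edge \<Rightarrow> half_edge" where
  "hbar h = (fst h, \<not> snd h)"

definition hvert :: "(nat \<times> nat) list \<Rightarrow> half_edge \<Rightarrow> nat" where
  "hvert es h = (if snd h then fst (es ! fst h) else snd (es ! fst h))"

lemma hvert_pair: "{#hvert es h, hvert es (hbar h)#} = {#fst (es ! fst h), snd (es ! fst h)#}"
  by (auto simp: hvert_def hbar_def add_mset_commute)

lemma mset_update_two:
  assumes "i < length es" "j < length es" "i \<noteq> j"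
  shows "mset (es[i := d, j := e]) = {#d, e#} + (mset es - {#es ! i, es ! j#})"
    and "mset es = {#es ! i, es ! j#} + (mset es - {#es ! i, es ! j#})"
proof -
  have 1: "es ! j \<in># mset es - {#es ! i#}"
  proof -
    have "mset es - {#es ! i#} = mset (remove_nth i es)" using assms by (simp add: mset_remove_nth)
    moreover have "es ! j \<in> set (remove_nth i es)"
    proof (cases "j < i")
      case True
      then have "es ! j = take i es ! j" "j < length (take i es)" using assms by auto
      then show ?thesis unfolding remove_nth_def by (metis UnI1 nth_mem set_append)
    next
      case False
      then have "es ! j = drop (Suc i) es ! (j - Suc i)" "j - Suc i < length (drop (Suc i) es)" using assms by auto
      then show ?thesis unfolding remove_nth_def by (metis UnI2 nth_mem set_append)
    qed
    ultimately show ?thesis by (metis set_mset_mset)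
  qed
  have 2: "mset es - {#es ! i, es ! j#} = mset es - {#es ! i#} - {#es ! j#}"
    by (simp add: add_mset_commute)
  have 3: "mset es - {#es ! i#} = add_mset (es ! j) (mset es - {#es ! i#} - {#es ! j#})"
    using 1 by (rule insert_DiffM[symmetric])
  show 4: "mset es = {#es ! i, es ! j#} + (mset es - {#es ! i, es ! j#})"
    unfolding 2 using 3 mset_update2(2)[OF assms(1)] by simp
  have "mset (es[i := d, j := e]) = add_mset e (add_mset d (mset es - {#es ! i#}) - {#es ! j#})"
    using assms by (simp add: mset_update)
  also have "\<dots> = add_mset e (add_mset d (mset es - {#es ! i#} - {#es ! j#}))"
    by (subst 3) simp
  finally show "mset (es[i := d, j := e]) = {#d, e#} + (mset es - {#es ! i, es ! j#})"
    unfolding 2 by simp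
qed

lemma is_lgraph_cut_glue:
  assumes "is_lgraph (n, es)" "fst h < length es" "fst k < length es" "fst h \<noteq> fst k"
  shows "is_lgraph (n, es[fst h := (hvert es h, hvert es k), fst k := (hvert es (hbar k), hvert es (hbar h))])"
proof -
  let ?M = "mset es - {#es ! fst h, es ! fst k#}"
  have "ends (mset es) = {#fst (es ! fst h), snd (es ! fst h)#} + {#fst (es ! fst k), snd (es ! fst k)#} + ends ?M"
    by (subst mset_update_two(2)[of "fst h" es "fst k"]) (use assms in simp_all)
  also have "\<dots> = {#hvert es h, hvert es (hbar h)#} + {#hvert es k, hvert es (hbar k)#} + ends ?M"
    by (simp only: hvert_pair)
  also have "\<dots> = ends (mset (es[fst h := (hvert es h, hvert es k), fst k := (hvert es (hbar k), hvert es (hbar h))]))"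
    by (subst mset_update_two(1)) (use assms in \<open>simp_all add: add_mset_commute\<close>)
  finally show ?thesis using assms by (simp add: is_lgraph_iff)
qed

text \<open>
  The edges \<open>e(h)\<close> and \<open>e(k)\<close> are replaced by \<open>h \<union> k\<close>, directed from \<open>h\<close> to \<open>k\<close> and placed at the position of
  \<open>e(h)\<close>, and by the union of the complementary halves, directed from that of \<open>k\<close> to that of \<open>h\<close>.
  The arrows of \<open>e(h)\<close> and \<open>e(k)\<close> themselves are disregarded; they enter through \<open>cut_sign\<close> below.
\<close>

lift_definition cut_glue :: "lgraph \<Rightarrow> half_edge \<Rightarrow> half_edge \<Rightarrow> lgraph" is
  "\<lambda>(n, es) h k. if fst h < length es \<and> fst k < length es \<and> fst h \<noteq> fst k
     then (n, es[fst h := (hvert es h, hvert es k), fst k := (hvert es (hbar k), hvert es (hbar h))])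
     else (n, es)"
  using is_lgraph_cut_glue[of _ _ "(a, b)" "(c, d)" for a b c d]
  by (auto split: prod.splits)

lift_definition gempty :: lgraph is "(0, [])"
  by (simp add: is_lgraph_def)

lemma is_lgraph_union:
  assumes a: "is_lgraph (n, es)" "is_lgraph (m, fs)"
  shows "is_lgraph (n + m, es @ map (map_prod ((+) n) ((+) n)) fs)"
proof -
  let ?E = "ends (mset es)" and ?F = "ends (mset fs)"
  have "3 \<le> count (?E + image_mset ((+) n) ?F) v" if "v \<in> {1..n+m}" for v
  proof (cases "v \<le> n")
    case True
    then show ?thesis using a that by (auto simp: is_lgraph_iff valid_ends_def trans_le_add1)
  next
    case False
    then have w: "v = n + (v - n)" "v - n \<in> {1..m}"
      using that by (auto)
    have "count (image_mset ((+) n) ?F) (n + (v - n)) = count ?F (v - n)"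
      by (rule count_image_inj) (simp add: inj_def)
    then have "count (image_mset ((+) n) ?F) v = count ?F (v - n)" using w(1) by metis
    then show ?thesis using a w(2) by (auto simp: is_lgraph_iff valid_ends_def trans_le_add2)
  qed
  moreover have "set_mset (?E + image_mset ((+) n) ?F) \<subseteq> {1..n+m}"
    using a by (fastforce simp: is_lgraph_iff valid_ends_def)
  ultimately show ?thesis
    by (simp add: is_lgraph_iff ends_image valid_ends_def)
qed

lift_definition gunion :: "lgraph \<Rightarrow> lgraph \<Rightarrow> lgraph" is
  "\<lambda>(n, es) (m, fs). (n + m, es @ map (map_prod ((+) n) ((+) n)) fs)"
  by (auto simp: is_lgraph_union split: prod.splits)

type_synonym 'k graph_space = "(lgraph, 'k) ospace"
type_synonym 'k graph_space2 = "(lgraph \<times> lgraph, 'k) ospace"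

text \<open>
  For distinct \<open>u\<close>, \<open>v\<close> in \<open>{1..n}\<close>, \<open>to12 u v\<close> is a permutation of \<open>{1..n}\<close> with \<open>u \<mapsto> 1\<close> and \<open>v \<mapsto> 2\<close>
  (lemma \<open>to12\<close>); by \<open>collm_eq\<close> any other such permutation yields the same value of \<open>collapse\<close>.
\<close>

definition to12 :: "nat \<Rightarrow> nat \<Rightarrow> nat \<Rightarrow> nat" where
  "to12 u v = transpose 2 (transpose 1 u v) \<circ> transpose 1 u"

definition collapse :: "lgraph \<Rightarrow> nat \<Rightarrow> 'k::field_char_0 graph_space" where
  "collapse X i = (let \<sigma> = to12 (fst (edges X ! i)) (snd (edges X ! i))
     in of_int (sign \<sigma>) \<bullet> gen (contract12 i (relabel \<sigma> X)))"

definition boundary_E_gen :: "lgraph \<Rightarrow> 'k::field_char_0 graph_space" where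
  "boundary_E_gen X = (\<Sum>i | i < length (edges X) \<and> fst (edges X ! i) \<noteq> snd (edges X ! i). collapse X i)"

definition boundary_E :: "'k::field_char_0 graph_space \<Rightarrow> 'k graph_space" where
  "boundary_E = lin_ext boundary_E_gen"

text \<open>
  One factor \<open>-1\<close> for each arrow of \<open>X\<close> that has to be reversed to make \<open>h\<close> the initial half of \<open>e(h)\<close>
  and \<open>k\<close> the terminal half of \<open>e(k)\<close>.
\<close>

definition cut_sign :: "half_edge \<Rightarrow> half_edge \<Rightarrow> 'k::field_char_0" where
  "cut_sign h k = (if snd h then 1 else -1) * (if snd k then -1 else 1)"

definition hh_collapse :: "lgraph \<Rightarrow> half_edge \<Rightarrow> half_edge \<Rightarrow> 'k::field_char_0 graph_space" where
  "hh_collapse X h k = (if hvert (edges X) h = hvert (edges X) k then 0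
     else cut_sign h k \<bullet> collapse (cut_glue X h k) (fst h))"

text \<open>
  An unordered pair of half-edges of two different edges is represented by the ordered pair
  whose first component lies in the edge of smaller index; \<open>hh_collapse_sym\<close> shows that the
  choice is immaterial.
\<close>

definition boundary_H_gen :: "lgraph \<Rightarrow> 'k::field_char_0 graph_space" where
  "boundary_H_gen X = (\<Sum>(h, k) \<in> {(h, k). h \<in> half_edges X \<and> k \<in> half_edges X \<and> fst h < fst k}. hh_collapse X h k)"

definition boundary_H :: "'k::field_char_0 graph_space \<Rightarrow> 'k graph_space" where
  "boundary_H = lin_ext boundary_H_gen"

declare One_nat_def [simp del]

lemma perm_permutation: "p permutes {a..b::nat} \<Longrightarrow> permutation p"
  by (rule permutes_imp_permutation) auto

definition genm :: "nat \<Rightarrow> (nat \<times> nat) multiset \<Rightarrow> 'k::field_char_0 graph_space" where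
  "genm n M = (if valid_ends n (ends M) then gen (Abs_lgraph (n, SOME es. mset es = M)) else 0)"

lemma valid_lgraph: "valid_ends (nverts X) (ends (mset (edges X)))"
  by transfer (auto simp: is_lgraph_iff)

lemma gen_eqI: "nverts X = nverts Y \<Longrightarrow> mset (edges X) = mset (edges Y) \<Longrightarrow> gen X = gen Y"
  by (rule gen_same) (simp add: same_or_lgraph_def)

lemma nverts_Abs: "is_lgraph (n, es) \<Longrightarrow> nverts (Abs_lgraph (n, es)) = n"
  by (simp add: nverts.rep_eq Abs_lgraph_inverse)
lemma edges_Abs: "is_lgraph (n, es) \<Longrightarrow> edges (Abs_lgraph (n, es)) = es"
  by (simp add: edges.rep_eq Abs_lgraph_inverse)

lemma mset_SOME: "mset (SOME es. mset es = M) = M"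
  by (metis (mono_tags, lifting) ex_mset someI_ex)

lemma genm_graph:
  assumes "valid_ends n (ends M)"
  obtains X where "nverts X = n" "mset (edges X) = M" "genm n M = gen X"
  using assms mset_SOME[of M]
  by (intro that[of "Abs_lgraph (n, SOME es. mset es = M)"])
     (simp_all add: genm_def nverts_Abs edges_Abs is_lgraph_iff)

lemma gen_genm: "gen X = genm (nverts X) (mset (edges X))"
proof -
  obtain Y where "nverts Y = nverts X" "mset (edges Y) = mset (edges X)"
    and "genm (nverts X) (mset (edges X)) = (gen Y :: 'a graph_space)"
    using genm_graph[OF valid_lgraph] by blast
  then show ?thesis using gen_eqI[of X Y] by simp
qed

lemma nverts_simps [simp]:
  "nverts (relabel \<sigma> X) = nverts X" "nverts (rev_arrow i X) = nverts X" "nverts (cut_glue X h k) = nverts X"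
  by (transfer; auto split: prod.splits)+

lemma edges_relabel: "\<sigma> permutes {1..nverts X} \<Longrightarrow> edges (relabel \<sigma> X) = map (map_prod \<sigma> \<sigma>) (edges X)"
  by transfer (auto split: prod.splits)

lemma edges_rev: "i < length (edges X) \<Longrightarrow> edges (rev_arrow i X) = (edges X)[i := prod.swap (edges X ! i)]"
  by transfer (auto split: prod.splits)

lemma mset_edges_rev: "i < length (edges X) \<Longrightarrow>
  mset (edges (rev_arrow i X)) = add_mset (prod.swap (edges X ! i)) (mset (edges X) - {#edges X ! i#})"
  by (simp add: edges_rev mset_update)

lemma genm_rev: "genm n (add_mset (v, u) M) = - genm n (add_mset (u, v) M)"
proof (cases "valid_ends n (ends (add_mset (u, v) M))")
  case True
  obtain X where X: "nverts X = n" "mset (edges X) = add_mset (u, v) M"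
    "genm n (add_mset (u, v) M) = (gen X :: 'a graph_space)"
    using genm_graph[OF True] by blast
  have "(u, v) \<in> set (edges X)" using X(2) by (metis set_mset_mset union_single_eq_member)
  then obtain i where i: "i < length (edges X)" "edges X ! i = (u, v)" by (metis in_set_conv_nth)
  have "gen X = - gen (rev_arrow i X)"
    by (rule gen_opp) (use i in \<open>auto simp: opp_or_lgraph_def\<close>)
  moreover have "gen (rev_arrow i X) = genm n (add_mset (v, u) M)"
    by (subst gen_genm) (simp add: X i mset_edges_rev)
  ultimately show ?thesis using X(3) by (metis minus_minus)
next
  case False
  moreover have "ends (add_mset (v, u) M) = ends (add_mset (u, v) M)" by (simp add: add_mset_commute)
  ultimately show ?thesis by (simp only: genm_def if_False minus_zero)
qed

lemma genm_transpose:
  assumes "a \<in> {1..n}" "b \<in> {1..n}" "a \<noteq> b"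
  shows "genm n (image_mset (map_prod (transpose a b) (transpose a b)) M) = - genm n M"
proof (cases "valid_ends n (ends M)")
  case True
  obtain X where X: "nverts X = n" "mset (edges X) = M" "genm n M = (gen X :: 'a graph_space)"
    using genm_graph[OF True] by blast
  have "gen X = - gen (relabel (transpose a b) X)"
    by (rule gen_opp) (use assms X in \<open>unfold opp_or_lgraph_def, blast\<close>)
  moreover have "transpose a b permutes {1..nverts X}" using assms X by (simp add: permutes_swap_id)
  then have "gen (relabel (transpose a b) X) = genm n (image_mset (map_prod (transpose a b) (transpose a b)) M)"
    by (subst gen_genm) (simp add: X edges_relabel)
  ultimately show ?thesis using X(3) by (metis minus_minus)
next
  case False
  moreover have "transpose a b permutes {1..n}" using assms by (simp add: permutes_swap_id)
  ultimately show ?thesis by (simp add: genm_def ends_image valid_ends_image)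
qed

lemma map_prod_image_comp:
  "image_mset (map_prod f f) (image_mset (map_prod g g) M) = image_mset (map_prod (f \<circ> g) (f \<circ> g)) M"
  by (simp add: multiset.map_comp map_prod.comp)

lemma genm_perm:
  assumes "\<sigma> permutes {1..n}"
  shows "genm n (image_mset (map_prod \<sigma> \<sigma>) M) = of_int (sign \<sigma>) \<bullet> (genm n M :: 'k::field_char_0 graph_space)"
  using assms finite_atLeastAtMost
proof (induction rule: permutes_induct)
  case id
  then show ?case by (simp add: prod.map_id0 map_prod.id)
next
  case (swap a b p)
  have "genm n (image_mset (map_prod (transpose a b \<circ> p) (transpose a b \<circ> p)) M)
      = - (genm n (image_mset (map_prod p p) M) :: 'k graph_space)"
    using genm_transpose[OF swap(1,2,3), of "image_mset (map_prod p p) M"]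
    by (simp only: map_prod_image_comp)
  moreover have "sign (transpose a b \<circ> p) = - sign p"
    using swap by (subst sign_compose)
      (auto simp: permutation_swap_id perm_permutation sign_swap_id)
  ultimately show ?case using swap(5) by (simp only: of_int_minus os.scale_minus_left)
qed

lemma loop_zero:
  assumes "i < length (edges X)" "fst (edges X ! i) = snd (edges X ! i)"
  shows "gen X = (0 :: 'k::field_char_0 graph_space)"
proof -
  obtain u where u: "edges X ! i = (u, u)" using assms(2) by (metis prod.collapse)
  have "mset (edges X) = add_mset (u, u) (mset (edges X) - {#(u, u)#})"
    using mset_update2(2)[OF assms(1)] u by simp
  then have "gen X = - (gen X :: 'k graph_space)"
    unfolding gen_genm[of X] using genm_rev by metis
  then have "(1 + 1 :: 'k) \<bullet> gen X = (0 :: 'k graph_space)"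
    unfolding os.scale_left_distrib by (metis add.left_inverse os.scale_one)
  then show ?thesis by simp
qed

definition collm :: "nat \<Rightarrow> (nat \<times> nat) multiset \<Rightarrow> nat \<Rightarrow> nat \<Rightarrow> 'k::field_char_0 graph_space" where
  "collm n M u v = (if u \<noteq> v \<and> u \<in> {1..n} \<and> v \<in> {1..n} then of_int (sign (to12 u v)) \<bullet>
     genm (n - 1) (image_mset (map_prod (merge12 \<circ> to12 u v) (merge12 \<circ> to12 u v)) M) else 0)"

lemma to12:
  assumes "u \<noteq> v" "u \<in> {1..n}" "v \<in> {1..n}"
  shows "to12 u v permutes {1..n}" "to12 u v u = 1" "to12 u v v = 2"
proof -
  have n: "1 \<in> {1..n}" "2 \<in> {1..n}" using assms by auto
  have c: "transpose 1 u v \<noteq> 1" "transpose 1 u v \<in> {1..n}"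
    using assms by (auto simp: transpose_def)
  show "to12 u v permutes {1..n}" unfolding to12_def
    using n c assms by (intro permutes_compose permutes_swap_id) auto
  show "to12 u v u = 1" "to12 u v v = 2" using c by (auto simp: to12_def)
qed

lemma merge12_transpose:
  assumes "a \<ge> 3" "b \<ge> 3"
  shows "merge12 \<circ> transpose a b = transpose (a - 1) (b - 1) \<circ> merge12"
  using assms by (auto simp: fun_eq_iff merge12_def transpose_def)

lemma genm_merge_perm:
  assumes "\<rho> permutes {3..n}"
  shows "genm (n - 1) (image_mset (map_prod (merge12 \<circ> \<rho>) (merge12 \<circ> \<rho>)) M)
    = of_int (sign \<rho>) \<bullet> (genm (n - 1) (image_mset (map_prod merge12 merge12) M) :: 'k::field_char_0 graph_space)"
  using assms finite_atLeastAtMost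
proof (induction rule: permutes_induct)
  case id
  then show ?case by simp
next
  case (swap a b p)
  have "genm (n - 1) (image_mset (map_prod (merge12 \<circ> (transpose a b \<circ> p)) (merge12 \<circ> (transpose a b \<circ> p))) M)
      = genm (n - 1) (image_mset (map_prod (transpose (a - 1) (b - 1)) (transpose (a - 1) (b - 1)))
          (image_mset (map_prod (merge12 \<circ> p) (merge12 \<circ> p)) M))"
    using merge12_transpose[of a b] swap(1,2) by (simp only: map_prod_image_comp o_assoc atLeastAtMost_iff)
  also have "\<dots> = - (genm (n - 1) (image_mset (map_prod (merge12 \<circ> p) (merge12 \<circ> p)) M) :: 'k graph_space)"
    using swap(1-3) by (intro genm_transpose) auto
  finally have 1: "genm (n - 1) (image_mset (map_prod (merge12 \<circ> (transpose a b \<circ> p)) (merge12 \<circ> (transpose a b \<circ> p))) M)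
    = - (genm (n - 1) (image_mset (map_prod (merge12 \<circ> p) (merge12 \<circ> p)) M) :: 'k graph_space)" .
  have "sign (transpose a b \<circ> p) = - sign p"
    using swap by (subst sign_compose)
      (auto simp: permutation_swap_id perm_permutation sign_swap_id)
  with 1 show ?case using swap(5) by (simp only: of_int_minus os.scale_minus_left)
qed

lemma collm_eq:
  assumes "u \<noteq> v" "u \<in> {1..n}" "v \<in> {1..n}" "\<sigma> permutes {1..n}" "\<sigma> u = 1" "\<sigma> v = 2"
  shows "collm n M u v = of_int (sign \<sigma>) \<bullet> (genm (n - 1) (image_mset (map_prod (merge12 \<circ> \<sigma>) (merge12 \<circ> \<sigma>)) M) :: 'k::field_char_0 graph_space)"
proof -
  note t = to12[OF assms(1-3)]
  define \<rho> where "\<rho> = to12 u v \<circ> inv \<sigma>"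
  have r: "\<rho> permutes {1..n}" unfolding \<rho>_def using t(1) assms(4) by (intro permutes_compose permutes_inv)
  have fix12: "\<rho> 1 = 1" "\<rho> 2 = 2"
    using t(2,3) assms(4-6) permutes_inverses(2)[OF assms(4)] unfolding \<rho>_def comp_def by metis+
  have r3: "\<rho> permutes {3..n}"
  proof (rule permutes_superset[OF r])
    fix x assume "x \<in> {1..n} - {3..n}"
    then have "x = 1 \<or> x = 2" by auto
    then show "\<rho> x = x" using fix12 by auto
  qed
  have e: "to12 u v = \<rho> \<circ> \<sigma>"
    unfolding \<rho>_def by (simp add: comp_assoc permutes_inv_o[OF assms(4)])
  have s: "sign (to12 u v) = sign \<rho> * sign \<sigma>"
    unfolding e using r assms(4) by (intro sign_compose) (auto intro: permutes_imp_permutation)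
  have "genm (n - 1) (image_mset (map_prod (merge12 \<circ> to12 u v) (merge12 \<circ> to12 u v)) M)
    = genm (n - 1) (image_mset (map_prod (merge12 \<circ> \<rho>) (merge12 \<circ> \<rho>)) (image_mset (map_prod \<sigma> \<sigma>) M))"
    by (simp only: map_prod_image_comp e comp_assoc)
  also have "\<dots> = of_int (sign \<rho>) \<bullet> (genm (n - 1) (image_mset (map_prod (merge12 \<circ> \<sigma>) (merge12 \<circ> \<sigma>)) M) :: 'k graph_space)"
    by (subst genm_merge_perm[OF r3]) (simp only: map_prod_image_comp)
  finally show ?thesis using assms(1-3) s sign_idempotent[of \<rho>]
    by (simp add: collm_def mult.commute mult.left_commute flip: of_int_mult)
qed

lemma collm_rev: "collm n M v u = - collm n M u v"
proof (cases "u \<noteq> v \<and> u \<in> {1..n} \<and> v \<in> {1..n}")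
  case True
  note t = to12[of u v n]
  have "transpose 1 2 permutes {1..n}" using True by (intro permutes_swap_id) auto
  then have p: "transpose 1 2 \<circ> to12 u v permutes {1..n}" using True t by (intro permutes_compose) auto
  have "merge12 \<circ> transpose 1 2 = merge12" by (auto simp: fun_eq_iff merge12_def transpose_def)
  then have m: "merge12 \<circ> (transpose 1 2 \<circ> to12 u v) = merge12 \<circ> to12 u v" by (metis comp_assoc)
  have s: "sign (transpose 1 2 \<circ> to12 u v) = - sign (to12 u v)"
    using True t by (subst sign_compose)
      (auto simp: permutation_swap_id sign_swap_id perm_permutation)
  show ?thesis using True t
    by (subst collm_eq[OF _ _ _ p]) (simp_all only: m s, auto simp: collm_def)
next
  case False
  then show ?thesis by (auto simp: collm_def)
qed

lemma collm_rev_other: "collm n (add_mset (b, a) M) u v = - collm n (add_mset (a, b) M) u v"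
  by (simp add: collm_def genm_rev[of _ "merge12 (to12 u v b)"])

lemma collm_perm:
  assumes "\<pi> permutes {1..n}"
  shows "collm n (image_mset (map_prod \<pi> \<pi>) M) (\<pi> u) (\<pi> v) = of_int (sign \<pi>) \<bullet> collm n M u v"
proof (cases "u \<noteq> v \<and> u \<in> {1..n} \<and> v \<in> {1..n}")
  case True
  note t = to12[of u v n]
  have inj: "\<pi> u \<noteq> \<pi> v" using True permutes_inj[OF assms] by (auto simp: inj_eq)
  have ran: "\<pi> u \<in> {1..n}" "\<pi> v \<in> {1..n}" using True permutes_in_image[OF assms] by auto
  have p: "to12 u v \<circ> inv \<pi> permutes {1..n}" using True t assms by (intro permutes_compose permutes_inv) auto
  have pp: "(to12 u v \<circ> inv \<pi>) (\<pi> u) = 1" "(to12 u v \<circ> inv \<pi>) (\<pi> v) = 2"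
    using t True permutes_inverses(2)[OF assms] by auto
  have s: "sign (to12 u v \<circ> inv \<pi>) = sign \<pi> * sign (to12 u v)"
    using True t assms by (subst sign_compose)
      (auto simp: sign_inverse perm_permutation perm_permutation[OF permutes_inv])
  have c: "merge12 \<circ> (to12 u v \<circ> inv \<pi>) \<circ> \<pi> = merge12 \<circ> to12 u v"
    by (simp add: comp_assoc permutes_inv_o[OF assms])
  show ?thesis
    unfolding collm_eq[OF inj ran p pp] map_prod_image_comp s c
    using True by (simp add: collm_def)
next
  case False
  then have "\<not> (\<pi> u \<noteq> \<pi> v \<and> \<pi> u \<in> {1..n} \<and> \<pi> v \<in> {1..n})"
    using permutes_in_image[OF assms] by auto
  then show ?thesis using False by (auto simp: collm_def)
qed

lemma edge_in: "i < length (edges X) \<Longrightarrow> fst (edges X ! i) \<in> {1..nverts X} \<and> snd (edges X ! i) \<in> {1..nverts X}"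
  by transfer (auto simp: is_lgraph_def dest!: nth_mem)

lemma contract12_simps:
  assumes "i < length (edges X)" "edges X ! i = (1, 2)"
  shows "nverts (contract12 i X) = nverts X - 1"
    "edges (contract12 i X) = map (map_prod merge12 merge12) (remove_nth i (edges X))"
  using assms by (transfer; auto split: prod.splits)+

lemma image_mset_diff_single: "e \<in># M \<Longrightarrow> image_mset f M - {#f e#} = image_mset f (M - {#e#})"
  by (simp add: image_mset_Diff)

lemma collapse_collm:
  assumes "i < length (edges X)" "fst (edges X ! i) \<noteq> snd (edges X ! i)"
  shows "collapse X i = collm (nverts X) (mset (edges X) - {#edges X ! i#}) (fst (edges X ! i)) (snd (edges X ! i))"
proof -
  define u v where "u = fst (edges X ! i)" and "v = snd (edges X ! i)"
  have uv: "edges X ! i = (u, v)" "u \<noteq> v" "u \<in> {1..nverts X}" "v \<in> {1..nverts X}"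
    using edge_in[OF assms(1)] assms(2) by (auto simp: u_def v_def)
  note t = to12[OF uv(2-4)]
  let ?Y = "relabel (to12 u v) X"
  have e: "edges ?Y = map (map_prod (to12 u v) (to12 u v)) (edges X)"
    by (rule edges_relabel) (use t in simp)
  have i: "i < length (edges ?Y)" "edges ?Y ! i = (1, 2)" using assms t uv by (auto simp: e)
  have "mset (edges (contract12 i ?Y)) = image_mset (map_prod (merge12 \<circ> to12 u v) (merge12 \<circ> to12 u v)) (mset (edges X) - {#(u, v)#})"
  proof -
    have "(u, v) \<in># mset (edges X)" using assms(1) uv(1) by (metis nth_mem set_mset_mset)
    then have "mset (edges ?Y) - {#(1, 2)#} = image_mset (map_prod (to12 u v) (to12 u v)) (mset (edges X) - {#(u, v)#})"
      using image_mset_diff_single[of "(u, v)" "mset (edges X)" "map_prod (to12 u v) (to12 u v)"] t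
      by (simp add: e)
    then show ?thesis
      using i by (simp add: contract12_simps[OF i] mset_remove_nth map_prod_image_comp)
  qed
  then have "gen (contract12 i ?Y) = genm (nverts X - 1) (image_mset (map_prod (merge12 \<circ> to12 u v) (merge12 \<circ> to12 u v)) (mset (edges X) - {#(u, v)#}))"
    by (subst gen_genm) (simp add: contract12_simps[OF i])
  then show ?thesis using uv by (simp add: collapse_def collm_def Let_def)
qed

definition dEm :: "nat \<Rightarrow> (nat \<times> nat) multiset \<Rightarrow> 'k::field_char_0 graph_space" where
  "dEm n M = (\<Sum>e\<in>#M. collm n (M - {#e#}) (fst e) (snd e))"

lemma sum_mset_scale: "(\<Sum>x\<in>#A. c \<bullet> g x) = c \<bullet> (\<Sum>x\<in>#A. g x :: ('a::oriented, 'k::field_char_0) ospace)"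
  by (induction A) (auto simp: os.scale_right_distrib)

lemma sum_mset_negf: "(\<Sum>x\<in>#A. - g x) = - (\<Sum>x\<in>#A. g x :: 'a::ab_group_add)"
  by (induction A) auto

lemma sum_index_mset: "(\<Sum>i<length xs. f (xs ! i)) = (\<Sum>x\<in>#mset xs. f x)"
  by (metis (no_types, lifting) atLeast0LessThan sum.cong sum_list_sum_nth sum_mset_sum_list length_map mset_map nth_map lessThan_iff)

lemma boundary_E_gen_dEm: "boundary_E_gen X = dEm (nverts X) (mset (edges X))"
proof -
  let ?c = "\<lambda>e. collm (nverts X) (mset (edges X) - {#e#}) (fst e) (snd e)"
  have "boundary_E_gen X = (\<Sum>i | i < length (edges X) \<and> fst (edges X ! i) \<noteq> snd (edges X ! i). ?c (edges X ! i))"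
    unfolding boundary_E_gen_def by (rule sum.cong) (auto simp: collapse_collm)
  also have "\<dots> = (\<Sum>i<length (edges X). ?c (edges X ! i))"
    by (rule sum.mono_neutral_left) (auto simp: collm_def)
  finally show ?thesis unfolding dEm_def by (simp only: sum_index_mset[of ?c])
qed

lemma add_diff_comm:
  assumes "e \<in># M" shows "add_mset p M - {#e#} = add_mset p (M - {#e#})"
proof -
  obtain N where "M = add_mset e N" using assms by (rule multi_member_split[THEN exE])
  then show ?thesis by (simp add: add_mset_commute[of p e])
qed

lemma dEm_rev: "dEm n (add_mset (v, u) M) = - dEm n (add_mset (u, v) M)"
proof -
  have "(\<Sum>e\<in>#M. collm n (add_mset (v, u) M - {#e#}) (fst e) (snd e))
      = (\<Sum>e\<in>#M. - collm n (add_mset (u, v) M - {#e#}) (fst e) (snd e))"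
    by (intro arg_cong[of _ _ sum_mset] image_mset_cong) (simp add: add_diff_comm collm_rev_other[of n v])
  then show ?thesis by (simp add: dEm_def collm_rev[of n M v] sum_mset_negf)
qed


lemma dEm_perm:
  assumes "\<pi> permutes {1..n}"
  shows "dEm n (image_mset (map_prod \<pi> \<pi>) M) = of_int (sign \<pi>) \<bullet> dEm n M"
proof -
  have "dEm n (image_mset (map_prod \<pi> \<pi>) M) =
      (\<Sum>e\<in>#M. collm n (image_mset (map_prod \<pi> \<pi>) M - {#map_prod \<pi> \<pi> e#}) (\<pi> (fst e)) (\<pi> (snd e)))"
    by (simp add: dEm_def multiset.map_comp comp_def)
  also have "\<dots> = (\<Sum>e\<in>#M. of_int (sign \<pi>) \<bullet> collm n (M - {#e#}) (fst e) (snd e))"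
    by (intro arg_cong[of _ _ sum_mset] image_mset_cong)
       (simp only: image_mset_diff_single collm_perm[OF assms])
  also have "\<dots> = of_int (sign \<pi>) \<bullet> dEm n M"
    unfolding dEm_def by (rule sum_mset_scale)
  finally show ?thesis .
qed

lemma or_respects_lgraphI:
  assumes "\<And>X. \<phi> X = F (nverts X) (mset (edges X))"
    and "\<And>n M u v. valid_ends n (ends (add_mset (u, v) M)) \<Longrightarrow> F n (add_mset (v, u) M) = - F n (add_mset (u, v) M)"
    and "\<And>n M a b. a \<in> {1..n} \<Longrightarrow> b \<in> {1..n} \<Longrightarrow> a \<noteq> b \<Longrightarrow> valid_ends n (ends M) \<Longrightarrow>
      F n (image_mset (map_prod (transpose a b) (transpose a b)) M) = - F n M"
  shows "or_respects \<phi>"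
  unfolding or_respects_def
proof (intro conjI allI impI)
  fix X Y :: lgraph
  assume "same_or X Y" then show "\<phi> X = \<phi> Y" by (simp add: assms(1) same_or_lgraph_def)
next
  fix X Y :: lgraph
  assume "opp_or X Y"
  then consider i where "i < length (edges X)" "Y = rev_arrow i X"
    | a b where "a \<in> {1..nverts X}" "b \<in> {1..nverts X}" "a \<noteq> b" "Y = relabel (transpose a b) X"
    unfolding opp_or_lgraph_def by blast
  then show "\<phi> X = - \<phi> Y"
  proof cases
    case 1
    obtain u v where uv: "edges X ! i = (u, v)" by fastforce
    have "\<phi> X = F (nverts X) (add_mset (u, v) (mset (edges X) - {#(u, v)#}))"
      using mset_update2(2)[OF 1(1)] uv by (simp add: assms(1))
    moreover have "valid_ends (nverts X) (ends (add_mset (u, v) (mset (edges X) - {#(u, v)#})))"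
      using mset_update2(2)[OF 1(1)] uv valid_lgraph[of X] by metis
    moreover have "\<phi> Y = F (nverts X) (add_mset (v, u) (mset (edges X) - {#(u, v)#}))"
      using 1 uv by (simp add: assms(1) mset_edges_rev)
    ultimately show ?thesis using assms(2) by (metis minus_minus)
  next
    case 2
    have "transpose a b permutes {1..nverts X}" using 2 by (simp add: permutes_swap_id)
    then have "\<phi> Y = F (nverts X) (image_mset (map_prod (transpose a b) (transpose a b)) (mset (edges X)))"
      by (simp add: assms(1) 2 edges_relabel)
    then show ?thesis using assms(3)[OF 2(1-3) valid_lgraph] by (simp add: assms(1))
  qed
qed

lemma boundary_E_respects: "or_respects boundary_E_gen"
proof (rule or_respects_lgraphI)
  show "boundary_E_gen X = dEm (nverts X) (mset (edges X))" for X by (rule boundary_E_gen_dEm)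
  show "dEm n (add_mset (v, u) M) = - dEm n (add_mset (u, v) M)" for n u v M by (rule dEm_rev)
  show "dEm n (image_mset (map_prod (transpose a b) (transpose a b)) M) = - dEm n M"
    if "a \<in> {1..n}" "b \<in> {1..n}" "a \<noteq> b" for n a b M
    using dEm_perm[of "transpose a b" n M] that by (simp add: permutes_swap_id sign_swap_id)
qed

definition hpair :: "bool \<Rightarrow> nat \<times> nat \<Rightarrow> nat \<times> nat" where
  "hpair b e = (if b then e else prod.swap e)"

definition dHK :: "nat \<Rightarrow> (nat \<times> nat) multiset \<Rightarrow> nat \<times> nat \<Rightarrow> nat \<times> nat \<Rightarrow> 'k::field_char_0 graph_space" where
  "dHK n N h k = collm n (add_mset (snd k, snd h) N) (fst h) (fst k)"

definition bsgn :: "bool \<Rightarrow> 'k::field_char_0" where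
  "bsgn b = (if b then 1 else -1)"

definition dHG :: "nat \<Rightarrow> (nat \<times> nat) multiset \<Rightarrow> nat \<times> nat \<Rightarrow> nat \<times> nat \<Rightarrow> 'k::field_char_0 graph_space" where
  "dHG n N e f = (\<Sum>b\<in>UNIV. \<Sum>c\<in>UNIV. (- bsgn b * bsgn c) \<bullet> dHK n N (hpair b e) (hpair c f))"

definition dHm :: "nat \<Rightarrow> (nat \<times> nat) multiset \<Rightarrow> 'k::field_char_0 graph_space" where
  "dHm n M = (\<Sum>e\<in>#M. \<Sum>f\<in>#M - {#e#}. dHG n (M - {#e, f#}) e f)"

lemma dHK_sym: "dHK n N k h = dHK n N h k"
  unfolding dHK_def by (subst collm_rev_other, subst collm_rev) simp

lemma dHG_sym: "dHG n N e f = dHG n N f e"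
  unfolding dHG_def by (subst sum.swap) (simp add: dHK_sym[of n N "hpair _ e"] mult.commute)

lemma dHG_swap1: "dHG n N (prod.swap e) f = - dHG n N e f"
  by (simp add: dHG_def UNIV_bool bsgn_def hpair_def)

lemma dHG_swap2: "dHG n N e (prod.swap f) = - dHG n N e f"
  using dHG_swap1 dHG_sym by metis

lemma dHG_rev: "dHG n (add_mset (v, u) N) e f = - (dHG n (add_mset (u, v) N) e f :: 'k::field_char_0 graph_space)"
proof -
  have "dHK n (add_mset (v, u) N) h k = - (dHK n (add_mset (u, v) N) h k :: 'k graph_space)" for h k
    unfolding dHK_def by (subst (1 2) add_mset_commute) (rule collm_rev_other)
  then show ?thesis by (simp only: dHG_def sum_negf os.scale_minus_right)
qed

lemma dHG_perm:
  assumes "\<pi> permutes {1..n}"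
  shows "dHG n (image_mset (map_prod \<pi> \<pi>) N) (map_prod \<pi> \<pi> e) (map_prod \<pi> \<pi> f) = of_int (sign \<pi>) \<bullet> (dHG n N e f :: 'k::field_char_0 graph_space)"
proof -
  have h: "hpair b (map_prod \<pi> \<pi> e) = map_prod \<pi> \<pi> (hpair b e)" for b e
    by (cases e) (auto simp: hpair_def)
  have "dHK n (image_mset (map_prod \<pi> \<pi>) N) (map_prod \<pi> \<pi> h) (map_prod \<pi> \<pi> k) = of_int (sign \<pi>) \<bullet> (dHK n N h k :: 'k graph_space)" for h k
    using collm_perm[OF assms, of "add_mset (snd k, snd h) N"] by (simp add: dHK_def)
  then show ?thesis unfolding dHG_def h
    by (simp add: os.scale_sum_right mult.commute)
qed

lemma add_diff_comm2: "e \<in># M \<Longrightarrow> f \<in># M - {#e#} \<Longrightarrow> add_mset p M - {#e, f#} = add_mset p (M - {#e, f#})"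
proof -
  assume a: "e \<in># M" "f \<in># M - {#e#}"
  have 2: "A - {#e, f#} = A - {#e#} - {#f#}" for A
    by (simp add: add_mset_commute)
  show ?thesis unfolding 2 using add_diff_comm[of e M p] add_diff_comm[of f "M - {#e#}" p] a by metis
qed

lemma sum_mset_cong: "(\<And>x. x \<in># M \<Longrightarrow> f x = g x) \<Longrightarrow> (\<Sum>x\<in>#M. f x) = (\<Sum>x\<in>#M. g x)"
  by (metis image_mset_cong)

lemma dHm_add: "dHm n (add_mset p M) = (\<Sum>f\<in>#M. dHG n (M - {#f#}) p f) + (\<Sum>e\<in>#M. dHG n (M - {#e#}) e p)
    + (\<Sum>e\<in>#M. \<Sum>f\<in>#M - {#e#}. dHG n (add_mset p (M - {#e, f#})) e f)"
proof -
  have "(\<Sum>e\<in>#M. \<Sum>f\<in>#add_mset p M - {#e#}. dHG n (add_mset p M - {#e, f#}) e f)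
    = (\<Sum>e\<in>#M. dHG n (M - {#e#}) e p + (\<Sum>f\<in>#M - {#e#}. dHG n (add_mset p (M - {#e, f#})) e f))"
  proof (rule sum_mset_cong)
    fix e assume e: "e \<in># M"
    have "(\<Sum>f\<in>#M - {#e#}. dHG n (add_mset p M - {#e, f#}) e f) = (\<Sum>f\<in>#M - {#e#}. dHG n (add_mset p (M - {#e, f#})) e f)"
      using e by (intro sum_mset_cong) (simp only: add_diff_comm2)
    then show "(\<Sum>f\<in>#add_mset p M - {#e#}. dHG n (add_mset p M - {#e, f#}) e f) =
      dHG n (M - {#e#}) e p + (\<Sum>f\<in>#M - {#e#}. dHG n (add_mset p (M - {#e, f#})) e f)"
      using e by (simp add: add_diff_comm add_mset_commute[of e p])
  qed
  then show ?thesis by (simp add: dHm_def sum_mset.distrib add.assoc)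
qed

lemma dHG_swap1': "dHG n N (v, u) f = - dHG n N (u, v) f"
  using dHG_swap1[of n N "(u, v)" f] by simp
lemma dHG_swap2': "dHG n N e (v, u) = - dHG n N e (u, v)"
  using dHG_swap2[of n N e "(u, v)"] by simp

lemma dHm_rev: "dHm n (add_mset (v, u) M) = - (dHm n (add_mset (u, v) M) :: 'k::field_char_0 graph_space)"
  unfolding dHm_add
  by (simp only: sum_mset_negf dHG_rev[of n v u] dHG_swap1'[of n _ v u] dHG_swap2'[of n _ _ v u] minus_add_distrib)

lemma dHm_perm:
  assumes "\<pi> permutes {1..n}"
  shows "dHm n (image_mset (map_prod \<pi> \<pi>) M) = of_int (sign \<pi>) \<bullet> dHm n M"
proof -
  let ?p = "map_prod \<pi> \<pi>"
  have "dHm n (image_mset ?p M) = (\<Sum>e\<in>#M. \<Sum>f\<in>#image_mset ?p M - {#?p e#}. dHG n (image_mset ?p M - {#?p e, f#}) (?p e) f)"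
    by (simp add: dHm_def multiset.map_comp comp_def)
  also have "\<dots> = (\<Sum>e\<in>#M. \<Sum>f\<in>#M - {#e#}. of_int (sign \<pi>) \<bullet> dHG n (M - {#e, f#}) e f)"
  proof (rule sum_mset_cong)
    fix e assume e: "e \<in># M"
    have "(\<Sum>f\<in>#image_mset ?p M - {#?p e#}. dHG n (image_mset ?p M - {#?p e, f#}) (?p e) f)
      = (\<Sum>f\<in>#M - {#e#}. dHG n (image_mset ?p M - {#?p e, ?p f#}) (?p e) (?p f))"
      using e by (simp add: image_mset_diff_single multiset.map_comp comp_def)
    also have "\<dots> = (\<Sum>f\<in>#M - {#e#}. dHG n (image_mset ?p (M - {#e, f#})) (?p e) (?p f))"
    proof (rule sum_mset_cong)
      fix f assume "f \<in># M - {#e#}"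
      then have "{#e, f#} \<subseteq># M" using e by (metis insert_DiffM insert_subset_eq_iff single_subset_iff)
      then have "image_mset ?p M - {#?p e, ?p f#} = image_mset ?p (M - {#e, f#})"
        by (subst image_mset_Diff) auto
      then show "dHG n (image_mset ?p M - {#?p e, ?p f#}) (?p e) (?p f) = dHG n (image_mset ?p (M - {#e, f#})) (?p e) (?p f)"
        by simp
    qed
    finally show "(\<Sum>f\<in>#image_mset ?p M - {#?p e#}. dHG n (image_mset ?p M - {#?p e, f#}) (?p e) f)
       = (\<Sum>f\<in>#M - {#e#}. of_int (sign \<pi>) \<bullet> dHG n (M - {#e, f#}) e f)"
      by (simp only: dHG_perm[OF assms])
  qed
  also have "\<dots> = of_int (sign \<pi>) \<bullet> dHm n M"
    by (simp only: sum_mset_scale dHm_def)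
  finally show ?thesis .
qed

lemma edges_cut_glue:
  assumes "fst h < length (edges X)" "fst k < length (edges X)" "fst h \<noteq> fst k"
  shows "edges (cut_glue X h k) = (edges X)[fst h := (hvert (edges X) h, hvert (edges X) k),
     fst k := (hvert (edges X) (hbar k), hvert (edges X) (hbar h))]"
  using assms by transfer (auto split: prod.splits)

lemma hh_collapse_dHK:
  assumes "fst h < length (edges X)" "fst k < length (edges X)" "fst h \<noteq> fst k"
  shows "hh_collapse X h k = (- bsgn (snd h) * bsgn (snd k) :: 'k::field_char_0) \<bullet>
    dHK (nverts X) (mset (edges X) - {#edges X ! fst h, edges X ! fst k#})
      (hpair (snd h) (edges X ! fst h)) (hpair (snd k) (edges X ! fst k))"
proof -
  let ?E = "edges X" let ?h = "hvert ?E h" let ?k = "hvert ?E k"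
  have v: "fst (hpair (snd h) (?E ! fst h)) = hvert ?E h" "snd (hpair (snd h) (?E ! fst h)) = hvert ?E (hbar h)" for h
    by (auto simp: hpair_def hvert_def hbar_def)
  have sg: "cut_sign h k = (- bsgn (snd h) * bsgn (snd k) :: 'k)" by (simp add: cut_sign_def bsgn_def)
  have e: "edges (cut_glue X h k) ! fst h = (?h, ?k)" "fst h < length (edges (cut_glue X h k))"
    using assms by (simp_all add: edges_cut_glue)
  have m: "mset (edges (cut_glue X h k)) - {#(?h, ?k)#} =
      add_mset (hvert ?E (hbar k), hvert ?E (hbar h)) (mset ?E - {#?E ! fst h, ?E ! fst k#})"
    unfolding edges_cut_glue[OF assms] mset_update_two(1)[OF assms] by simp
  show ?thesis
  proof (cases "?h = ?k")
    case True
    then show ?thesis by (simp add: hh_collapse_def dHK_def v collm_def)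
  next
    case False
    have "collapse (cut_glue X h k) (fst h) = (collm (nverts X)
      (add_mset (hvert ?E (hbar k), hvert ?E (hbar h)) (mset ?E - {#?E ! fst h, ?E ! fst k#})) ?h ?k :: 'k graph_space)"
      using collapse_collm[OF e(2)] False by (simp add: e m)
    then show ?thesis using False by (simp add: hh_collapse_def dHK_def v sg)
  qed
qed

lemma hh_collapse_sym:
  assumes "h \<in> half_edges X" "k \<in> half_edges X" "fst h \<noteq> fst k"
  shows "hh_collapse X h k = hh_collapse X k h"
proof -
  have l: "fst h < length (edges X)" "fst k < length (edges X)" using assms by (auto simp: half_edges_def)
  show ?thesis
    unfolding hh_collapse_dHK[OF l assms(3)] hh_collapse_dHK[OF l(2,1) assms(3)[symmetric]]
    by (subst dHK_sym) (simp add: add_mset_commute mult.commute)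
qed

lemma double_boundary_H_gen: "2 \<bullet> boundary_H_gen X = dHm (nverts X) (mset (edges X))"
proof -
  let ?E = "edges X" let ?m = "length ?E"
  let ?G = "\<lambda>e f. dHG (nverts X) (mset ?E - {#e, f#}) e f :: 'a graph_space"
  define f where "f = (\<lambda>(h, k). hh_collapse X h k :: 'a graph_space)"
  define P where "P = {(h, k). h \<in> half_edges X \<and> k \<in> half_edges X \<and> fst h < fst k}"
  define Q where "Q = {(h, k). h \<in> half_edges X \<and> k \<in> half_edges X \<and> fst k < fst h}"
  have finH: "finite (half_edges X)" by (simp add: half_edges_def)
  have fin: "finite P" "finite Q"
    by (rule finite_subset[of _ "half_edges X \<times> half_edges X"], auto simp: P_def Q_def finH)+
  have sw: "sum f Q = sum f P"
    by (rule sum.reindex_bij_witness[of _ prod.swap prod.swap])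
       (auto simp: P_def Q_def f_def hh_collapse_sym)
  have "2 \<bullet> boundary_H_gen X = sum f P + sum f Q"
    unfolding sw using os.scale_left_distrib[of 1 1 "sum f P"] by (simp add: boundary_H_gen_def f_def P_def)
  also have "\<dots> = sum f (P \<union> Q)"
    using fin by (intro sum.union_disjoint[symmetric]) (auto simp: P_def Q_def)
  also have "P \<union> Q = (\<lambda>((i, j), (b, c)). ((i, b), (j, c))) ` ({(i, j). i < ?m \<and> j < ?m \<and> i \<noteq> j} \<times> UNIV)"
    by (auto simp: P_def Q_def half_edges_def image_def)
  also have "sum f \<dots> = (\<Sum>((i, j), (b, c))\<in>{(i, j). i < ?m \<and> j < ?m \<and> i \<noteq> j} \<times> UNIV. hh_collapse X (i, b) (j, c))"
    by (subst sum.reindex) (auto simp: inj_on_def f_def intro!: sum.cong)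
  also have "\<dots> = (\<Sum>(i, j)\<in>{(i, j). i < ?m \<and> j < ?m \<and> i \<noteq> j}. \<Sum>(b, c)\<in>UNIV. hh_collapse X (i, b) (j, c))"
    by (simp only: sum.cartesian_product split_def)
  also have "\<dots> = (\<Sum>(i, j)\<in>{(i, j). i < ?m \<and> j < ?m \<and> i \<noteq> j}. ?G (?E ! i) (?E ! j))"
  proof (intro sum.cong refl, clarify)
    fix i j assume "i < ?m" "j < ?m" "i \<noteq> j"
    then show "(\<Sum>(b, c)\<in>UNIV. hh_collapse X (i, b) (j, c)) = ?G (?E ! i) (?E ! j)"
      unfolding dHG_def sum.cartesian_product UNIV_Times_UNIV
      by (intro sum.cong) (auto simp: hh_collapse_dHK)
  qed
  also have "{(i, j). i < ?m \<and> j < ?m \<and> i \<noteq> j} = Sigma {..<?m} (\<lambda>i. {..<?m} - {i})"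
    by auto
  also have "(\<Sum>(i, j)\<in>\<dots>. ?G (?E ! i) (?E ! j)) = (\<Sum>i<?m. \<Sum>j\<in>{..<?m} - {i}. ?G (?E ! i) (?E ! j))"
    by (subst sum.Sigma) auto
  also have "\<dots> = (\<Sum>i<?m. (\<Sum>j<?m. ?G (?E ! i) (?E ! j)) - ?G (?E ! i) (?E ! i))"
    by (intro sum.cong refl) (simp add: sum_diff1)
  also have "\<dots> = (\<Sum>i<?m. (\<lambda>e. (\<Sum>f\<in>#mset ?E. ?G e f) - ?G e e) (?E ! i))"
    by (intro sum.cong refl) (simp only: sum_index_mset[of "?G _"])
  also have "\<dots> = (\<Sum>e\<in>#mset ?E. (\<Sum>f\<in>#mset ?E. ?G e f) - ?G e e)"
    by (rule sum_index_mset)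
  also have "\<dots> = dHm (nverts X) (mset ?E)"
    unfolding dHm_def
  proof (rule sum_mset_cong)
    fix e assume "e \<in># mset ?E"
    then show "(\<Sum>f\<in>#mset ?E. ?G e f) - ?G e e = (\<Sum>f\<in>#mset ?E - {#e#}. ?G e f)"
      by (metis (no_types, lifting) add_diff_cancel_left' image_mset_add_mset insert_DiffM sum_mset.insert)
  qed
  finally show ?thesis .
qed

lemma boundary_H_gen_dHm: "boundary_H_gen X = inverse 2 \<bullet> (dHm (nverts X) (mset (edges X)) :: 'k::field_char_0 graph_space)"
  using double_boundary_H_gen[of X] by (metis field_class.field_inverse os.scale_one os.scale_scale zero_neq_numeral)

lemma boundary_H_respects: "or_respects (boundary_H_gen :: lgraph \<Rightarrow> 'k::field_char_0 graph_space)"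
proof (rule or_respects_lgraphI)
  let ?F = "\<lambda>n M. inverse 2 \<bullet> (dHm n M :: 'k graph_space)"
  show "boundary_H_gen X = ?F (nverts X) (mset (edges X))" for X by (rule boundary_H_gen_dHm)
  show "?F n (add_mset (v, u) M) = - ?F n (add_mset (u, v) M)" for n u v M
    by (simp add: dHm_rev[of n v u])
  show "?F n (image_mset (map_prod (transpose a b) (transpose a b)) M) = - ?F n M"
    if "a \<in> {1..n}" "b \<in> {1..n}" "a \<noteq> b" for n a b M
  proof -
    have "dHm n (image_mset (map_prod (transpose a b) (transpose a b)) M) = - (dHm n M :: 'k graph_space)"
      using dHm_perm[of "transpose a b" n M] that by (simp add: permutes_swap_id sign_swap_id)
    then show ?thesis by simp
  qed
qed

definition gprod :: "'k::field_char_0 graph_space \<Rightarrow> 'k graph_space \<Rightarrow> 'k graph_space" (infixl "\<odot>" 74) where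
  "x \<odot> y = bilift (\<lambda>X Y. gen (gunion X Y)) x y"

definition gone :: "'k::field_char_0 graph_space" where
  "gone = gen gempty"

definition gconnected :: "lgraph \<Rightarrow> bool" where
  "gconnected X \<longleftrightarrow> nverts X > 0 \<and>
     (\<forall>u\<in>{1..nverts X}. \<forall>v\<in>{1..nverts X}. (u, v) \<in> (set (edges X) \<union> (set (edges X))\<inverse>)\<^sup>*)"

definition tprod :: "'k::field_char_0 graph_space2 \<Rightarrow> 'k graph_space2 \<Rightarrow> 'k graph_space2" where
  "tprod = bilift (\<lambda>(X, Y) (Z, W). (-1) ^ (nverts Y * nverts Z) \<bullet> gen (gunion X Z, gunion Y W))"

definition is_coproduct :: "('k::field_char_0 graph_space \<Rightarrow> 'k graph_space2) \<Rightarrow> bool" where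
  "is_coproduct D \<longleftrightarrow> olinear D \<and>
     D gone = gone \<otimes> gone \<and>
     (\<forall>X. gconnected X \<longrightarrow> D (gen X) = gen X \<otimes> gone + gone \<otimes> gen X) \<and>
     (\<forall>x y. D (x \<odot> y) = tprod (D x) (D y))"

text \<open>Existence and uniqueness are proved in \<open>ex1_coproduct\<close>.\<close>

definition coprod :: "'k::field_char_0 graph_space \<Rightarrow> 'k graph_space2" where
  "coprod = (THE D. is_coproduct D)"

definition boundary_E2 :: "'k::field_char_0 graph_space2 \<Rightarrow> 'k graph_space2" where
  "boundary_E2 = lin_ext (\<lambda>(X, Y). boundary_E (gen X) \<otimes> gen Y + (-1) ^ nverts X \<bullet> gen X \<otimes> boundary_E (gen Y))"

definition boundary_H2 :: "'k::field_char_0 graph_space2 \<Rightarrow> 'k graph_space2" where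
  "boundary_H2 = lin_ext (\<lambda>(X, Y). boundary_H (gen X) \<otimes> gen Y + (-1) ^ nverts X \<bullet> gen X \<otimes> boundary_H (gen Y))"

definition cobracket :: "'k::field_char_0 graph_space \<Rightarrow> 'k graph_space2" where
  "cobracket x = coprod (boundary_H x) - boundary_H2 (coprod x)"

lemma boundary_E_gen: "boundary_E (gen X) = boundary_E_gen X" and boundary_E_linear: "olinear boundary_E"
  by (simp_all add: boundary_E_def lin_ext_gen lin_ext_linear boundary_E_respects)
lemma boundary_H_gen: "boundary_H (gen X) = boundary_H_gen X" and boundary_H_linear: "olinear boundary_H"
  by (simp_all add: boundary_H_def lin_ext_gen lin_ext_linear boundary_H_respects)

lemma same_or_nverts: "same_or X Y \<Longrightarrow> nverts X = nverts Y"
  by (simp add: same_or_lgraph_def)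
lemma opp_or_nverts: "opp_or X Y \<Longrightarrow> nverts X = nverts Y"
  by (auto simp: opp_or_lgraph_def)

lemma or_respects_sign: "or_respects \<phi> \<Longrightarrow> or_respects (\<lambda>X. c (nverts X) \<bullet> \<phi> X)"
  by (auto simp: or_respects_def dest: same_or_nverts opp_or_nverts)

lemma or_respects_add: "or_respects \<phi> \<Longrightarrow> or_respects \<psi> \<Longrightarrow> or_respects (\<lambda>X. \<phi> X + \<psi> X)"
  by (simp add: or_respects_def)

lemma graded_tensor_respects:
  assumes "olinear d"
  shows "or_respects (\<lambda>(X, Y). d (gen X) \<otimes> gen Y + (-1) ^ nverts X \<bullet> gen X \<otimes> d (gen Y))"
proof (rule or_respects_prod, unfold or_respects2_def, intro conjI allI)
  have d: "or_respects (\<lambda>X. d (gen X))"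
    by (rule or_respects_linear[OF assms or_respects_gen])
  show "or_respects (\<lambda>Y. d (gen X) \<otimes> gen Y + (-1) ^ nverts X \<bullet> gen X \<otimes> d (gen Y))" for X
    by (intro or_respects_add or_respects_linear[OF tensor_linear2] or_respects_gen
        or_respects_linear[OF olinear_scale[OF olinear_id]] d)
  show "or_respects (\<lambda>X. d (gen X) \<otimes> gen Y + (-1) ^ nverts X \<bullet> gen X \<otimes> d (gen Y))" for Y
    by (intro or_respects_add or_respects_linear[OF tensor_linear1] or_respects_gen
        or_respects_sign d)
qed

lemma boundary_E2_linear: "olinear boundary_E2"
  unfolding boundary_E2_def by (intro lin_ext_linear graded_tensor_respects boundary_E_linear)

lemma boundary_H2_linear: "olinear boundary_H2"
  unfolding boundary_H2_def by (intro lin_ext_linear graded_tensor_respects boundary_H_linear)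

lemma boundary_E2_tensor: "boundary_E2 (gen X \<otimes> y) = boundary_E (gen X) \<otimes> y + (-1) ^ nverts X \<bullet> gen X \<otimes> boundary_E y"
proof -
  have "(\<lambda>y. boundary_E2 (gen X \<otimes> y)) = (\<lambda>y. boundary_E (gen X) \<otimes> y + (-1) ^ nverts X \<bullet> gen X \<otimes> boundary_E y)"
  proof (rule olinear_eqI)
    show "boundary_E2 (gen X \<otimes> gen Y) = boundary_E (gen X) \<otimes> gen Y + (-1) ^ nverts X \<bullet> gen X \<otimes> boundary_E (gen Y)" for Y
      by (simp add: tensor_gen[of X Y] boundary_E2_def lin_ext_gen graded_tensor_respects boundary_E_linear)
  qed (intro olinear_add olinear_scale olinear_compose[OF tensor_linear2 boundary_E2_linear]
      tensor_linear2 olinear_compose[OF boundary_E_linear tensor_linear2])+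
  then show ?thesis by metis
qed

lemma boundary_H2_tensor: "boundary_H2 (gen X \<otimes> y) = boundary_H (gen X) \<otimes> y + (-1) ^ nverts X \<bullet> gen X \<otimes> boundary_H y"
proof -
  have "(\<lambda>y. boundary_H2 (gen X \<otimes> y)) = (\<lambda>y. boundary_H (gen X) \<otimes> y + (-1) ^ nverts X \<bullet> gen X \<otimes> boundary_H y)"
  proof (rule olinear_eqI)
    show "boundary_H2 (gen X \<otimes> gen Y) = boundary_H (gen X) \<otimes> gen Y + (-1) ^ nverts X \<bullet> gen X \<otimes> boundary_H (gen Y)" for Y
      by (simp add: tensor_gen[of X Y] boundary_H2_def lin_ext_gen graded_tensor_respects boundary_H_linear)
  qed (intro olinear_add olinear_scale olinear_compose[OF tensor_linear2 boundary_H2_linear]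
      tensor_linear2 olinear_compose[OF boundary_H_linear tensor_linear2])+
  then show ?thesis by metis
qed

abbreviation eimage :: "(nat \<Rightarrow> nat) \<Rightarrow> (nat \<times> nat) multiset \<Rightarrow> (nat \<times> nat) multiset" where
  "eimage f M \<equiv> image_mset (map_prod f f) M"

lemma edges_union: "nverts (gunion X Y) = nverts X + nverts Y"
  "edges (gunion X Y) = edges X @ map (map_prod ((+) (nverts X)) ((+) (nverts X))) (edges Y)"
  by (transfer; auto split: prod.splits)+

lemma edges_empty: "nverts gempty = 0" "edges gempty = []"
  by (transfer; simp)+

lemma ends_bound: "set_mset (ends M) \<subseteq> A \<longleftrightarrow> (\<forall>e\<in>#M. fst e \<in> A \<and> snd e \<in> A)"
  by (auto simp: set_ends)

lemma eimage_cong: "set_mset (ends M) \<subseteq> A \<Longrightarrow> (\<And>v. v \<in> A \<Longrightarrow> f v = g v) \<Longrightarrow> eimage f M = eimage g M"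
  by (intro image_mset_cong) (simp add: ends_bound map_prod_def split_def)

lemma valid_ends_subset: "valid_ends n E \<Longrightarrow> set_mset E \<subseteq> {1..n}"
  by (simp add: valid_ends_def)

lemma gunion_genm: "gen (gunion X Y) =
   genm (nverts X + nverts Y) (mset (edges X) + eimage ((+) (nverts X)) (mset (edges Y)))"
  by (subst gen_genm) (simp add: edges_union)

lemma gunion_respects: "or_respects2 (\<lambda>X Y. gen (gunion X Y) :: 'k::field_char_0 graph_space)"
  unfolding or_respects2_def
proof (intro conjI allI)
  fix Y :: lgraph
  note Y = valid_ends_subset[OF valid_lgraph[of Y]]
  show "or_respects (\<lambda>X. gen (gunion X Y) :: 'k graph_space)"
  proof (rule or_respects_lgraphI[where F = "\<lambda>n M. genm (n + nverts Y) (M + eimage ((+) n) (mset (edges Y)))"])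
    show "genm (n + nverts Y) (add_mset (v, u) M + eimage ((+) n) (mset (edges Y))) =
      - (genm (n + nverts Y) (add_mset (u, v) M + eimage ((+) n) (mset (edges Y))) :: 'k graph_space)" for n M u v
      using genm_rev[of _ v u] by simp
  next
    fix n M a b assume ab: "a \<in> {1..n}" "b \<in> {1..n}" "a \<noteq> (b::nat)"
    have "eimage (transpose a b) (eimage ((+) n) (mset (edges Y))) = eimage ((+) n) (mset (edges Y))"
      unfolding map_prod_image_comp by (rule eimage_cong[OF Y]) (use ab in auto)
    then have "eimage (transpose a b) M + eimage ((+) n) (mset (edges Y))
      = eimage (transpose a b) (M + eimage ((+) n) (mset (edges Y)))" by simp
    moreover have "genm (n + nverts Y) (eimage (transpose a b) (M + eimage ((+) n) (mset (edges Y)))) =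
      - (genm (n + nverts Y) (M + eimage ((+) n) (mset (edges Y))) :: 'k graph_space)"
      by (rule genm_transpose) (use ab in auto)
    ultimately show "genm (n + nverts Y) (eimage (transpose a b) M + eimage ((+) n) (mset (edges Y))) =
      - (genm (n + nverts Y) (M + eimage ((+) n) (mset (edges Y))) :: 'k graph_space)" by simp
  qed (rule gunion_genm)
next
  fix X :: lgraph
  note X = valid_ends_subset[OF valid_lgraph[of X]]
  let ?n = "nverts X" let ?E = "mset (edges X)"
  show "or_respects (\<lambda>Y. gen (gunion X Y) :: 'k graph_space)"
  proof (rule or_respects_lgraphI[where F = "\<lambda>m M. genm (?n + m) (?E + eimage ((+) ?n) M)"])
    show "genm (?n + m) (?E + eimage ((+) ?n) (add_mset (v, u) M)) =
      - (genm (?n + m) (?E + eimage ((+) ?n) (add_mset (u, v) M)) :: 'k graph_space)" for m M u v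
      using genm_rev[of _ "?n + v" "?n + u"] by simp
  next
    fix m M a b assume ab: "a \<in> {1..m}" "b \<in> {1..m}" "a \<noteq> (b::nat)"
    let ?t = "transpose (?n + a) (?n + b)"
    have "eimage ?t ?E = eimage id ?E"
      by (rule eimage_cong[OF X]) (use ab in \<open>auto simp: transpose_def\<close>)
    moreover have "?t \<circ> (+) ?n = (+) ?n \<circ> transpose a b" by (auto simp: fun_eq_iff transpose_def)
    then have "eimage ?t (eimage ((+) ?n) M) = eimage ((+) ?n) (eimage (transpose a b) M)"
      by (simp only: map_prod_image_comp)
    ultimately have "?E + eimage ((+) ?n) (eimage (transpose a b) M) = eimage ?t (?E + eimage ((+) ?n) M)"
      by (simp add: map_prod.id)
    moreover have "genm (?n + m) (eimage ?t (?E + eimage ((+) ?n) M)) = - (genm (?n + m) (?E + eimage ((+) ?n) M) :: 'k graph_space)"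
      by (rule genm_transpose) (use ab in auto)
    ultimately show "genm (?n + m) (?E + eimage ((+) ?n) (eimage (transpose a b) M)) =
       - (genm (?n + m) (?E + eimage ((+) ?n) M) :: 'k graph_space)" by simp
  qed (rule gunion_genm)
qed

lemma gprod_gen: "gen X \<odot> gen Y = gen (gunion X Y)"
  by (simp add: gprod_def bilift_gen gunion_respects)
lemma gprod_linear1: "olinear (\<lambda>x. x \<odot> y)" and gprod_linear2: "olinear (\<lambda>y. x \<odot> y)"
  unfolding gprod_def by (intro bilift_linear1 bilift_linear2 gunion_respects)+

lemma tprod_respects: "or_respects2 (\<lambda>(X, Y) (Z, W).
    (-1) ^ (nverts Y * nverts Z) \<bullet> gen (gunion X Z, gunion Y W) :: 'k::field_char_0 graph_space2)"
proof -
  let ?f = "\<lambda>X Y Z W. (-1) ^ (nverts Y * nverts Z) \<bullet> (gen (gunion X Z) \<otimes> gen (gunion Y W)) :: 'k graph_space2"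
  have g1: "or_respects (\<lambda>Z. gen (gunion X Z) :: 'k graph_space)" "or_respects (\<lambda>X. gen (gunion X Z) :: 'k graph_space)" for X Z
    using gunion_respects by (auto simp: or_respects2_def)
  have "or_respects (\<lambda>(Z, W). ?f X Y Z W)" for X Y
    by (rule or_respects_prod, unfold or_respects2_def, intro conjI allI)
       (intro or_respects_linear[OF olinear_scale[OF tensor_linear2]] g1
          or_respects_sign or_respects_linear[OF tensor_linear1])+
  moreover have "or_respects (\<lambda>(X, Y). ?f X Y Z W)" for Z W
    by (rule or_respects_prod, unfold or_respects2_def, intro conjI allI)
       (intro or_respects_linear[OF olinear_scale[OF tensor_linear1]] g1
          or_respects_sign or_respects_linear[OF tensor_linear2])+
  ultimately show ?thesis unfolding or_respects2_def tensor_gen split_def by simp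
qed

lemma tprod_gen: "tprod (gen X \<otimes> gen Y) (gen Z \<otimes> gen W) =
    (-1) ^ (nverts Y * nverts Z) \<bullet> ((gen X \<odot> gen Z) \<otimes> (gen Y \<odot> gen W))"
  by (simp add: tprod_def tensor_gen gprod_gen bilift_gen tprod_respects)
lemma tprod_linear1: "olinear (\<lambda>x. tprod x y)" and tprod_linear2: "olinear (tprod x)"
  unfolding tprod_def using bilift_linear1[OF tprod_respects] bilift_linear2[OF tprod_respects] by auto

lemma genm_cases:
  fixes n M
  obtains "genm n M = (0 :: 'k::field_char_0 graph_space)" 
  | X where "nverts X = n" "mset (edges X) = M" "genm n M = (gen X :: 'k graph_space)"
proof (cases "valid_ends n (ends M)")
  case True
  then show ?thesis using genm_graph that(2) by metis
next
  case False
  then show ?thesis using that(1) by (simp add: genm_def)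
qed

lemma tprod_genm: "tprod (genm s M \<otimes> genm s' M') (genm t N \<otimes> genm t' N') =
    (-1) ^ (s' * t) \<bullet> ((genm s M \<odot> genm t N) \<otimes> (genm s' M' \<odot> genm t' N') :: 'k::field_char_0 graph_space2)"
proof -
  note z = olinearD(3)[OF tensor_linear1] olinearD(3)[OF tensor_linear2] olinearD(3)[OF gprod_linear1]
    olinearD(3)[OF gprod_linear2] olinearD(3)[OF tprod_linear1] olinearD(3)[OF tprod_linear2]
  show ?thesis
    by (cases rule: genm_cases[of s M, where 'k='k]; cases rule: genm_cases[of s' M', where 'k='k];
        cases rule: genm_cases[of t N, where 'k='k]; cases rule: genm_cases[of t' N', where 'k='k])
      (simp_all add: z tprod_gen)
qed

lemma shift_image: "(u \<in> (+) n ` T) \<longleftrightarrow> n \<le> u \<and> u - n \<in> (T :: nat set)"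
  by (auto simp: image_iff intro!: bexI[of _ "u - n"])

lemma interval_split: "{1..n+m} = {1..n} \<union> (+) n ` {1..m::nat}"
  by (auto simp: shift_image)

lemma split_union:
  assumes "U \<subseteq> {1..n+m::nat}"
  shows "(U \<inter> {1..n}) \<union> (+) n ` {t\<in>{1..m}. n + t \<in> U} = U"
proof (rule set_eqI)
  fix u
  have "u \<in> U \<Longrightarrow> 1 \<le> u \<and> u \<le> n + m" using assms by auto
  then show "u \<in> (U \<inter> {1..n}) \<union> (+) n ` {t\<in>{1..m}. n + t \<in> U} \<longleftrightarrow> u \<in> U"
    unfolding Un_iff shift_image by (cases "u \<le> n") auto
qed

lemma card_transpose: "card (transpose a b ` S) = card S"
  by (rule card_image) (metis inj_on_subset inj_transpose subset_UNIV)

lemma valid_ends_union: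
  assumes "set_mset E \<subseteq> {1..n}" "set_mset F \<subseteq> {1..m}"
  shows "valid_ends (n + m) (E + image_mset ((+) n) F) \<longleftrightarrow> valid_ends n E \<and> valid_ends m F"
proof -
  have b: "set_mset (E + image_mset ((+) n) F) \<subseteq> {1..n+m}" using assms by fastforce
  have 1: "count (E + image_mset ((+) n) F) v = count E v" if "v \<le> n" for v
  proof -
    have "v \<notin> (+) n ` set_mset F" using assms(2) that by fastforce
    then show ?thesis by (simp add: count_eq_zero_iff)
  qed
  have 2: "count (E + image_mset ((+) n) F) (n + w) = count F w" if "w \<in> {1..m}" for w
  proof -
    have "n + w \<notin># E" using assms(1) that by fastforce
    moreover have "count (image_mset ((+) n) F) (n + w) = count F w"
      by (rule count_image_inj) (simp add: inj_def)
    ultimately show ?thesis by (simp add: count_eq_zero_iff)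
  qed
  have "{1..n+m} = {1..n} \<union> (+) n ` {1..m}"
    by (rule interval_split)
  then have "(\<forall>v\<in>{1..n+m}. 3 \<le> count (E + image_mset ((+) n) F) v) \<longleftrightarrow>
     (\<forall>v\<in>{1..n}. 3 \<le> count (E + image_mset ((+) n) F) v) \<and> (\<forall>w\<in>{1..m}. 3 \<le> count (E + image_mset ((+) n) F) (n + w))"
    by (simp only: ball_Un ball_simps)
  also have "\<dots> \<longleftrightarrow> (\<forall>v\<in>{1..n}. 3 \<le> count E v) \<and> (\<forall>w\<in>{1..m}. 3 \<le> count F w)"
    using 1 2 by (metis atLeastAtMost_iff)
  finally show ?thesis using b assms by (simp only: valid_ends_def) blast
qed

lemma genm_gprod:
  assumes "set_mset (ends M) \<subseteq> {1..n}" "set_mset (ends N) \<subseteq> {1..m}"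
  shows "genm n M \<odot> genm m N = (genm (n + m) (M + eimage ((+) n) N) :: 'k::field_char_0 graph_space)"
proof (cases "valid_ends n (ends M) \<and> valid_ends m (ends N)")
  case True
  obtain X Y where "nverts X = n" "mset (edges X) = M" "genm n M = (gen X :: 'k graph_space)"
    "nverts Y = m" "mset (edges Y) = N" "genm m N = (gen Y :: 'k graph_space)"
    using True genm_graph by metis
  then show ?thesis by (simp add: gprod_gen gunion_genm)
next
  case False
  then have "\<not> valid_ends (n + m) (ends (M + eimage ((+) n) N))"
    using valid_ends_union[OF assms] by (simp add: ends_image)
  then show ?thesis using False
    by (auto simp: genm_def olinearD(3)[OF gprod_linear1] olinearD(3)[OF gprod_linear2])
qed

definition clos :: "nat \<Rightarrow> (nat \<times> nat) multiset \<Rightarrow> nat set \<Rightarrow> bool" where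
  "clos n M S \<longleftrightarrow> S \<subseteq> {1..n} \<and> (\<forall>e\<in>#M. fst e \<in> S \<longleftrightarrow> snd e \<in> S)"

definition rk :: "nat set \<Rightarrow> nat \<Rightarrow> nat" where
  "rk S v = card {u\<in>S. u \<le> v}"

definition subm :: "nat set \<Rightarrow> (nat \<times> nat) multiset \<Rightarrow> (nat \<times> nat) multiset" where
  "subm S M = eimage (rk S) (filter_mset (\<lambda>e. fst e \<in> S) M)"

definition part :: "nat set \<Rightarrow> (nat \<times> nat) multiset \<Rightarrow> 'k::field_char_0 graph_space" where
  "part S M = genm (card S) (subm S M)"

definition eps :: "nat set \<Rightarrow> 'k::field_char_0" where
  "eps S = (-1) ^ (\<Sum>S + \<Sum>{1..card S})"

definition Dterm :: "nat \<Rightarrow> (nat \<times> nat) multiset \<Rightarrow> nat set \<Rightarrow> 'k::field_char_0 graph_space2" where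
  "Dterm n M S = eps S \<bullet> (part S M \<otimes> part ({1..n} - S) M)"

definition Dm :: "nat \<Rightarrow> (nat \<times> nat) multiset \<Rightarrow> 'k::field_char_0 graph_space2" where
  "Dm n M = (\<Sum>S | clos n M S. Dterm n M S)"

lemma finite_clos: "finite {S. clos n M S}"
  by (rule finite_subset[of _ "Pow {1..n}"]) (auto simp: clos_def)

lemma closD: "clos n M S \<Longrightarrow> finite S" "clos n M S \<Longrightarrow> S \<subseteq> {1..n}"
  by (auto simp: clos_def finite_subset)

lemma rk_less: "finite S \<Longrightarrow> u < v \<Longrightarrow> v \<in> S \<Longrightarrow> rk S u < rk S v"
  unfolding rk_def by (rule psubset_card_mono) (auto, force)

lemma rk_inj: "finite S \<Longrightarrow> u \<in> S \<Longrightarrow> v \<in> S \<Longrightarrow> rk S u = rk S v \<longleftrightarrow> u = v"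
  using rk_less by (metis less_irrefl_nat linorder_neqE_nat)

lemma rk_range: "finite S \<Longrightarrow> v \<in> S \<Longrightarrow> rk S v \<in> {1..card S}"
  unfolding rk_def by (auto simp: Suc_le_eq card_gt_0_iff One_nat_def intro!: card_mono)

lemma clos_filter: "clos n M S \<Longrightarrow> set_mset (ends (filter_mset (\<lambda>e. fst e \<in> S) M)) \<subseteq> S"
  by (auto simp: ends_bound clos_def)

lemma subm_bound: "clos n M S \<Longrightarrow> set_mset (ends (subm S M)) \<subseteq> {1..card S}"
  using clos_filter[of n M S] rk_range[OF closD(1)] by (fastforce simp: subm_def ends_image)

lemma clos_compl: "set_mset (ends M) \<subseteq> {1..n} \<Longrightarrow> clos n M S \<Longrightarrow> clos n M ({1..n} - S)"
  by (auto simp: clos_def ends_bound)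

lemma subm_image:
  assumes "clos n M S" "inj \<tau>" "\<And>v. v \<in> S \<Longrightarrow> rk (\<tau> ` S) (\<tau> v) = g (rk S v)"
  shows "subm (\<tau> ` S) (eimage \<tau> M) = eimage g (subm S M)"
proof -
  have "filter_mset (\<lambda>e. fst e \<in> \<tau> ` S) (eimage \<tau> M) = eimage \<tau> (filter_mset (\<lambda>e. fst e \<in> S) M)"
    by (induction M) (auto simp: inj_image_mem_iff[OF assms(2)])
  then show ?thesis unfolding subm_def
    by (simp only: map_prod_image_comp) (rule eimage_cong[OF clos_filter[OF assms(1)]], use assms(3) in auto)
qed

lemma rk_adj1:
  assumes "finite S" "\<not> (a \<in> S \<and> a + 1 \<in> S)" "v \<in> S"
  shows "rk (transpose a (a + 1) ` S) (transpose a (a + 1) v) = rk S v"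
proof -
  let ?t = "transpose a (a + 1)"
  have "{w \<in> ?t ` S. w \<le> ?t v} = ?t ` {u \<in> S. u \<le> v}"
    using assms by (auto simp: transpose_def split: if_splits)
  then show ?thesis unfolding rk_def by (simp add: card_transpose)
qed

lemma rk_adj2:
  assumes "finite S" "a \<in> S" "a + 1 \<in> S" "v \<in> S"
  shows "rk S (transpose a (a + 1) v) = transpose (rk S a) (rk S a + 1) (rk S v)" "rk S (a + 1) = rk S a + 1"
proof -
  have "{u\<in>S. u \<le> a + 1} = insert (a + 1) {u\<in>S. u \<le> a}" using assms by auto
  then show 1: "rk S (a + 1) = rk S a + 1" unfolding rk_def using assms(1) by simp
  show "rk S (transpose a (a + 1) v) = transpose (rk S a) (rk S a + 1) (rk S v)"
    using assms rk_inj[OF assms(1), of v a] rk_inj[OF assms(1), of v "a + 1"] 1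
    by (auto simp: transpose_def)
qed

lemma part_adj1:
  assumes "clos n M S" "\<not> (a \<in> S \<and> a + 1 \<in> S)"
  shows "part (transpose a (a + 1) ` S) (eimage (transpose a (a + 1)) M) = part S M"
proof -
  have "subm (transpose a (a + 1) ` S) (eimage (transpose a (a + 1)) M) = eimage id (subm S M)"
    by (rule subm_image[OF assms(1)]) (use rk_adj1[OF closD(1)[OF assms(1)] assms(2)] in auto)
  then show ?thesis by (simp add: part_def card_transpose map_prod.id)
qed

lemma part_adj2:
  assumes "clos n M S" "a \<in> S" "a + 1 \<in> S"
  shows "part (transpose a (a + 1) ` S) (eimage (transpose a (a + 1)) M) = - part S M"
proof -
  let ?t = "transpose a (a + 1)"
  have fin: "finite S" by (rule closD(1)[OF assms(1)])
  have tS: "?t ` S = S" using assms(2,3) by (auto simp: transpose_def image_iff)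
  let ?g = "transpose (rk S a) (rk S a + 1)"
  have "subm (?t ` S) (eimage ?t M) = eimage ?g (subm S M)"
    by (rule subm_image[OF assms(1)]) (use rk_adj2(1)[OF fin assms(2,3)] tS in auto)
  moreover have "genm (card S) (eimage ?g (subm S M)) = - (genm (card S) (subm S M) :: 'a graph_space)"
    using rk_range[OF fin assms(2)] rk_range[OF fin assms(3)] rk_adj2(2)[OF fin assms(2,3,2)]
    by (intro genm_transpose) auto
  ultimately show ?thesis by (simp only: part_def tS)
qed

lemma eps_adj:
  assumes "finite S" "(a \<in> S) \<noteq> (a + 1 \<in> S)"
  shows "eps (transpose a (a + 1) ` S) = - (eps S :: 'k::field_char_0)"
proof -
  let ?t = "transpose a (a + 1)"
  have 1: "eps (?t ` T) = - (eps T :: 'k)" if "finite T" "a \<in> T" "a + 1 \<notin> T" for T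
  proof -
    define U where "U = T - {a}"
    have U: "T = insert a U" "a \<notin> U" "a + 1 \<notin> U" "finite U"
      using that by (auto simp: U_def)
    have "?t ` U = id ` U" using U by (intro image_cong) (auto simp: transpose_def)
    then have "?t ` T = insert (a + 1) U" using U by simp
    then show ?thesis using U by (simp add: eps_def power_add)
  qed
  show ?thesis
  proof (cases "a \<in> S")
    case True
    then show ?thesis using 1 assms by blast
  next
    case False
    have "a \<in> ?t ` S" "a + 1 \<notin> ?t ` S" using False assms(2) by (auto simp: transpose_def image_iff)
    then have "eps (?t ` ?t ` S) = - (eps (?t ` S) :: 'k)" using assms(1) by (intro 1) auto
    then show ?thesis by (simp add: image_comp)
  qed
qed

lemma Dterm_adj:
  assumes "a \<in> {1..n}" "a + 1 \<in> {1..n}" "set_mset (ends M) \<subseteq> {1..n}" "clos n M S"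
  shows "Dterm n (eimage (transpose a (a + 1)) M) (transpose a (a + 1) ` S) = - (Dterm n M S :: 'k::field_char_0 graph_space2)"
proof -
  let ?t = "transpose a (a + 1)"
  let ?C = "{1..n} - S"
  have C: "clos n M ?C" by (rule clos_compl[OF assms(3,4)])
  have tn: "?t ` {1..n} = {1..n}" using assms(1,2) by (intro permutes_image permutes_swap_id)
  have tC: "{1..n} - ?t ` S = ?t ` ?C"
    by (subst image_set_diff) (auto simp only: tn inj_transpose)
  have "finite S" using closD[OF assms(4)] by simp
  have e: "eps (?t ` S) = (eps S :: 'k)" if "(a \<in> S) = (a + 1 \<in> S)"
  proof -
    have "?t ` S = S" using that by (cases "a \<in> S") (force simp: transpose_def image_iff)+
    then show ?thesis by simp
  qed
  consider "a \<in> S" "a + 1 \<in> S" | "a \<in> ?C" "a + 1 \<in> ?C" | "(a \<in> S) \<noteq> (a + 1 \<in> S)"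
    using assms(1,2) by blast
  then show ?thesis
  proof cases
    case 1
    then show ?thesis
      unfolding Dterm_def tC using part_adj2[OF assms(4) 1, where 'a='k] part_adj1[OF C, of a, where 'a='k] e
      by (simp add: olinearD(4)[OF tensor_linear1])
  next
    case 2
    then show ?thesis
      unfolding Dterm_def tC using part_adj2[OF C 2, where 'a='k] part_adj1[OF assms(4), of a, where 'a='k] e
      by (simp add: olinearD(4)[OF tensor_linear2])
  next
    case 3
    then show ?thesis
      unfolding Dterm_def tC using part_adj1[OF C, of a, where 'a='k] part_adj1[OF assms(4), of a, where 'a='k]
        eps_adj[OF \<open>finite S\<close> 3, where 'k='k]
      by auto
  qed
qed

lemma clos_image:
  assumes "\<tau> permutes {1..n}"
  shows "clos n (eimage \<tau> M) (\<tau> ` S) \<longleftrightarrow> clos n M S"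
  using permutes_in_image[OF assms] inj_image_mem_iff[OF permutes_inj[OF assms]]
  by (auto simp: clos_def image_subset_iff)

lemma Dm_adj:
  assumes "a \<in> {1..n}" "a + 1 \<in> {1..n}" "set_mset (ends M) \<subseteq> {1..n}"
  shows "Dm n (eimage (transpose a (a + 1)) M) = - (Dm n M :: 'k::field_char_0 graph_space2)"
proof -
  let ?t = "transpose a (a + 1)"
  have p: "?t permutes {1..n}" using assms by (intro permutes_swap_id)
  have tt: "?t ` ?t ` S = S" for S by (simp add: image_comp)
  have "Dm n (eimage ?t M) = (\<Sum>S | clos n M S. Dterm n (eimage ?t M) (?t ` S) :: 'k graph_space2)"
    unfolding Dm_def
    by (rule sum.reindex_bij_witness[of _ "image ?t" "image ?t"])
       (auto simp: tt clos_image[OF p], metis clos_image[OF p] tt)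
  also have "\<dots> = (\<Sum>S | clos n M S. - Dterm n M S)"
    by (intro sum.cong refl) (use Dterm_adj[OF assms] in auto)
  finally show ?thesis by (simp add: Dm_def sum_negf)
qed

lemma Dm_transpose:
  assumes "a \<in> {1..n}" "b \<in> {1..n}" "a < b" "set_mset (ends M) \<subseteq> {1..n}"
  shows "Dm n (eimage (transpose a b) M) = - (Dm n M :: 'k::field_char_0 graph_space2)"
  using assms(3,2,4)
proof (induction b arbitrary: M)
  case 0
  then show ?case by simp
next
  case (Suc b)
  show ?case
  proof (cases "a = b")
    case True
    then show ?thesis using Dm_adj[of a n M, where 'k='k] Suc.prems assms(1) by (simp add: Suc_eq_plus1)
  next
    case False
    then have ab: "a < b" using Suc by auto
    let ?t = "transpose b (b + 1)"
    have b: "b \<in> {1..n}" "b + 1 \<in> {1..n}" using ab Suc.prems assms by auto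
    have p: "?t permutes {1..n}" "transpose a b permutes {1..n}" using b assms by (auto intro: permutes_swap_id)
    have bound: "set_mset (ends (eimage f N)) \<subseteq> {1..n}" if "f permutes {1..n}" "set_mset (ends N) \<subseteq> {1..n}" for f N
      using that permutes_in_image[OF that(1)] by (auto simp: ends_image)
    have "transpose a (Suc b) = ?t \<circ> (transpose a b \<circ> ?t)"
      using ab by (auto simp: fun_eq_iff transpose_def)
    then have "eimage (transpose a (Suc b)) M = eimage ?t (eimage (transpose a b) (eimage ?t M))"
      by (simp only: map_prod_image_comp)
    then have "Dm n (eimage (transpose a (Suc b)) M) = (Dm n (eimage ?t (eimage (transpose a b) (eimage ?t M))) :: 'k graph_space2)"
      by simp
    also have "\<dots> = - Dm n (eimage (transpose a b) (eimage ?t M))"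
      by (intro Dm_adj b bound p Suc.prems)
    also have "\<dots> = Dm n (eimage ?t M)"
      using Suc.IH[OF ab b(1), of "eimage ?t M"] bound p Suc.prems by simp
    also have "\<dots> = - Dm n M" by (intro Dm_adj b Suc.prems)
    finally show ?thesis .
  qed
qed

lemma Dm_rev:
  assumes "u \<in> {1..n}" "v \<in> {1..n}"
  shows "Dm n (add_mset (v, u) M) = - (Dm n (add_mset (u, v) M) :: 'k::field_char_0 graph_space2)"
proof -
  have c: "clos n (add_mset (v, u) M) S \<longleftrightarrow> clos n (add_mset (u, v) M) S" for S
    by (auto simp: clos_def)
  have 1: "part S (add_mset (v, u) M) = - (part S (add_mset (u, v) M) :: 'k graph_space)" if "u \<in> S" "v \<in> S" for S
    using that genm_rev[of _ "rk S v" "rk S u"] by (simp add: part_def subm_def)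
  have 2: "part S (add_mset (v, u) M) = (part S (add_mset (u, v) M) :: 'k graph_space)" if "u \<notin> S" "v \<notin> S" for S
    using that by (simp add: part_def subm_def)
  have "Dterm n (add_mset (v, u) M) S = - (Dterm n (add_mset (u, v) M) S :: 'k graph_space2)" if "clos n (add_mset (u, v) M) S" for S
  proof (cases "u \<in> S")
    case True
    then have "v \<in> S" using that by (auto simp: clos_def)
    then show ?thesis using True 1[of S] 2[of "{1..n} - S"] by (simp add: Dterm_def olinearD(4)[OF tensor_linear1])
  next
    case False
    then have "v \<notin> S" using that by (auto simp: clos_def)
    then show ?thesis using False assms 2[of S] 1[of "{1..n} - S"] by (simp add: Dterm_def olinearD(4)[OF tensor_linear2])
  qed
  then show ?thesis unfolding Dm_def c by (simp add: sum_negf)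
qed

definition coprod_gen :: "lgraph \<Rightarrow> 'k::field_char_0 graph_space2" where
  "coprod_gen X = Dm (nverts X) (mset (edges X))"

lemma coprod_gen_respects: "or_respects (coprod_gen :: lgraph \<Rightarrow> 'k::field_char_0 graph_space2)"
proof (rule or_respects_lgraphI)
  show "coprod_gen X = Dm (nverts X) (mset (edges X))" for X by (rule coprod_gen_def)
next
  fix n M u v assume "valid_ends n (ends (add_mset (u, v) M))"
  then have "u \<in> {1..n}" "v \<in> {1..n}" by (auto simp: valid_ends_def)
  then show "Dm n (add_mset (v, u) M) = - (Dm n (add_mset (u, v) M) :: 'k graph_space2)" by (rule Dm_rev)
next
  fix n M a b assume "a \<in> {1..n}" "b \<in> {1..n}" "a \<noteq> b" "valid_ends n (ends M)"
  then show "Dm n (eimage (transpose a b) M) = - (Dm n M :: 'k graph_space2)"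
    using Dm_transpose[of a n b M, where 'k='k] Dm_transpose[of b n a M, where 'k='k] valid_ends_subset[of n "ends M"]
    by (metis linorder_neqE_nat transpose_commute)
qed

lemma rk_union:
  assumes "finite S" "finite T" "S \<subseteq> {..n}" "\<forall>t\<in>T. 1 \<le> t"
  shows "v \<in> S \<Longrightarrow> rk (S \<union> (+) n ` T) v = rk S v" "rk (S \<union> (+) n ` T) (n + w) = card S + rk T w"
proof -
  assume "v \<in> S"
  then have "{u \<in> S \<union> (+) n ` T. u \<le> v} = {u \<in> S. u \<le> v}" using assms by fastforce
  then show "rk (S \<union> (+) n ` T) v = rk S v" by (simp add: rk_def)
next
  have "{u \<in> S \<union> (+) n ` T. u \<le> n + w} = S \<union> (+) n ` {u \<in> T. u \<le> w}" using assms by fastforce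
  moreover have "S \<inter> (+) n ` {u \<in> T. u \<le> w} = {}" using assms by fastforce
  ultimately show "rk (S \<union> (+) n ` T) (n + w) = card S + rk T w"
    using assms by (simp add: rk_def card_Un_disjoint card_image)
qed

lemma clos_union:
  assumes "set_mset (ends M) \<subseteq> {1..n}" "set_mset (ends N) \<subseteq> {1..m}" "S \<subseteq> {1..n}" "T \<subseteq> {1..m}"
  shows "clos (n + m) (M + eimage ((+) n) N) (S \<union> (+) n ` T) \<longleftrightarrow> clos n M S \<and> clos m N T"
proof -
  have M: "fst e \<in> S \<union> (+) n ` T \<longleftrightarrow> fst e \<in> S" "snd e \<in> S \<union> (+) n ` T \<longleftrightarrow> snd e \<in> S" if "e \<in># M" for e
    using that assms by (fastforce simp: ends_bound)+
  have N: "n + fst e \<in> S \<union> (+) n ` T \<longleftrightarrow> fst e \<in> T" "n + snd e \<in> S \<union> (+) n ` T \<longleftrightarrow> snd e \<in> T" if "e \<in># N" for e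
    using that assms by (fastforce simp: ends_bound)+
  have "S \<union> (+) n ` T \<subseteq> {1..n + m}" using assms by fastforce
  then show ?thesis using assms(3,4) M N by (auto simp: clos_def ball_Un simp del: Un_iff)
qed

lemma subm_union:
  assumes "clos n M S" "clos m N T" "set_mset (ends M) \<subseteq> {1..n}" "set_mset (ends N) \<subseteq> {1..m}"
  shows "subm (S \<union> (+) n ` T) (M + eimage ((+) n) N) = subm S M + eimage ((+) (card S)) (subm T N)"
proof -
  note fin = closD(1)[OF assms(1)] closD(1)[OF assms(2)]
  have b: "S \<subseteq> {..n}" "\<forall>t\<in>T. 1 \<le> t" "T \<subseteq> {1..m}" "S \<subseteq> {1..n}" using closD(2)[OF assms(1)] closD(2)[OF assms(2)] by auto
  let ?U = "S \<union> (+) n ` T"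
  have "filter_mset (\<lambda>e. fst e \<in> ?U) M = filter_mset (\<lambda>e. fst e \<in> S) M"
    using assms(3) b by (intro filter_mset_cong refl) (fastforce simp: ends_bound)
  moreover have "eimage (rk ?U) (filter_mset (\<lambda>e. fst e \<in> S) M) = subm S M"
    unfolding subm_def by (rule eimage_cong[OF clos_filter[OF assms(1)]]) (rule rk_union(1)[OF fin b(1,2)])
  moreover have "filter_mset (\<lambda>e. fst e \<in> ?U) (eimage ((+) n) N) = eimage ((+) n) (filter_mset (\<lambda>e. fst e \<in> T) N)"
  proof -
    have "filter_mset (\<lambda>e. fst e \<in> ?U) (eimage ((+) n) N) = eimage ((+) n) (filter_mset (\<lambda>e. n + fst e \<in> ?U) N)"
      by (induction N) auto
    also have "filter_mset (\<lambda>e. n + fst e \<in> ?U) N = filter_mset (\<lambda>e. fst e \<in> T) N"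
      using assms(4) b by (intro filter_mset_cong refl) (fastforce simp: ends_bound)
    finally show ?thesis .
  qed
  moreover have "eimage (rk ?U) (eimage ((+) n) (filter_mset (\<lambda>e. fst e \<in> T) N)) = eimage ((+) (card S)) (subm T N)"
    unfolding subm_def map_prod_image_comp
    by (rule eimage_cong[of _ UNIV]) (use rk_union(2)[OF fin b(1,2)] in auto)
  ultimately show ?thesis by (simp add: subm_def)
qed

lemma card_union:
  assumes "S \<subseteq> {1..n}" "T \<subseteq> {1..m}"
  shows "card (S \<union> (+) n ` T) = card S + card T" "\<Sum>(S \<union> (+) n ` T) = \<Sum>S + \<Sum>T + n * card T"
proof -
  have fin: "finite S" "finite T" using assms by (auto intro: finite_subset)
  have d: "S \<inter> (+) n ` T = {}" using assms by fastforce
  show "card (S \<union> (+) n ` T) = card S + card T"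
    using fin d by (simp add: card_Un_disjoint card_image)
  have "\<Sum>((+) n ` T) = (\<Sum>t\<in>T. n + t)" by (simp add: sum.reindex)
  then show "\<Sum>(S \<union> (+) n ` T) = \<Sum>S + \<Sum>T + n * card T"
    using fin d by (simp add: sum.union_disjoint sum.distrib mult.commute)
qed

lemma sum_upto_add: "\<Sum>{1..s + t} = \<Sum>{1..s} + \<Sum>{1..t} + s * (t::nat)"
  by (induction t) auto

lemma eps_union:
  assumes "S \<subseteq> {1..n}" "T \<subseteq> {1..m}"
  shows "eps (S \<union> (+) n ` T) = eps S * eps T * (-1 :: 'k::field_char_0) ^ (card ({1..n} - S) * card T)"
proof -
  have "card ({1..n} - S) = n - card S" "card S \<le> n"
    using assms card_mono[of "{1..n}" S] by (auto simp: card_Diff_subset finite_subset)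
  then obtain c where c: "n = card S + c" "card ({1..n} - S) = c" by (metis le_add_diff_inverse)
  have "(-1 :: 'k) ^ (card S * card T * 2) = 1" by (simp add: power_mult mult.commute)
  then have "(-1 :: 'k) ^ (n * card T + card S * card T) = (-1) ^ (c * card T)"
    unfolding c(1) by (simp add: algebra_simps power_add mult_2_right)
  then show ?thesis unfolding eps_def card_union[OF assms] sum_upto_add c(2)
    by (simp add: power_add mult_ac)
qed

lemma Dm_union:
  assumes M: "set_mset (ends M) \<subseteq> {1..n}" and N: "set_mset (ends N) \<subseteq> {1..m}"
  shows "Dm (n + m) (M + eimage ((+) n) N) = (tprod (Dm n M) (Dm m N) :: 'k::field_char_0 graph_space2)"
proof -
  let ?MN = "M + eimage ((+) n) N"
  let ?U = "\<lambda>S T. S \<union> (+) n ` T"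
  have t: "Dterm (n + m) ?MN (?U S T) = (tprod (Dterm n M S) (Dterm m N T) :: 'k graph_space2)"
    if S: "clos n M S" and T: "clos m N T" for S T
  proof -
    have sub: "S \<subseteq> {1..n}" "T \<subseteq> {1..m}" using closD S T by auto
    let ?S' = "{1..n} - S" let ?T' = "{1..m} - T"
    have S': "clos n M ?S'" and T': "clos m N ?T'" using clos_compl M N S T by auto
    have sub': "?S' \<subseteq> {1..n}" "?T' \<subseteq> {1..m}" by auto
    have p: "part (?U A B) ?MN = (part A M \<odot> part B N :: 'k graph_space)" if "clos n M A" "clos m N B" for A B
      unfolding part_def using that
      by (simp add: genm_gprod[OF subm_bound[OF that(1)] subm_bound[OF that(2)]] subm_union[OF that M N] card_union[OF closD(2) closD(2)])
    have "{1..n + m} - ?U S T = ?U ?S' ?T'"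
    proof -
      have 0: "u \<in> T \<Longrightarrow> 1 \<le> u \<and> u \<le> m" "u \<in> S \<Longrightarrow> 1 \<le> u \<and> u \<le> n" for u using sub by auto
      show ?thesis
      proof (rule set_eqI)
        fix u
        show "u \<in> {1..n + m} - ?U S T \<longleftrightarrow> u \<in> ?U ?S' ?T'"
          using 0(1)[of "u - n"] 0(2)[of u] by (auto simp: shift_image)
      qed
    qed
    then have "Dterm (n + m) ?MN (?U S T) = eps (?U S T) \<bullet> ((part S M \<odot> part T N) \<otimes> (part ?S' M \<odot> part ?T' N) :: 'k graph_space2)"
      using S T S' T' by (simp add: Dterm_def p)
    also have "\<dots> = (eps S * eps T) \<bullet> tprod (part S M \<otimes> part ?S' M) (part T N \<otimes> part ?T' N)"
      unfolding part_def tprod_genm by (simp add: eps_union[OF sub])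
    also have "\<dots> = tprod (Dterm n M S) (Dterm m N T)"
      by (simp add: Dterm_def olinearD(2)[OF tprod_linear1] olinearD(2)[OF tprod_linear2])
    finally show ?thesis .
  qed
  have "Dm (n + m) ?MN = (\<Sum>(S, T)\<in>{S. clos n M S} \<times> {T. clos m N T}. Dterm (n + m) ?MN (?U S T) :: 'k graph_space2)"
    unfolding Dm_def
  proof (rule sum.reindex_bij_witness[of _ "\<lambda>(S, T). ?U S T" "\<lambda>U. (U \<inter> {1..n}, {t\<in>{1..m}. n + t \<in> U})"], goal_cases)
    case (1 U)
    then have "U \<subseteq> {1..n+m}" using closD by auto
    then show ?case using split_union[of U n m] by simp
  next
    case (2 U)
    then have "U \<subseteq> {1..n+m}" using closD by auto
    then have "?U (U \<inter> {1..n}) {t\<in>{1..m}. n + t \<in> U} = U" by (rule split_union)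
    moreover have "U \<inter> {1..n} \<subseteq> {1..n}" "{t\<in>{1..m}. n + t \<in> U} \<subseteq> {1..m}" by auto
    ultimately have "clos n M (U \<inter> {1..n}) \<and> clos m N {t\<in>{1..m}. n + t \<in> U}"
      using 2 clos_union[OF M N, of "U \<inter> {1..n}" "{t\<in>{1..m}. n + t \<in> U}"] by (metis mem_Collect_eq)
    then show ?case by simp
  next
    case (3 b)
    then obtain S T where b: "b = (S, T)" "clos n M S" "clos m N T" by auto
    have 0: "u \<in> T \<Longrightarrow> 1 \<le> u \<and> u \<le> m" "u \<in> S \<Longrightarrow> 1 \<le> u \<and> u \<le> n" for u
      using closD(2)[OF b(2)] closD(2)[OF b(3)] by auto
    have "?U S T \<inter> {1..n} = S"
    proof (rule set_eqI)
      fix u show "u \<in> ?U S T \<inter> {1..n} \<longleftrightarrow> u \<in> S"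
        using 0(1)[of "u - n"] 0(2)[of u] by (auto simp: shift_image)
    qed
    moreover have "{t\<in>{1..m}. n + t \<in> ?U S T} = T"
    proof (rule set_eqI)
      fix u show "u \<in> {t\<in>{1..m}. n + t \<in> ?U S T} \<longleftrightarrow> u \<in> T"
        using 0(1)[of u] 0(2)[of "n + u"] by (auto simp: shift_image)
    qed
    ultimately show ?case using b by simp
  next
    case (4 b)
    then show ?case using clos_union[OF M N closD(2) closD(2)] by auto
  next
    case (5 U)
    then have "U \<subseteq> {1..n+m}" using closD by auto
    then show ?case using split_union[of U n m] by simp
  qed
  also have "\<dots> = (\<Sum>(S, T)\<in>{S. clos n M S} \<times> {T. clos m N T}. tprod (Dterm n M S) (Dterm m N T))"
    by (intro sum.cong) (auto simp: t)
  also have "\<dots> = tprod (Dm n M) (Dm m N)"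
    unfolding Dm_def
    by (simp add: sum.cartesian_product[symmetric] olinearD(6)[OF tprod_linear1] olinearD(6)[OF tprod_linear2])
       (rule sum.swap)
  finally show ?thesis .
qed

lemma gone_genm: "gone = genm 0 {#}"
  unfolding gone_def by (subst gen_genm) (simp add: edges_empty)

lemma eps_full: "eps {1..n} = 1"
  by (simp add: eps_def flip: mult_2)

lemma Dterm_empty: "set_mset (ends M) \<subseteq> {1..n} \<Longrightarrow> Dterm n M {} = gone \<otimes> genm n M"
  and Dterm_full: "set_mset (ends M) \<subseteq> {1..n} \<Longrightarrow> Dterm n M {1..n} = genm n M \<otimes> gone"
proof -
  assume M: "set_mset (ends M) \<subseteq> {1..n}"
  have e: "part {} M = gone" by (simp add: part_def subm_def gone_genm)
  have "filter_mset (\<lambda>e. fst e \<in> {1..n}) M = M"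
    using M by (auto simp: ends_bound filter_mset_eq_conv)
  moreover have "rk {1..n} v = v" if "v \<in> {1..n}" for v
  proof -
    have "{u \<in> {1..n}. u \<le> v} = {1..v}" using that by auto
    then show ?thesis by (simp add: rk_def)
  qed
  then have "eimage (rk {1..n}) M = eimage id M" by (intro eimage_cong[OF M]) auto
  ultimately have f: "part {1..n} M = genm n M" by (simp add: part_def subm_def map_prod.id)
  show "Dterm n M {} = gone \<otimes> genm n M" unfolding Dterm_def by (simp add: eps_def e f)
  show "Dterm n M {1..n} = genm n M \<otimes> gone" unfolding Dterm_def by (simp add: e f eps_full)
qed

lemma connected_clos:
  assumes "gconnected X" "clos (nverts X) (mset (edges X)) S"
  shows "S = {} \<or> S = {1..nverts X}"
proof (rule ccontr)
  assume *: "\<not> ?thesis"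
  have sub: "S \<subseteq> {1..nverts X}" using assms closD by auto
  then obtain u v where uv: "u \<in> S" "v \<notin> S" "u \<in> {1..nverts X}" "v \<in> {1..nverts X}" using * by blast
  have "(u, v) \<in> (set (edges X) \<union> (set (edges X))\<inverse>)\<^sup>*" using assms(1) uv by (auto simp: gconnected_def)
  then have "v \<in> S"
  proof (induction rule: rtrancl_induct)
    case base then show ?case by (rule uv(1))
  next
    case (step y z)
    then show ?case using assms(2) by (fastforce simp: clos_def)
  qed
  then show False using uv by simp
qed

lemma coproduct_exists: "is_coproduct (lin_ext coprod_gen :: 'k::field_char_0 graph_space \<Rightarrow> 'k graph_space2)"
  unfolding is_coproduct_def
proof (intro conjI allI impI)
  show lin: "olinear (lin_ext coprod_gen :: 'k graph_space \<Rightarrow> 'k graph_space2)" by (intro lin_ext_linear coprod_gen_respects)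
  have D: "lin_ext coprod_gen (gen X) = (Dm (nverts X) (mset (edges X)) :: 'k graph_space2)" for X
    by (simp add: lin_ext_gen coprod_gen_respects coprod_gen_def)
  have "{S. clos 0 {#} S} = {{}}" by (auto simp: clos_def)
  then show "lin_ext coprod_gen gone = (gone \<otimes> gone :: 'k graph_space2)"
    unfolding gone_def D by (simp add: Dm_def edges_empty Dterm_empty flip: gone_def gone_genm)
  show "lin_ext coprod_gen (gen X) = (gen X \<otimes> gone + gone \<otimes> gen X :: 'k graph_space2)" if "gconnected X" for X
  proof -
    let ?n = "nverts X" let ?M = "mset (edges X)"
    have n: "{1..?n} \<noteq> {}" using that by (auto simp: gconnected_def)
    have M: "set_mset (ends ?M) \<subseteq> {1..?n}" by (intro valid_ends_subset valid_lgraph)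
    then have "{S. clos ?n ?M S} = {{1..?n}, {}}"
      using connected_clos[OF that] by (auto simp: clos_def ends_bound)
    then have "Dm ?n ?M = (Dterm ?n ?M {1..?n} + Dterm ?n ?M {} :: 'k graph_space2)"
      unfolding Dm_def using n by simp
    then show ?thesis unfolding D Dterm_empty[OF M] Dterm_full[OF M] by (simp add: gen_genm[of X])
  qed
  show "lin_ext coprod_gen (x \<odot> y) = tprod (lin_ext coprod_gen x) (lin_ext coprod_gen y)" for x y :: "'k graph_space"
  proof (rule bilinear_eqI[where f = "\<lambda>x y. lin_ext coprod_gen (x \<odot> y)"])
    show "lin_ext coprod_gen (gen X \<odot> gen Y) = (tprod (lin_ext coprod_gen (gen X)) (lin_ext coprod_gen (gen Y)) :: 'k graph_space2)" for X Y
      unfolding gprod_gen D using Dm_union[OF valid_ends_subset[OF valid_lgraph[of X]] valid_ends_subset[OF valid_lgraph[of Y]]]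
      by (simp add: edges_union)
  qed (intro olinear_compose[OF gprod_linear1 lin] olinear_compose[OF gprod_linear2 lin]
     olinear_compose[OF lin tprod_linear1] olinear_compose[OF lin tprod_linear2])+
qed

lemma unshuffle:
  assumes S: "clos n M S" and M: "set_mset (ends M) \<subseteq> {1..n}"
  shows "\<exists>c::int. genm n M = of_int c \<bullet> (part S M \<odot> part ({1..n} - S) M :: 'k::field_char_0 graph_space)"
proof -
  let ?C = "{1..n} - S"
  define \<sigma> where "\<sigma> v = (if v \<in> S then rk S v else if v \<in> ?C then card S + rk ?C v else v)" for v
  have C: "clos n M ?C" by (rule clos_compl[OF M S])
  have sub: "S \<subseteq> {1..n}" and fin: "finite S" "finite ?C" using closD[OF S] by auto
  have cn: "card S + card ?C = n" using sub fin
    by (metis card_Diff_subset card_atLeastAtMost card_mono diff_Suc_1 finite_atLeastAtMost le_add_diff_inverse One_nat_def)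
  have r: "v \<in> S \<Longrightarrow> \<sigma> v \<in> {1..card S}" "v \<in> ?C \<Longrightarrow> \<sigma> v \<in> {card S + 1..n}" for v
    using rk_range[OF fin(1), of v] rk_range[OF fin(2), of v] cn by (auto simp: \<sigma>_def)
  have "inj_on \<sigma> {1..n}"
  proof (rule inj_onI)
    fix u v assume uv: "u \<in> {1..n}" "v \<in> {1..n}" "\<sigma> u = \<sigma> v"
    then consider "u \<in> S" "v \<in> S" | "u \<in> ?C" "v \<in> ?C" using r[of u] r[of v] by fastforce
    then show "u = v"
      using uv(3) rk_inj[OF fin(1), of u v] rk_inj[OF fin(2), of u v] by cases (auto simp: \<sigma>_def)
  qed
  moreover have "\<sigma> v \<in> {1..n}" if "v \<in> {1..n}" for v
    using r[of v] that cn by (cases "v \<in> S") auto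
  ultimately have "bij_betw \<sigma> {1..n} {1..n}"
    by (metis bij_betw_def endo_inj_surj finite_atLeastAtMost image_subsetI)
  then have p: "\<sigma> permutes {1..n}"
    by (rule bij_imp_permutes) (use sub in \<open>auto simp: \<sigma>_def\<close>)
  have "M = filter_mset (\<lambda>e. fst e \<in> S) M + filter_mset (\<lambda>e. fst e \<notin> S) M" by (rule multiset_partition)
  also have "filter_mset (\<lambda>e. fst e \<notin> S) M = filter_mset (\<lambda>e. fst e \<in> ?C) M"
    using M by (intro filter_mset_cong refl) (auto simp: ends_bound)
  finally have "eimage \<sigma> M = eimage \<sigma> (filter_mset (\<lambda>e. fst e \<in> S) M) + eimage \<sigma> (filter_mset (\<lambda>e. fst e \<in> ?C) M)"
    by (metis image_mset_union)
  also have "eimage \<sigma> (filter_mset (\<lambda>e. fst e \<in> S) M) = subm S M"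
    unfolding subm_def by (rule eimage_cong[OF clos_filter[OF S]]) (simp add: \<sigma>_def)
  also have "eimage \<sigma> (filter_mset (\<lambda>e. fst e \<in> ?C) M) = eimage ((+) (card S)) (subm ?C M)"
    unfolding subm_def map_prod_image_comp by (rule eimage_cong[OF clos_filter[OF C]]) (auto simp: \<sigma>_def)
  finally have "genm n (eimage \<sigma> M) = (part S M \<odot> part ?C M :: 'k graph_space)"
    unfolding part_def by (simp add: genm_gprod subm_bound[OF S] subm_bound[OF C] cn)
  then have "of_int (sign \<sigma>) \<bullet> genm n M = (part S M \<odot> part ?C M :: 'k graph_space)"
    by (simp add: genm_perm[OF p])
  then have "of_int (sign \<sigma>) \<bullet> (part S M \<odot> part ?C M) = (genm n M :: 'k graph_space)"
    by (metis of_int_1 of_int_mult os.scale_one os.scale_scale sign_idempotent)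
  then show ?thesis by metis
qed

lemma disconnected_clos:
  assumes "nverts X > 0" "\<not> gconnected X"
  obtains S where "clos (nverts X) (mset (edges X)) S" "S \<noteq> {}" "S \<noteq> {1..nverts X}"
proof -
  let ?R = "(set (edges X) \<union> (set (edges X))\<inverse>)\<^sup>*"
  obtain u v where uv: "u \<in> {1..nverts X}" "v \<in> {1..nverts X}" "(u, v) \<notin> ?R"
    using assms by (auto simp: gconnected_def)
  let ?S = "{w \<in> {1..nverts X}. (u, w) \<in> ?R}"
  have M: "set_mset (ends (mset (edges X))) \<subseteq> {1..nverts X}" by (intro valid_ends_subset valid_lgraph)
  have "fst e \<in> ?S \<longleftrightarrow> snd e \<in> ?S" if "e \<in> set (edges X)" for e
  proof -
    have "(fst e, snd e) \<in> ?R" "(snd e, fst e) \<in> ?R" using that by auto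
    moreover have "fst e \<in> {1..nverts X}" "snd e \<in> {1..nverts X}" using M that by (auto simp: ends_bound)
    ultimately show ?thesis by (metis (mono_tags, lifting) mem_Collect_eq rtrancl_trans)
  qed
  then have "clos (nverts X) (mset (edges X)) ?S" by (auto simp: clos_def)
  moreover have "u \<in> ?S" "v \<notin> ?S" using uv by auto
  ultimately show ?thesis using that[of ?S] uv by blast
qed

lemma coproduct_unique:
  fixes D D' :: "'k::field_char_0 graph_space \<Rightarrow> 'k graph_space2"
  assumes "is_coproduct D" "is_coproduct D'"
  shows "D = D'"
proof (rule olinear_eqI)
  show l: "olinear D" "olinear D'" using assms by (auto simp: is_coproduct_def)
  show "D (gen X) = D' (gen X)" for X
  proof (induction "nverts X" arbitrary: X rule: less_induct)
    case less
    let ?n = "nverts X" let ?M = "mset (edges X)"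
    have M: "set_mset (ends ?M) \<subseteq> {1..?n}" by (intro valid_ends_subset valid_lgraph)
    have IH: "D (genm s N) = D' (genm s N)" if "s < ?n" for s N
      by (rule genm_cases[of s N, where 'k='k]) (use that less olinearD(3)[OF l(1)] olinearD(3)[OF l(2)] in auto)
    consider "?n = 0" | "gconnected X" | "?n > 0" "\<not> gconnected X" by blast
    then show ?case
    proof cases
      case 1
      then have "ends ?M = {#}" using M by auto
      then have "?M = {#}" by (auto simp: ends_def)
      then have "gen X = (gone :: 'k graph_space)" unfolding gone_genm by (subst gen_genm) (simp add: 1)
      then show ?thesis using assms by (simp add: is_coproduct_def)
    next
      case 2
      then show ?thesis using assms by (simp add: is_coproduct_def)
    next
      case 3
      obtain S where S: "clos ?n ?M S" "S \<noteq> {}" "S \<noteq> {1..?n}" using disconnected_clos[OF 3] by blast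
      obtain c :: int where c: "genm ?n ?M = of_int c \<bullet> (part S ?M \<odot> part ({1..?n} - S) ?M :: 'k graph_space)"
        using unshuffle[OF S(1) M, where 'k='k] by blast
      have sub: "S \<subseteq> {1..?n}" by (rule closD(2)[OF S(1)])
      have "card S < ?n" using psubset_card_mono[of "{1..?n}" S] sub S(3) by auto
      moreover have "card ({1..?n} - S) < ?n" using psubset_card_mono[of "{1..?n}" "{1..?n} - S"] sub S(2) by auto
      ultimately have "D (part S ?M \<odot> part ({1..?n} - S) ?M) = D' (part S ?M \<odot> part ({1..?n} - S) ?M)"
        using assms IH by (simp add: is_coproduct_def part_def)
      then show ?thesis unfolding gen_genm[of X] c by (simp add: olinearD(2)[OF l(1)] olinearD(2)[OF l(2)])
    qed
  qed
qed

theorem ex1_coproduct: "\<exists>!D :: 'k::field_char_0 graph_space \<Rightarrow> 'k graph_space2. is_coproduct D"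
  using coproduct_exists coproduct_unique by blast

lemma coprod_is_coproduct: "is_coproduct coprod"
  unfolding coprod_def by (rule theI'[OF ex1_coproduct])

lemma coprod_eq: "coprod = lin_ext coprod_gen"
  by (rule coproduct_unique[OF coprod_is_coproduct coproduct_exists])

declare One_nat_def [simp]

end

theory Submission
  imports Defs
begin

text \<open>
  Let \<open>T X\<close> be the sum of the graphs \<open>X\<langle>hk\<rangle>\<close>, without the collapse, over all pairs \<open>{h, k}\<close> up to passing
  to the complementary pair.  Collapsing one of the two new edges of \<open>X\<langle>hk\<rangle>\<close> gives a term of \<open>\<partial>\<^sub>H X\<close>, while
  collapsing an old edge commutes with cutting and gluing; hence \<open>\<partial>\<^sub>H = \<partial>\<^sub>E T - T \<partial>\<^sub>E\<close>.  The same identity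
  holds on the tensor square with \<open>T\<^sub>2 = T \<otimes> 1 + 1 \<otimes> T\<close>.  Since \<open>\<partial>\<^sub>E\<close> is a derivation and the collapse
  of a connected graph is connected, \<open>\<Delta>\<close> commutes with \<open>\<partial>\<^sub>E\<close>, so \<open>\<partial>\<^sub>E X = 0\<close> implies
  \<open>\<theta> X = \<partial>\<^sub>E (\<Delta> (T X) - T\<^sub>2 (\<Delta> X))\<close>.
\<close>

subsection \<open>Cutting and regluing pairs of edges\<close>

lemma sum_mset_remove1:
  "e \<in># M \<Longrightarrow> (\<Sum>f\<in>#M - {#e#}. F f) = (\<Sum>f\<in>#M. F f) - (F e :: 'b::ab_group_add)"
  by (metis add_diff_cancel_left' image_mset_add_mset insert_DiffM sum_mset.insert)

lemma sum_mset_subtractf: "(\<Sum>x\<in>#A. f x - g x) = (\<Sum>x\<in>#A. f x) - (\<Sum>x\<in>#A. g x :: 'b::ab_group_add)"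
  by (induction A) (auto simp: algebra_simps)

text \<open>Each side is the unrestricted double sum minus its diagonal.\<close>

lemma sum_mset_distinct_swap:
  fixes F :: "'a \<Rightarrow> 'a \<Rightarrow> 'b::ab_group_add"
  shows "(\<Sum>e\<in>#M. \<Sum>f\<in>#M - {#e#}. F e f) = (\<Sum>f\<in>#M. \<Sum>e\<in>#M - {#f#}. F e f)"
proof -
  have "(\<Sum>e\<in>#M. \<Sum>f\<in>#M - {#e#}. G e f) = (\<Sum>e\<in>#M. \<Sum>f\<in>#M. G e f) - (\<Sum>e\<in>#M. G e e)"
    for G :: "'a \<Rightarrow> 'a \<Rightarrow> 'b"
    unfolding sum_mset_subtractf[symmetric] by (rule sum_mset_cong) (rule sum_mset_remove1)
  from this[of F] this[of "\<lambda>f e. F e f"] sum_mset.swap[of F M M]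
  show ?thesis by simp
qed

lemma olinear_sum_mset: "olinear f \<Longrightarrow> f (\<Sum>x\<in>#A. g x) = (\<Sum>x\<in>#A. f (g x))"
  by (induction A) (auto simp: olinearD)

text \<open>One term for each choice of a half-edge h of \<open>e\<close> and k of \<open>f\<close>.
  The sign is \<open>cut_sign\<close>, and \<open>F\<close> receives the two new edges of
  X\<langle>hk\<rangle>. Keeping \<open>F\<close> abstract lets the same sum be taken before and
  after a collapse.\<close>

definition reglue :: "(nat \<times> nat \<Rightarrow> nat \<times> nat \<Rightarrow> ('a::oriented, 'k::field_char_0) ospace)
    \<Rightarrow> nat \<times> nat \<Rightarrow> nat \<times> nat \<Rightarrow> ('a, 'k) ospace" where
  "reglue F e f = (\<Sum>b\<in>UNIV. \<Sum>c\<in>UNIV. (- bsgn b * bsgn c) \<bullet>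
     F (fst (hpair b e), fst (hpair c f)) (snd (hpair c f), snd (hpair b e)))"

text \<open>
  Every unordered pair of distinct edges is visited in both orders, and \<open>X\<langle>hk\<rangle>\<close> equals the graph obtained
  from the two complementary half-edges, so \<open>reglue_sum\<close> counts each \<open>X\<langle>hk\<rangle>\<close> four times.
\<close>

definition reglue_sum :: "((nat \<times> nat) multiset \<Rightarrow> ('a::oriented, 'k::field_char_0) ospace)
    \<Rightarrow> (nat \<times> nat) multiset \<Rightarrow> ('a, 'k) ospace" where
  "reglue_sum L M = (\<Sum>e\<in>#M. \<Sum>f\<in>#M - {#e#}. reglue (\<lambda>p q. L (add_mset p (add_mset q (M - {#e, f#})))) e f)"

lemma reglue_expand: "reglue F (a, b) (c, d) = F (a, d) (c, b) + F (b, c) (d, a) - F (a, c) (d, b) - F (b, d) (c, a)"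
  by (simp add: reglue_def UNIV_bool hpair_def bsgn_def)

lemma reglue_swap1: "reglue F (v, u) f = - reglue F (u, v) f"
  by (cases f) (simp add: reglue_expand)

lemma reglue_swap2: "reglue F e (v, u) = - reglue F e (u, v)"
  by (cases e) (simp add: reglue_expand)

lemma reglue_linear: "olinear l \<Longrightarrow> l (reglue F e f) = reglue (\<lambda>p q. l (F p q)) e f"
  by (cases e; cases f) (simp add: reglue_expand olinearD)

lemma reglue_add: "reglue (\<lambda>p q. F p q + G p q) e f = reglue F e f + reglue G e f"
  by (cases e; cases f) (simp add: reglue_expand)

lemma reglue_neg: "reglue (\<lambda>p q. - F p q) e f = - reglue F e f"
  by (cases e; cases f) (simp add: reglue_expand)

lemma reglue_sum_mset: "reglue (\<lambda>p q. \<Sum>g\<in>#A. F g p q) e f = (\<Sum>g\<in>#A. reglue (F g) e f)"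
  by (cases e; cases f) (simp add: reglue_expand sum_mset.distrib sum_mset_subtractf)

lemma reglue_image: "reglue F (map_prod \<mu> \<mu> e) (map_prod \<mu> \<mu> f) = reglue (\<lambda>p q. F (map_prod \<mu> \<mu> p) (map_prod \<mu> \<mu> q)) e f"
  by (cases e; cases f) (simp add: reglue_expand)

lemma reglue_sum_linear: "olinear l \<Longrightarrow> l (reglue_sum L M) = reglue_sum (\<lambda>P. l (L P)) M"
  unfolding reglue_sum_def by (simp add: olinear_sum_mset reglue_linear)

lemma sub_pair: "e \<in># M \<Longrightarrow> f \<in># M - {#e#} \<Longrightarrow> {#e, f#} \<subseteq># M"
  by (metis insert_DiffM insert_subset_eq_iff single_subset_iff)

text \<open>Cutting and gluing only redistributes the ends of edges, so \<open>L\<close> is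
  evaluated solely on multisets with the ends of \<open>M\<close>. In particular valences are
  preserved.\<close>

lemma reglue_sum_cong:
  assumes "\<And>P. ends P = ends M \<Longrightarrow> L P = L' P"
  shows "reglue_sum L M = reglue_sum L' M"
  unfolding reglue_sum_def
proof (intro sum_mset_cong)
  fix e f assume "e \<in># M" "f \<in># M - {#e#}"
  then have M: "M = add_mset e (add_mset f (M - {#e, f#}))"
    using subset_mset.add_diff_inverse[OF sub_pair, of e M f] by simp
  obtain a b c d where ef: "e = (a, b)" "f = (c, d)" by fastforce
  show "reglue (\<lambda>p q. L (add_mset p (add_mset q (M - {#e, f#})))) e f =
    reglue (\<lambda>p q. L' (add_mset p (add_mset q (M - {#e, f#})))) e f"
    unfolding ef reglue_expand
    by (intro arg_cong2[of _ _ _ _ "(+)"] arg_cong2[of _ _ _ _ "(-)"] assms; subst (2) M)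
      (simp_all add: ef add_mset_commute)
qed

text \<open>The new edges are formed from end vertices alone, so every vertex map commutes with
  regluing. It is applied to transpositions for the orientation and to collapse maps.\<close>

lemma reglue_sum_image: "reglue_sum L (eimage \<mu> M) = reglue_sum (\<lambda>P. L (eimage \<mu> P)) M"
proof -
  let ?p = "map_prod \<mu> \<mu>"
  let ?G = "\<lambda>e f. reglue (\<lambda>p q. L (add_mset p (add_mset q (eimage \<mu> M - {#e, f#})))) e f"
  have "reglue_sum L (eimage \<mu> M) = (\<Sum>e\<in>#M. \<Sum>f\<in>#eimage \<mu> M - {#?p e#}. ?G (?p e) f)"
    by (simp add: reglue_sum_def multiset.map_comp comp_def)
  also have "\<dots> = (\<Sum>e\<in>#M. \<Sum>f\<in>#M - {#e#}. ?G (?p e) (?p f))"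
    by (intro sum_mset_cong) (simp add: image_mset_diff_single multiset.map_comp comp_def)
  also have "\<dots> = reglue_sum (\<lambda>P. L (eimage \<mu> P)) M"
    unfolding reglue_sum_def reglue_image
  proof (intro sum_mset_cong)
    fix e f assume "e \<in># M" "f \<in># M - {#e#}"
    then have "eimage \<mu> M - {#?p e, ?p f#} = eimage \<mu> (M - {#e, f#})"
      using image_mset_Diff[OF sub_pair, of e M f ?p] by simp
    then show "reglue (\<lambda>p q. L (add_mset (?p p) (add_mset (?p q) (eimage \<mu> M - {#?p e, ?p f#})))) e f =
      reglue (\<lambda>p q. L (eimage \<mu> (add_mset p (add_mset q (M - {#e, f#}))))) e f" by simp
  qed
  finally show ?thesis .
qed

text \<open>The terms are sorted by whether \<open>r\<close> is the first cut edge, the second one,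
  or left alone.\<close>

lemma reglue_sum_add_mset: "reglue_sum L (add_mset r M) =
    (\<Sum>f\<in>#M. reglue (\<lambda>p q. L (add_mset p (add_mset q (M - {#f#})))) r f)
    + (\<Sum>e\<in>#M. reglue (\<lambda>p q. L (add_mset p (add_mset q (M - {#e#})))) e r)
    + reglue_sum (\<lambda>P. L (add_mset r P)) M"
proof -
  let ?G = "\<lambda>K e f. reglue (\<lambda>p q. L (add_mset p (add_mset q K))) e f"
  have "(\<Sum>e\<in>#M. \<Sum>f\<in>#add_mset r M - {#e#}. ?G (add_mset r M - {#e, f#}) e f)
    = (\<Sum>e\<in>#M. ?G (M - {#e#}) e r + (\<Sum>f\<in>#M - {#e#}. ?G (add_mset r (M - {#e, f#})) e f))"
  proof (rule sum_mset_cong)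
    fix e assume e: "e \<in># M"
    have "(\<Sum>f\<in>#M - {#e#}. ?G (add_mset r M - {#e, f#}) e f) = (\<Sum>f\<in>#M - {#e#}. ?G (add_mset r (M - {#e, f#})) e f)"
      using e by (intro sum_mset_cong) (simp only: add_diff_comm2)
    then show "(\<Sum>f\<in>#add_mset r M - {#e#}. ?G (add_mset r M - {#e, f#}) e f) =
      ?G (M - {#e#}) e r + (\<Sum>f\<in>#M - {#e#}. ?G (add_mset r (M - {#e, f#})) e f)"
      using e by (simp add: add_diff_comm add_mset_commute[of e r])
  qed
  moreover have "add_mset p (add_mset q (add_mset r K)) = add_mset r (add_mset p (add_mset q K))" for p q K
    by (simp add: add_mset_commute)
  moreover have "reglue_sum L (add_mset r M) = (\<Sum>f\<in>#M. ?G (M - {#f#}) r f)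
      + (\<Sum>e\<in>#M. \<Sum>f\<in>#add_mset r M - {#e#}. ?G (add_mset r M - {#e, f#}) e f)"
    by (simp add: reglue_sum_def)
  ultimately show ?thesis by (simp only: reglue_sum_def sum_mset.distrib add.assoc)
qed

lemma reglue_sum_neg: "reglue_sum (\<lambda>P. - L P) M = - reglue_sum L M"
  by (simp add: reglue_sum_def reglue_neg sum_mset_negf)

text \<open>If the reversed edge is cut, the sign comes from \<open>reglue\<close>; otherwise it
  comes from \<open>L\<close>.\<close>

lemma reglue_sum_rev:
  assumes "\<And>P u v. L (add_mset (v, u) P) = - L (add_mset (u, v) P)"
  shows "reglue_sum L (add_mset (v, u) M) = - reglue_sum L (add_mset (u, v) M)"
  unfolding reglue_sum_add_mset
  by (simp only: reglue_swap1[of _ v u] reglue_swap2[of _ _ v u] assms[of v u] reglue_sum_neg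
      sum_mset_negf minus_add_distrib)

section \<open>The regluing operator and its commutator with the boundary\<close>

definition regluing_gen :: "lgraph \<Rightarrow> 'k::field_char_0 graph_space" where
  "regluing_gen X = reglue_sum (genm (nverts X)) (mset (edges X))"

definition regluing :: "'k::field_char_0 graph_space \<Rightarrow> 'k graph_space" where
  "regluing = lin_ext regluing_gen"

lemma regluing_respects: "or_respects (regluing_gen :: lgraph \<Rightarrow> 'k::field_char_0 graph_space)"
proof (rule or_respects_lgraphI)
  let ?F = "\<lambda>n M. reglue_sum (genm n) M :: 'k graph_space"
  show "regluing_gen X = ?F (nverts X) (mset (edges X))" for X by (rule regluing_gen_def)
  show "?F n (add_mset (v, u) M) = - ?F n (add_mset (u, v) M)" for n u v M
    by (rule reglue_sum_rev) (rule genm_rev)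
  show "?F n (eimage (transpose a b) M) = - ?F n M" if "a \<in> {1..n}" "b \<in> {1..n}" "a \<noteq> b" for n a b M
    unfolding reglue_sum_image genm_transpose[OF that] by (rule reglue_sum_neg)
qed

lemma regluing_linear: "olinear regluing"
  unfolding regluing_def by (rule lin_ext_linear[OF regluing_respects])

lemma reglue_sum_zero: "reglue_sum (\<lambda>P. 0) M = 0"
  using reglue_sum_neg[of "\<lambda>P. 0" M] reglue_sum_linear[of "\<lambda>x. 0" "\<lambda>P. 0" M] by (simp add: olinearI)

lemma regluing_genm: "regluing (genm n M) = reglue_sum (genm n) M"
proof (cases "valid_ends n (ends M)")
  case True
  then obtain X where "nverts X = n" "mset (edges X) = M" "genm n M = (gen X :: 'a graph_space)"
    by (rule genm_graph)
  then show ?thesis by (simp add: regluing_def lin_ext_gen regluing_respects regluing_gen_def)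
next
  case False
  \<comment> \<open>Regluing preserves valences, so no regluing of an invalid multiset is valid, and
    \<open>genm\<close> takes its default value 0 throughout.\<close>
  then have "reglue_sum (genm n) M = reglue_sum (\<lambda>P. 0 :: 'a graph_space) M"
    by (intro reglue_sum_cong) (simp add: genm_def)
  then show ?thesis using False by (simp add: genm_def reglue_sum_zero olinearD(3)[OF regluing_linear])
qed

text \<open>A collapse is a vertex map together with a fixed sign, so this is
  \<open>reglue_sum_image\<close>. Since \<open>M\<close> omits the collapsed edge, only other edges
  are cut.\<close>

lemma regluing_collm: "regluing (collm n M u v) = reglue_sum (\<lambda>P. collm n P u v) M"
proof (cases "u \<noteq> v \<and> u \<in> {1..n} \<and> v \<in> {1..n}")
  case True
  then show ?thesis
    by (simp add: collm_def olinearD(2)[OF regluing_linear] regluing_genm reglue_sum_image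
        reglue_sum_linear[OF olinear_scale[OF olinear_id]])
next
  case False
  then have "collm n P u v = (0 :: 'a graph_space)" for P by (auto simp: collm_def)
  then show ?thesis by (simp add: olinearD(3)[OF regluing_linear] reglue_sum_zero)
qed

lemma boundary_E_genm: "valid_ends n (ends M) \<Longrightarrow> boundary_E (genm n M) = dEm n M"
  by (metis boundary_E_gen boundary_E_gen_dEm genm_graph)

lemma dHG_reglue1: "reglue (\<lambda>p q. collm n (add_mset q N) (fst p) (snd p)) e f = dHG n N e f"
  by (simp add: reglue_def dHG_def dHK_def)

text \<open>The second new edge of X\<langle>hk\<rangle> is the first new edge for the complementary
  half-edges. Both arrows are reversed, the two signs cancel, and the four terms are merely
  permuted.\<close>

lemma dHG_reglue2: "reglue (\<lambda>p q. collm n (add_mset p N) (fst q) (snd q)) e f = (dHG n N e f :: 'k::field_char_0 graph_space)"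
proof -
  obtain a b c d where ef: "e = (a, b)" "f = (c, d)" by fastforce
  have "collm n (add_mset (y, x) N) v u = (collm n (add_mset (x, y) N) u v :: 'k graph_space)" for u v x y
    by (subst collm_rev, subst collm_rev_other) simp
  from this[of b c d a] this[of a d c b] this[of b d c a] this[of a c d b]
  show ?thesis unfolding ef dHG_reglue1[symmetric] reglue_expand by simp
qed

text \<open>An edge collapsed after regluing is new or old. Each of the two new edges contributes
  \<open>dHm\<close>, which is twice \<open>boundary_H\<close> because pairs are ordered; the old
  edges give the last term.\<close>

lemma boundary_E_regluing:
  "boundary_E (regluing x) = 4 \<bullet> boundary_H x + regluing (boundary_E (x :: 'k::field_char_0 graph_space))"
proof -
  have "(\<lambda>x. boundary_E (regluing x)) = (\<lambda>x. 4 \<bullet> boundary_H x + regluing (boundary_E (x :: 'k graph_space)))"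
  proof (rule olinear_eqI)
    fix X
    define n M where "n = nverts X" and "M = mset (edges X)"
    let ?R = "\<lambda>P. collm n P :: nat \<Rightarrow> nat \<Rightarrow> 'k graph_space"
    have v: "valid_ends n (ends M)" unfolding n_def M_def by (rule valid_lgraph)
    have dE: "dEm n (add_mset p (add_mset q N)) = ?R (add_mset q N) (fst p) (snd p) + ?R (add_mset p N) (fst q) (snd q)
       + (\<Sum>g\<in>#N. ?R (add_mset p (add_mset q (N - {#g#}))) (fst g) (snd g))" for p q N
    proof -
      have "add_mset p (add_mset q N) - {#g#} = add_mset p (add_mset q (N - {#g#}))" if "g \<in># N" for g
        using that by (simp add: add_diff_comm)
      then have "(\<Sum>g\<in>#N. ?R (add_mset p (add_mset q N) - {#g#}) (fst g) (snd g))
        = (\<Sum>g\<in>#N. ?R (add_mset p (add_mset q (N - {#g#}))) (fst g) (snd g))"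
        by (intro sum_mset_cong) simp
      then show ?thesis by (simp add: dEm_def add_mset_commute[of p q] add.assoc)
    qed
    have "boundary_E (regluing (gen X)) = reglue_sum (\<lambda>P. boundary_E (genm n P)) M"
      unfolding gen_genm[of X] regluing_genm reglue_sum_linear[OF boundary_E_linear] n_def M_def ..
    also have "\<dots> = reglue_sum (dEm n) M"
      by (rule reglue_sum_cong) (use v in \<open>simp add: boundary_E_genm\<close>)
    also have "\<dots> = dHm n M + dHm n M + (\<Sum>e\<in>#M. \<Sum>f\<in>#M - {#e#}. \<Sum>g\<in>#M - {#e, f#}.
        reglue (\<lambda>p q. ?R (add_mset p (add_mset q (M - {#e, f#} - {#g#}))) (fst g) (snd g)) e f)"
      by (simp only: reglue_sum_def dE reglue_add dHG_reglue1 dHG_reglue2 reglue_sum_mset sum_mset.distrib dHm_def)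
    \<comment> \<open>The collapsed edge \<open>g\<close> is now chosen before the cut edges instead
      of after them.\<close>
    also have "(\<Sum>e\<in>#M. \<Sum>f\<in>#M - {#e#}. \<Sum>g\<in>#M - {#e, f#}.
        reglue (\<lambda>p q. ?R (add_mset p (add_mset q (M - {#e, f#} - {#g#}))) (fst g) (snd g)) e f)
      = (\<Sum>g\<in>#M. \<Sum>e\<in>#M - {#g#}. \<Sum>f\<in>#M - {#g#} - {#e#}.
        reglue (\<lambda>p q. ?R (add_mset p (add_mset q (M - {#g#} - {#e, f#}))) (fst g) (snd g)) e f)" (is "_ = ?S")
    proof -
      have 2: "M - {#e, f#} = M - {#e#} - {#f#}" "M - {#e, f#} - {#g#} = M - {#g#} - {#e, f#}" 
        "M - {#e#} - {#g#} = M - {#g#} - {#e#}" for e f g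
        by (simp_all add: add_mset_commute)
      show ?thesis
        unfolding 2(2) unfolding 2(1)[of _ _] 
        by (subst sum_mset_distinct_swap[symmetric, of _ M], subst sum_mset_distinct_swap[of _ "M - {#_#}"]) (simp only: 2(3))
    qed
    also have "?S = (\<Sum>g\<in>#M. regluing (collm n (M - {#g#}) (fst g) (snd g)))"
      by (simp only: regluing_collm reglue_sum_def)
    also have "\<dots> = regluing (boundary_E (gen X))"
      by (simp only: boundary_E_gen boundary_E_gen_dEm dEm_def n_def M_def olinear_sum_mset[OF regluing_linear])
    also have "dHm n M = 2 \<bullet> (boundary_H (gen X) :: 'k graph_space)"
      by (simp only: boundary_H_gen double_boundary_H_gen n_def M_def)
    also have "2 \<bullet> boundary_H (gen X) + 2 \<bullet> boundary_H (gen X) = 4 \<bullet> (boundary_H (gen X) :: 'k graph_space)"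
      by (simp flip: os.scale_left_distrib)
    finally show "boundary_E (regluing (gen X)) = 4 \<bullet> boundary_H (gen X) + regluing (boundary_E (gen X) :: 'k graph_space)" .
  qed (intro olinear_add olinear_scale olinear_compose[OF regluing_linear boundary_E_linear]
      olinear_compose[OF boundary_E_linear regluing_linear] boundary_H_linear)+
  then show ?thesis by metis
qed

subsection \<open>Graded commutativity of the product and the derivation property\<close>

definition homogeneous :: "('a \<Rightarrow> nat) \<Rightarrow> nat \<Rightarrow> ('a::oriented, 'k::field_char_0) ospace \<Rightarrow> bool" where
  "homogeneous deg n x \<longleftrightarrow> x \<in> os.span (gen ` {a. deg a = n})"

lemma homogeneous_gen: "homogeneous deg (deg a) (gen a)"
  unfolding homogeneous_def by (rule os.span_base) simp

lemma homogeneous_zero: "homogeneous deg n 0"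
  and homogeneous_add: "homogeneous deg n x \<Longrightarrow> homogeneous deg n y \<Longrightarrow> homogeneous deg n (x + y)"
  and homogeneous_scale: "homogeneous deg n x \<Longrightarrow> homogeneous deg n (c \<bullet> x)"
  unfolding homogeneous_def by (rule os.span_zero os.span_add os.span_scale; assumption)+

lemma homogeneous_sum: "(\<And>a. a \<in> A \<Longrightarrow> homogeneous deg n (g a)) \<Longrightarrow> homogeneous deg n (sum g A)"
  unfolding homogeneous_def by (rule os.span_sum)

lemma homogeneous_sum_mset:
  "(\<And>a. a \<in># A \<Longrightarrow> homogeneous deg n (g a)) \<Longrightarrow> homogeneous deg n (\<Sum>a\<in>#A. g a)"
  by (induction A) (auto intro: homogeneous_add homogeneous_zero)

text \<open>Makes identities with a sign depending on the degree of x accessible: once the degree is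
  fixed, both sides are linear and generators suffice.\<close>

lemma homogeneous_eqI:
  assumes "homogeneous deg n x" "olinear f" "olinear g" "\<And>a. deg a = n \<Longrightarrow> f (gen a) = g (gen a)"
  shows "f x = g x"
  using assms(1) unfolding homogeneous_def
proof (induction rule: os.span_induct_alt)
  case base
  then show ?case by (simp add: olinearD(3)[OF assms(2)] olinearD(3)[OF assms(3)])
next
  case (step c x y)
  then show ?case using assms(4)
    by (auto simp: olinearD[OF assms(2)] olinearD[OF assms(3)])
qed

lemma genm_homogeneous: "homogeneous nverts n (genm n M :: 'k::field_char_0 graph_space)"
  by (cases rule: genm_cases[of n M, where 'k='k]) (auto simp: homogeneous_zero intro: homogeneous_gen)

lemma collm_homogeneous: "homogeneous nverts (n - 1) (collm n M u v)"
  by (simp add: collm_def genm_homogeneous homogeneous_scale homogeneous_zero)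

lemma boundary_E_homogeneous: "homogeneous nverts (nverts X - 1) (boundary_E (gen X))"
  unfolding boundary_E_gen boundary_E_gen_dEm dEm_def
  by (intro homogeneous_sum_mset collm_homogeneous)

text \<open>Covers the case in which the degree \<open>nverts X - 1\<close> of the boundary is
  truncated.\<close>

lemma boundary_E_no_vertices: "nverts X = 0 \<Longrightarrow> boundary_E (gen X) = 0"
  using valid_lgraph[of X]
  by (auto simp: boundary_E_gen boundary_E_gen_dEm dEm_def valid_ends_def ends_def)

section \<open>Signs of block permutations and graded commutativity\<close>

definition shift_cycle :: "nat \<Rightarrow> nat \<Rightarrow> nat \<Rightarrow> nat" where
  "shift_cycle a n v = (if a \<le> v \<and> v < a + n then v + 1 else if v = a + n then a else v)"

text \<open>Lengthening the cycle by one point costs one adjacent transposition.\<close>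

lemma shift_cycle: "shift_cycle a n permutes {a..a + n}" "sign (shift_cycle a n) = (-1) ^ n"
proof -
  have "shift_cycle a n permutes {a..a + n} \<and> sign (shift_cycle a n) = (-1) ^ n"
  proof (induction n)
    case 0
    have "shift_cycle a 0 = id" by (auto simp: fun_eq_iff shift_cycle_def)
    then show ?case by (simp only: permutes_id sign_id power_0 mult_0_right simp_thms)
  next
    case (Suc n)
    have e: "shift_cycle a (Suc n) = shift_cycle a n \<circ> transpose (a + n) (a + n + 1)"
      by (auto simp: fun_eq_iff shift_cycle_def transpose_def)
    have t: "transpose (a + n) (a + n + 1) permutes {a..a + Suc n}" by (rule permutes_swap_id) auto
    have s: "shift_cycle a n permutes {a..a + Suc n}"
      by (rule permutes_subset[of _ "{a..a + n}"]) (use Suc in auto)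
    have "sign (shift_cycle a (Suc n)) = sign (shift_cycle a n) * sign (transpose (a + n) (a + n + 1))"
      unfolding e by (intro sign_compose perm_permutation[OF s] perm_permutation[OF t])
    moreover have "shift_cycle a (Suc n) permutes {a..a + Suc n}"
      unfolding e by (rule permutes_compose[OF t s])
    ultimately show ?case using Suc by (simp add: sign_swap_id)
  qed
  then show "shift_cycle a n permutes {a..a + n}" "sign (shift_cycle a n) = (-1) ^ n" by auto
qed

definition block_swap :: "nat \<Rightarrow> nat \<Rightarrow> nat \<Rightarrow> nat" where
  "block_swap n m v = (if v \<in> {1..n} then v + m else if v \<in> {n + 1..n + m} then v - n else v)"

text \<open>Each vertex of the second block is carried past the \<open>n\<close> vertices of the
  first by one \<open>shift_cycle\<close> of sign \<open>(-1) ^ n\<close>.\<close>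

lemma block_swap: "block_swap n m permutes {1..n + m}" "sign (block_swap n m) = (-1) ^ (n * m)"
proof -
  have "block_swap n m permutes {1..n + m} \<and> sign (block_swap n m) = (-1) ^ (n * m)"
  proof (induction m)
    case 0
    have "block_swap n 0 = id" by (auto simp: fun_eq_iff block_swap_def)
    then show ?case by (simp only: permutes_id sign_id power_0 mult_0_right simp_thms)
  next
    case (Suc m)
    have e: "block_swap n (Suc m) = shift_cycle (m + 1) n \<circ> block_swap n m"
      by (auto simp: fun_eq_iff shift_cycle_def block_swap_def)
    have s: "shift_cycle (m + 1) n permutes {1..n + Suc m}"
      by (rule permutes_subset[OF shift_cycle(1)]) auto
    have b: "block_swap n m permutes {1..n + Suc m}"
      by (rule permutes_subset[of _ "{1..n + m}"]) (use Suc in auto)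
    have "sign (block_swap n (Suc m)) = sign (shift_cycle (m + 1) n) * sign (block_swap n m)"
      unfolding e by (intro sign_compose perm_permutation[OF s] perm_permutation[OF b])
    moreover have "block_swap n (Suc m) permutes {1..n + Suc m}"
      unfolding e by (rule permutes_compose[OF b s])
    ultimately show ?case using Suc by (simp add: shift_cycle(2) power_add)
  qed
  then show "block_swap n m permutes {1..n + m}" "sign (block_swap n m) = (-1) ^ (n * m)" by auto
qed

lemma eimage_block_swap:
  assumes "set_mset (ends M) \<subseteq> {1..n}" "set_mset (ends N) \<subseteq> {1..m}"
  shows "eimage (block_swap n m) (M + eimage ((+) n) N) = N + eimage ((+) m) M"
proof -
  have "eimage (block_swap n m) M = eimage ((+) m) M"
    by (rule eimage_cong[OF assms(1)]) (auto simp: block_swap_def)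
  moreover have "eimage (block_swap n m) (eimage ((+) n) N) = eimage id N"
    unfolding map_prod_image_comp by (rule eimage_cong[OF assms(2)]) (auto simp: block_swap_def)
  ultimately show ?thesis by (simp add: map_prod.id)
qed

text \<open>The two disjoint unions differ only by the block permutation of the vertex numbers,
  whose sign is the Koszul sign.\<close>

lemma gprod_commute_gen:
  "gen X \<odot> gen Y = (-1) ^ (nverts X * nverts Y) \<bullet> (gen Y \<odot> gen X :: 'k::field_char_0 graph_space)"
proof -
  let ?n = "nverts X" let ?m = "nverts Y" let ?M = "mset (edges X)" let ?N = "mset (edges Y)"
  have b: "set_mset (ends ?M) \<subseteq> {1..?n}" "set_mset (ends ?N) \<subseteq> {1..?m}"
    by (intro valid_ends_subset valid_lgraph)+
  have "gen Y \<odot> gen X = (genm (?n + ?m) (eimage (block_swap ?n ?m) (?M + eimage ((+) ?n) ?N)) :: 'k graph_space)"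
    unfolding eimage_block_swap[OF b] by (simp add: gprod_gen gunion_genm add.commute)
  also have "\<dots> = (-1) ^ (?n * ?m) \<bullet> (gen X \<odot> gen Y)"
    unfolding genm_perm[OF block_swap(1)] block_swap(2) by (simp add: gprod_gen gunion_genm)
  finally show ?thesis by (simp flip: power_mult_distrib)
qed

lemma gprod_commute:
  assumes "homogeneous nverts n x" "homogeneous nverts m y"
  shows "x \<odot> y = (-1) ^ (n * m) \<bullet> (y \<odot> x :: 'k::field_char_0 graph_space)"
proof (rule homogeneous_eqI[OF assms(1)])
  fix X assume "nverts X = n"
  then show "gen X \<odot> y = (-1) ^ (n * m) \<bullet> (y \<odot> gen X)"
    by (intro homogeneous_eqI[OF assms(2), of "\<lambda>y. gen X \<odot> y"])
      (auto simp: gprod_commute_gen[of X] intro: gprod_linear1 gprod_linear2 olinear_scale)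
qed (intro gprod_linear1 gprod_linear2 olinear_scale)+

section \<open>The boundary as a derivation of the product\<close>

lemma collm_gprod:
  assumes "set_mset (ends M) \<subseteq> {1..n}" "set_mset (ends N) \<subseteq> {1..m}" "u \<in> {1..n}" "v \<in> {1..n}"
  shows "collm (n + m) (M + eimage ((+) n) N) u v = collm n M u v \<odot> (genm m N :: 'k::field_char_0 graph_space)"
proof (cases "u = v")
  case True
  then show ?thesis by (simp add: collm_def olinearD(3)[OF gprod_linear1])
next
  case False
  let ?\<sigma> = "to12 u v" let ?\<mu> = "merge12 \<circ> to12 u v"
  note t = to12[OF False assms(3,4)]
  have n: "n \<ge> 2" using False assms(3,4) by auto
  have p: "?\<sigma> permutes {1..n + m}" by (rule permutes_subset[OF t(1)]) auto
  have r: "?\<mu> w \<in> {1..n - 1}" if "w \<in> {1..n}" for w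
    using permutes_in_image[OF t(1), of w] that n by (auto simp: merge12_def)
  have M: "set_mset (ends (eimage ?\<mu> M)) \<subseteq> {1..n - 1}"
    unfolding ends_image set_image_mset using assms(1) r by blast
  \<comment> \<open>The relabelling fixes the vertices of the second factor and
    \<open>merge12\<close> lowers them by one, so their shift drops from \<open>n\<close> to
    \<open>n - 1\<close>.\<close>
  have "?\<sigma> (n + w) = n + w" if "w \<in> {1..m}" for w
    by (rule permutes_not_in[OF t(1)]) (use that in auto)
  then have "eimage ?\<mu> (eimage ((+) n) N) = eimage ((+) (n - 1)) N"
    unfolding map_prod_image_comp
    by (intro eimage_cong[OF assms(2)]) (use n in \<open>auto simp: merge12_def\<close>)
  then have "collm (n + m) (M + eimage ((+) n) N) u v
    = of_int (sign ?\<sigma>) \<bullet> (genm (n + m - 1) (eimage ?\<mu> M + eimage ((+) (n - 1)) N) :: 'k graph_space)"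
    using assms(3,4) by (subst collm_eq[OF False _ _ p t(2,3)]) auto
  also have "n + m - 1 = n - 1 + m" using n by simp
  also have "genm (n - 1 + m) (eimage ?\<mu> M + eimage ((+) (n - 1)) N) = (genm (n - 1) (eimage ?\<mu> M) \<odot> genm m N :: 'k graph_space)"
    by (rule genm_gprod[OF M assms(2), symmetric])
  finally show ?thesis using False assms(3,4)
    by (simp add: collm_def olinearD(2)[OF gprod_linear1])
qed

text \<open>Exchange the blocks, collapse in what is now the left factor, and exchange back. The
  signs \<open>(-1) ^ (n * m)\<close> and \<open>(-1) ^ ((m - 1) * n)\<close> leave
  \<open>(-1) ^ n\<close>.\<close>

lemma collm_gprod_right:
  assumes "set_mset (ends M) \<subseteq> {1..n}" "set_mset (ends N) \<subseteq> {1..m}" "u \<in> {1..m}" "v \<in> {1..m}"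
  shows "collm (n + m) (M + eimage ((+) n) N) (n + u) (n + v) =
    (-1) ^ n \<bullet> (genm n M \<odot> (collm m N u v :: 'k::field_char_0 graph_space))"
proof -
  let ?\<rho> = "block_swap n m" let ?P = "M + eimage ((+) n) N"
  \<comment> \<open>The vertex \<open>u\<close> makes \<open>m\<close> positive, so
    \<open>m - 1\<close> is not truncated.\<close>
  obtain k where k: "m = Suc k" using assms(3) by (cases m) auto
  have r: "?\<rho> (n + u) = u" "?\<rho> (n + v) = v" using assms(3,4) by (auto simp: block_swap_def)
  have "(-1) ^ (n * m) \<bullet> collm (n + m) ?P (n + u) (n + v) = (collm (m + n) (N + eimage ((+) m) M) u v :: 'k graph_space)"
    using collm_perm[OF block_swap(1), of n m ?P "n + u" "n + v", where 'a='k, symmetric]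
    unfolding r eimage_block_swap[OF assms(1,2)] block_swap(2) by (simp add: add.commute)
  also have "\<dots> = collm m N u v \<odot> (genm n M :: 'k graph_space)"
    by (rule collm_gprod[OF assms(2,1,3,4)])
  also have "\<dots> = (-1) ^ ((m - 1) * n) \<bullet> (genm n M \<odot> collm m N u v)"
    by (rule gprod_commute[OF collm_homogeneous genm_homogeneous])
  finally have "(-1) ^ (n * m) \<bullet> (-1) ^ (n * m) \<bullet> collm (n + m) ?P (n + u) (n + v)
     = (-1) ^ (n * m) \<bullet> (-1) ^ ((m - 1) * n) \<bullet> (genm n M \<odot> (collm m N u v :: 'k graph_space))" by simp
  moreover have "(-1) ^ (n * m) * (-1) ^ (n * m) = (1::'k)" by (simp flip: power_mult_distrib)
  moreover have "(-1) ^ (n * m) * (-1) ^ ((m - 1) * n) = ((-1) ^ n :: 'k)"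
    unfolding k by (simp add: power_add mult.commute flip: power_mult_distrib)
  ultimately show ?thesis by simp
qed

text \<open>Every edge of a disjoint union lies in exactly one factor, so the sum over edges splits
  in two.\<close>

lemma boundary_E_gprod:
  "boundary_E (gen X \<odot> y) = boundary_E (gen X) \<odot> y + (-1) ^ nverts X \<bullet> (gen X \<odot> boundary_E (y :: 'k::field_char_0 graph_space))"
proof -
  have "(\<lambda>y. boundary_E (gen X \<odot> y)) = (\<lambda>y. boundary_E (gen X) \<odot> y + (-1) ^ nverts X \<bullet> (gen X \<odot> boundary_E (y :: 'k graph_space)))"
  proof (rule olinear_eqI)
    fix Y
    define n m M N where "n = nverts X" and "m = nverts Y" and "M = mset (edges X)" and "N = mset (edges Y)"
    note defs = n_def m_def M_def N_def
    let ?s = "\<lambda>N. eimage ((+) n) N"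
    have b: "set_mset (ends M) \<subseteq> {1..n}" "set_mset (ends N) \<subseteq> {1..m}"
      unfolding defs by (intro valid_ends_subset valid_lgraph)+
    have b': "set_mset (ends (M - {#e#})) \<subseteq> {1..n}" "set_mset (ends (N - {#e#})) \<subseteq> {1..m}" for e
      using b unfolding ends_bound by (auto dest: in_diffD)
    have 1: "collm (n + m) (M + ?s N - {#e#}) (fst e) (snd e) = (collm n (M - {#e#}) (fst e) (snd e) \<odot> gen Y :: 'k graph_space)"
      if "e \<in># M" for e
    proof -
      have *: "M + ?s N - {#e#} = M - {#e#} + ?s N" using that by simp
      show ?thesis unfolding *
        by (subst collm_gprod[OF b'(1) b(2)]) (use that b(1) in \<open>auto simp: gen_genm[of Y] defs(2,4) ends_bound\<close>)
    qed
    have 2: "collm (n + m) (M + ?s N - {#map_prod ((+) n) ((+) n) e#}) (n + fst e) (n + snd e)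
       = (-1) ^ n \<bullet> (gen X \<odot> collm m (N - {#e#}) (fst e) (snd e) :: 'k graph_space)"
      if "e \<in># N" for e
    proof -
      have *: "M + ?s N - {#map_prod ((+) n) ((+) n) e#} = M + ?s (N - {#e#})"
        using that by (subst image_mset_diff_single[symmetric]) (auto intro!: multiset_diff_union_assoc)
      show ?thesis unfolding *
        using collm_gprod_right[OF b(1) b'(2), of "fst e" "snd e", where 'k='k] that b(2)
        by (simp add: gen_genm[of X] defs(1,3) ends_bound)
    qed
    have "boundary_E (gen X \<odot> gen Y) = (dEm (n + m) (M + ?s N) :: 'k graph_space)"
      by (simp add: gprod_gen boundary_E_gen boundary_E_gen_dEm edges_union defs)
    also have "\<dots> = (\<Sum>e\<in>#M. collm (n + m) (M + ?s N - {#e#}) (fst e) (snd e)) +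
       (\<Sum>e\<in>#N. collm (n + m) (M + ?s N - {#map_prod ((+) n) ((+) n) e#}) (n + fst e) (n + snd e))"
      by (simp add: dEm_def multiset.map_comp comp_def)
    also have "\<dots> = (\<Sum>e\<in>#M. collm n (M - {#e#}) (fst e) (snd e) \<odot> gen Y) +
       (\<Sum>e\<in>#N. (-1) ^ n \<bullet> (gen X \<odot> collm m (N - {#e#}) (fst e) (snd e)))"
      by (intro arg_cong2[of _ _ _ _ "(+)"] sum_mset_cong 1 2)
    also have "\<dots> = boundary_E (gen X) \<odot> gen Y + (-1) ^ n \<bullet> (gen X \<odot> boundary_E (gen Y))"
      unfolding boundary_E_gen boundary_E_gen_dEm dEm_def olinear_sum_mset[OF gprod_linear1]
        olinear_sum_mset[OF gprod_linear2] sum_mset_scale defs ..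
    finally show "boundary_E (gen X \<odot> gen Y) = boundary_E (gen X) \<odot> gen Y
      + (-1) ^ nverts X \<bullet> (gen X \<odot> boundary_E (gen Y) :: 'k graph_space)" unfolding n_def .
  qed (intro olinear_add olinear_scale olinear_compose[OF gprod_linear2 boundary_E_linear]
      olinear_compose[OF boundary_E_linear gprod_linear2] gprod_linear2)+
  then show ?thesis by metis
qed

subsection \<open>Compatibility of the coproduct with the boundary operator\<close>

lemma tprod_tensor:
  assumes "homogeneous nverts s y" "homogeneous nverts t z"
  shows "tprod (x \<otimes> y) (z \<otimes> w) = (-1) ^ (s * t) \<bullet> ((x \<odot> z) \<otimes> (y \<odot> w) :: 'k::field_char_0 graph_space2)"
proof (rule homogeneous_eqI[OF assms(1)])
  fix Y assume Y: "nverts Y = s"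
  show "tprod (x \<otimes> gen Y) (z \<otimes> w) = (-1) ^ (s * t) \<bullet> ((x \<odot> z) \<otimes> (gen Y \<odot> w) :: 'k graph_space2)"
  proof (rule homogeneous_eqI[OF assms(2)])
    fix Z assume Z: "nverts Z = t"
    show "tprod (x \<otimes> gen Y) (gen Z \<otimes> w) = (-1) ^ (s * t) \<bullet> ((x \<odot> gen Z) \<otimes> (gen Y \<odot> w) :: 'k graph_space2)"
    proof (rule bilinear_eqI[where f = "\<lambda>x w. tprod (x \<otimes> gen Y) (gen Z \<otimes> w)"])
      show "tprod (gen X \<otimes> gen Y) (gen Z \<otimes> gen W) = (-1) ^ (s * t) \<bullet> ((gen X \<odot> gen Z) \<otimes> (gen Y \<odot> gen W) :: 'k graph_space2)" for X W
        by (simp add: tprod_gen Y Z)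
    qed (intro olinear_scale olinear_compose[OF tensor_linear1 tprod_linear1] olinear_compose[OF tensor_linear2 tprod_linear2]
        olinear_compose[OF gprod_linear1 tensor_linear1] olinear_compose[OF gprod_linear2 tensor_linear2])+
  qed (intro olinear_scale olinear_compose[OF tensor_linear1 tprod_linear2] olinear_compose[OF gprod_linear2 tensor_linear1]
      olinear_compose[OF gprod_linear1 tensor_linear2])+
qed (intro olinear_scale olinear_compose[OF tensor_linear2 tprod_linear1] olinear_compose[OF gprod_linear1 tensor_linear2])+

lemma boundary_E2_homogeneous:
  assumes "homogeneous nverts n x"
  shows "boundary_E2 (x \<otimes> y) = boundary_E x \<otimes> y + (-1) ^ n \<bullet> (x \<otimes> boundary_E y)"
proof (rule homogeneous_eqI[OF assms])
  show "boundary_E2 (gen X \<otimes> y) = boundary_E (gen X) \<otimes> y + (-1) ^ n \<bullet> (gen X \<otimes> boundary_E y)"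
    if "nverts X = n" for X
    using boundary_E2_tensor[of X y] that by (simp add: tensor_simps1)
qed (intro olinear_add olinear_scale olinear_compose[OF tensor_linear1 boundary_E2_linear]
    olinear_compose[OF boundary_E_linear tensor_linear1] tensor_linear1)+

lemma minus_one_power_pred_mult:
  assumes "y > 0"
  shows "(-1) ^ ((y - 1) * z) = (-1) ^ (y * z) * ((-1) ^ z :: 'k::field_char_0)"
proof -
  obtain k where "y = Suc k" using assms by (cases y) auto
  then show ?thesis by (simp add: power_add mult.commute flip: power_mult_distrib)
qed

text \<open>The boundary lowers the degree of \<open>gen Y\<close> by one, which changes the Koszul
  sign by \<open>(-1) ^ nverts Z\<close>.\<close>

lemma tprod_boundary_E_left:
  "tprod (x \<otimes> boundary_E (gen Y)) (gen Z \<otimes> w) =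
    (-1) ^ (nverts Y * nverts Z + nverts Z) \<bullet> ((x \<odot> gen Z) \<otimes> (boundary_E (gen Y) \<odot> w) :: 'k::field_char_0 graph_space2)"
proof (cases "nverts Y = 0")
  case True
  then show ?thesis
    by (simp add: boundary_E_no_vertices tensor_simps2 olinearD(3)[OF gprod_linear1] olinearD(3)[OF tprod_linear1] tensor_simps1)
next
  case False
  then show ?thesis
    by (simp add: tprod_tensor[OF boundary_E_homogeneous homogeneous_gen] minus_one_power_pred_mult power_add
      del: One_nat_def)
qed

lemma tprod_boundary_E_right:
  "tprod (x \<otimes> gen Y) (boundary_E (gen Z) \<otimes> w) =
    (-1) ^ (nverts Y * nverts Z + nverts Y) \<bullet> ((x \<odot> boundary_E (gen Z)) \<otimes> (gen Y \<odot> w) :: 'k::field_char_0 graph_space2)"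
proof (cases "nverts Z = 0")
  case True
  then show ?thesis
    by (simp add: boundary_E_no_vertices tensor_simps1 olinearD(3)[OF gprod_linear2] olinearD(3)[OF tprod_linear2])
next
  case False
  then show ?thesis
    by (simp add: tprod_tensor[OF homogeneous_gen boundary_E_homogeneous] minus_one_power_pred_mult power_add
      mult.commute[of "nverts Y"] del: One_nat_def)
qed

abbreviation nverts2 :: "lgraph \<times> lgraph \<Rightarrow> nat" where
  "nverts2 p \<equiv> nverts (fst p) + nverts (snd p)"

text \<open>Both sides consist of the same four terms, one for each graph in which an edge is
  collapsed. With the signs abbreviated, they are compared as monomials in quantities of square
  1.\<close>

lemma boundary_E2_tprod_gen:
  "boundary_E2 (tprod (gen X \<otimes> gen Y) (gen Z \<otimes> gen W)) = tprod (boundary_E2 (gen X \<otimes> gen Y)) (gen Z \<otimes> gen W)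
    + (-1) ^ (nverts X + nverts Y) \<bullet> (tprod (gen X \<otimes> gen Y) (boundary_E2 (gen Z \<otimes> gen W)) :: 'k::field_char_0 graph_space2)"
proof -
  define x y z :: 'k where "x = (-1) ^ nverts X" and "y = (-1) ^ nverts Y" and "z = (-1) ^ nverts Z"
  define yz :: 'k where "yz = (-1) ^ (nverts Y * nverts Z)"
  have sq: "x * x = 1" "y * y = 1" "z * z = 1" by (simp_all add: x_def y_def z_def flip: power_mult_distrib)
  have sq': "y * (y * t) = t" "z * (z * t) = t" for t using sq by (metis mult.assoc mult_1)+
  note scale = olinearD(2)[OF tprod_linear1] olinearD(2)[OF tprod_linear2] tensor_simps1 tensor_simps2
    olinearD(1)[OF tprod_linear1] olinearD(1)[OF tprod_linear2] os.scale_right_distrib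
  have XZ: "homogeneous nverts (nverts X + nverts Z) (gen X \<odot> gen Z :: 'k graph_space)"
    using homogeneous_gen[of nverts "gunion X Z"] by (simp add: gprod_gen edges_union)
  have "boundary_E2 (tprod (gen X \<otimes> gen Y) (gen Z \<otimes> gen W)) =
     yz \<bullet> ((boundary_E (gen X) \<odot> gen Z) \<otimes> (gen Y \<odot> gen W)) + (yz * x) \<bullet> ((gen X \<odot> boundary_E (gen Z)) \<otimes> (gen Y \<odot> gen W))
     + (yz * x * z) \<bullet> ((gen X \<odot> gen Z) \<otimes> (boundary_E (gen Y) \<odot> gen W))
     + (yz * x * z * y) \<bullet> ((gen X \<odot> gen Z) \<otimes> (gen Y \<odot> boundary_E (gen W)))"
    unfolding tprod_gen olinearD(2)[OF boundary_E2_linear]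
      boundary_E2_homogeneous[OF XZ]
      boundary_E_gprod x_def y_def z_def yz_def
    by (simp add: scale power_add mult_ac add_ac)
  moreover have "tprod (boundary_E2 (gen X \<otimes> gen Y)) (gen Z \<otimes> gen W) =
     yz \<bullet> ((boundary_E (gen X) \<odot> gen Z) \<otimes> (gen Y \<odot> gen W))
     + (x * yz * z) \<bullet> ((gen X \<odot> gen Z) \<otimes> (boundary_E (gen Y) \<odot> gen W))"
    unfolding boundary_E2_homogeneous[OF homogeneous_gen] scale tprod_boundary_E_left
      tprod_tensor[OF homogeneous_gen homogeneous_gen] x_def z_def yz_def
    by (simp add: power_add mult_ac)
  moreover have "tprod (gen X \<otimes> gen Y) (boundary_E2 (gen Z \<otimes> gen W)) =
     (yz * y) \<bullet> ((gen X \<odot> boundary_E (gen Z)) \<otimes> (gen Y \<odot> gen W))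
     + (z * yz) \<bullet> ((gen X \<odot> gen Z) \<otimes> (gen Y \<odot> boundary_E (gen W)))"
    unfolding boundary_E2_homogeneous[OF homogeneous_gen] scale tprod_boundary_E_right
      tprod_tensor[OF homogeneous_gen homogeneous_gen] y_def z_def yz_def
    by (simp add: power_add mult_ac)
  moreover have "(-1) ^ (nverts X + nverts Y) = x * y" by (simp add: x_def y_def power_add)
  ultimately show ?thesis
    by (simp add: os.scale_right_distrib mult_ac sq')
qed

lemma boundary_E2_tprod:
  assumes "homogeneous nverts2 n p"
  shows "boundary_E2 (tprod p q) = tprod (boundary_E2 p) q + (-1) ^ n \<bullet> tprod p (boundary_E2 q)"
proof (rule homogeneous_eqI[OF assms])
  fix A :: "lgraph \<times> lgraph" assume A: "nverts2 A = n"
  have "(\<lambda>q. boundary_E2 (tprod (gen A) q)) = (\<lambda>q. tprod (boundary_E2 (gen A)) q + (-1) ^ n \<bullet> tprod (gen A) (boundary_E2 q))"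
  proof (rule olinear_eqI)
    fix B :: "lgraph \<times> lgraph"
    show "boundary_E2 (tprod (gen A) (gen B)) = tprod (boundary_E2 (gen A)) (gen B) + (-1) ^ n \<bullet> tprod (gen A) (boundary_E2 (gen B))"
      using boundary_E2_tprod_gen[of "fst A" "snd A" "fst B" "snd B"] A by (simp add: tensor_gen)
  qed (intro olinear_add olinear_scale olinear_compose[OF tprod_linear2 boundary_E2_linear]
      olinear_compose[OF boundary_E2_linear tprod_linear2] tprod_linear2)+
  then show "boundary_E2 (tprod (gen A) q) = tprod (boundary_E2 (gen A)) q + (-1) ^ n \<bullet> tprod (gen A) (boundary_E2 q)"
    by metis
qed (intro olinear_add olinear_scale olinear_compose[OF tprod_linear1 boundary_E2_linear]
    olinear_compose[OF boundary_E2_linear tprod_linear1] tprod_linear1)+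

lemma tensor_homogeneous:
  assumes "homogeneous nverts s x" "homogeneous nverts t y"
  shows "homogeneous nverts2 (s + t) (x \<otimes> y)"
proof -
  have 1: "homogeneous nverts2 (nverts X + t) (gen X \<otimes> y)" for X
    using assms(2) unfolding homogeneous_def[of nverts]
  proof (induction rule: os.span_induct_alt)
    case base
    show ?case by (simp add: tensor_simps2 homogeneous_zero)
  next
    case (step c u v)
    then obtain U where "u = gen U" "nverts U = t" by auto
    then show ?case using step(2) homogeneous_gen[of nverts2 "(X, U)"]
      by (auto simp: tensor_simps2 tensor_gen intro!: homogeneous_add homogeneous_scale)
  qed
  show ?thesis
    using assms(1) unfolding homogeneous_def[of nverts]
  proof (induction rule: os.span_induct_alt)
    case base
    show ?case by (simp add: tensor_simps1 homogeneous_zero)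
  next
    case (step c u v)
    then show ?case using 1 by (auto simp: tensor_simps1 intro!: homogeneous_add homogeneous_scale)
  qed
qed

lemma coprod_gen: "coprod (gen X) = Dm (nverts X) (mset (edges X))"
  by (simp add: coprod_eq lin_ext_gen coprod_gen_respects coprod_gen_def)

text \<open>Each term distributes the vertices of \<open>X\<close> over the two factors. The degree
  supplies the sign when \<open>boundary_E2_tprod\<close> is applied to a coproduct.\<close>

lemma coprod_homogeneous: "homogeneous nverts2 (nverts X) (coprod (gen X))"
  unfolding coprod_gen Dm_def
proof (rule homogeneous_sum)
  fix S assume "S \<in> {S. clos (nverts X) (mset (edges X)) S}"
  then have S: "S \<subseteq> {1..nverts X}" by (auto simp: clos_def)
  then have n: "card S + card ({1..nverts X} - S) = nverts X"
    using card_mono[of "{1..nverts X}" S] by (simp add: card_Diff_subset finite_subset)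
  show "homogeneous nverts2 (nverts X) (Dterm (nverts X) (mset (edges X)) S)"
    unfolding Dterm_def part_def
    by (rule homogeneous_scale, rule tensor_homogeneous[OF genm_homogeneous genm_homogeneous, of "card S"
        "card ({1..nverts X} - S)", unfolded n])
qed

section \<open>Collapses of connected graphs\<close>

lemma set_remove_nth: "i < length xs \<Longrightarrow> x \<in> set xs \<Longrightarrow> x \<noteq> xs ! i \<Longrightarrow> x \<in> set (remove_nth i xs)"
  by (metis insert_iff mset_remove_nth mset_update2(2) set_mset_add_mset_insert set_mset_mset)

text \<open>The vertex map of the collapse is onto and sends each edge to an edge or a single
  vertex, so walks project to walks.\<close>

lemma contract_connected:
  assumes X: "gconnected X" and i: "i < length (edges X)" "fst (edges X ! i) \<noteq> snd (edges X ! i)"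
  shows "gconnected (contract12 i (relabel (to12 (fst (edges X ! i)) (snd (edges X ! i))) X))"
proof -
  define u v where "u = fst (edges X ! i)" and "v = snd (edges X ! i)"
  let ?\<sigma> = "to12 u v" let ?n = "nverts X" let ?Y = "relabel ?\<sigma> X" let ?Z = "contract12 i ?Y"
  define \<mu> where "\<mu> = merge12 \<circ> ?\<sigma>"
  have uv: "u \<in> {1..?n}" "v \<in> {1..?n}" "u \<noteq> v" using edge_in[OF i(1)] i(2) by (auto simp: u_def v_def)
  note t = to12[OF uv(3,1,2)]
  have n: "?n \<ge> 2" using uv by auto
  have e: "edges ?Y = map (map_prod ?\<sigma> ?\<sigma>) (edges X)" by (rule edges_relabel[OF t(1)])
  have iY: "i < length (edges ?Y)" "edges ?Y ! i = (1, 2)"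
    using i(1) t(2,3) by (simp_all add: e u_def v_def map_prod_def split_def del: One_nat_def flip: u_def v_def)
  note Z = contract12_simps[OF iY, simplified]
  let ?R = "\<lambda>E. (set E \<union> (set E)\<inverse>)\<^sup>*"
  have edge: "(\<mu> a, \<mu> b) \<in> set (edges ?Z) \<or> \<mu> a = \<mu> b" if "(a, b) \<in> set (edges X)" for a b
  proof (cases "map_prod ?\<sigma> ?\<sigma> (a, b) = (1, 2)")
    \<comment> \<open>This is the collapsed edge or one parallel to it in the same direction; both
      ends go to vertex 1.\<close>
    case True
    then show ?thesis by (simp add: \<mu>_def merge12_def)
  next
    case False
    have "map_prod ?\<sigma> ?\<sigma> (a, b) \<in> set (remove_nth i (edges ?Y))"
      by (rule set_remove_nth[OF iY(1)]) (use that False iY(2) in \<open>force simp: e\<close>)+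
    then have "map_prod merge12 merge12 (map_prod ?\<sigma> ?\<sigma> (a, b)) \<in> set (edges ?Z)"
      unfolding Z(2) set_map by (rule imageI)
    then show ?thesis by (simp add: \<mu>_def)
  qed
  have walk: "(\<mu> a, \<mu> b) \<in> ?R (edges ?Z)" if "(a, b) \<in> ?R (edges X)" for a b
    using that
  proof (induction rule: rtrancl_induct)
    case base
    then show ?case by simp
  next
    case (step y z)
    have "(\<mu> y, \<mu> z) \<in> set (edges ?Z) \<union> (set (edges ?Z))\<inverse> \<or> \<mu> y = \<mu> z"
      using step(2) edge[of y z] edge[of z y] by auto
    then show ?case using step(3) by (metis rtrancl.rtrancl_into_rtrancl)
  qed
  have surj: "\<exists>a\<in>{1..?n}. \<mu> a = w" if "w \<in> {1..?n - 1}" for w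
  proof -
    define w' where "w' = (if w = 1 then 1 else w + 1)"
    have w': "w' \<in> {1..?n}" "merge12 w' = w" using that by (auto simp: w'_def merge12_def)
    have "w' \<in> ?\<sigma> ` {1..?n}" unfolding permutes_image[OF t(1)] by (rule w'(1))
    then show ?thesis using w'(2) by (auto simp: \<mu>_def)
  qed
  have "(w, w') \<in> ?R (edges ?Z)" if "w \<in> {1..?n - 1}" "w' \<in> {1..?n - 1}" for w w'
    using surj[OF that(1)] surj[OF that(2)] walk X unfolding gconnected_def by metis
  then have "gconnected ?Z" using n by (simp add: gconnected_def Z(1))
  then show ?thesis by (simp only: u_def v_def)
qed

section \<open>The coproduct as a chain map\<close>

lemma coprod_linear: "olinear coprod"
  and coprod_gone: "coprod gone = gone \<otimes> gone"
  and coprod_connected: "gconnected X \<Longrightarrow> coprod (gen X) = gen X \<otimes> gone + gone \<otimes> gen X"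
  and coprod_gprod: "coprod (x \<odot> y) = tprod (coprod x) (coprod y)"
  using coprod_is_coproduct by (auto simp: is_coproduct_def)

lemma boundary_E_gone: "boundary_E gone = 0"
  unfolding gone_def by (rule boundary_E_no_vertices) (rule edges_empty)

text \<open>Every collapse of a connected graph is connected, hence primitive, and sums of primitive
  elements are primitive.\<close>

lemma coprod_boundary_E_connected:
  assumes "gconnected X"
  shows "coprod (boundary_E (gen X)) = boundary_E (gen X) \<otimes> gone + gone \<otimes> (boundary_E (gen X) :: 'k::field_char_0 graph_space)"
proof -
  have "coprod (collapse X i) = collapse X i \<otimes> gone + gone \<otimes> (collapse X i :: 'k graph_space)"
    if "i < length (edges X)" "fst (edges X ! i) \<noteq> snd (edges X ! i)" for i
    by (simp add: collapse_def Let_def olinearD(2)[OF coprod_linear] coprod_connected[OF contract_connected[OF assms that]]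
        tensor_simps1 tensor_simps2 os.scale_right_distrib)
  then show ?thesis
    by (simp add: boundary_E_gen boundary_E_gen_def olinearD(6)[OF coprod_linear] tensor_simps1 tensor_simps2
        flip: sum.distrib)
qed

lemma coprod_boundary_E_gprod:
  assumes "coprod (boundary_E (gen Y)) = boundary_E2 (coprod (gen Y :: 'k::field_char_0 graph_space))"
    and "coprod (boundary_E y) = boundary_E2 (coprod (y :: 'k graph_space))"
  shows "coprod (boundary_E (gen Y \<odot> y)) = boundary_E2 (coprod (gen Y \<odot> y))"
  by (simp add: coprod_gprod boundary_E_gprod boundary_E2_tprod[OF coprod_homogeneous] assms
      olinearD(1,2)[OF coprod_linear])

text \<open>Induction on the number of vertices. A disconnected graph is by \<open>unshuffle\<close>
  a multiple of a product of two smaller parts, and the property passes to products by the two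
  derivation rules.\<close>

lemma coprod_boundary_E: "coprod (boundary_E x) = boundary_E2 (coprod (x :: 'k::field_char_0 graph_space))"
proof -
  note lin = olinear_compose[OF boundary_E_linear coprod_linear] olinear_compose[OF coprod_linear boundary_E2_linear]
  have "coprod (boundary_E (gen X)) = boundary_E2 (coprod (gen X :: 'k graph_space))" for X
  proof (induction "nverts X" arbitrary: X rule: less_induct)
    case less
    let ?n = "nverts X" let ?M = "mset (edges X)"
    have M: "set_mset (ends ?M) \<subseteq> {1..?n}" by (intro valid_ends_subset valid_lgraph)
    consider "?n = 0" | "gconnected X" | "?n > 0" "\<not> gconnected X" by blast
    then show ?case
    proof cases
      case 1
      then have "ends ?M = {#}" using M by auto
      then have "?M = {#}" by (auto simp: ends_def)
      then have "gen X = (gone :: 'k graph_space)" unfolding gone_genm by (subst gen_genm) (simp add: 1)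
      then show ?thesis using boundary_E2_tensor[of gempty "gone :: 'k graph_space"]
        by (simp add: coprod_gone boundary_E_gone olinearD(3)[OF coprod_linear] tensor_simps1 tensor_simps2 flip: gone_def)
    next
      case 2
      \<comment> \<open>Writing the left unit as the generator \<open>gen gempty\<close> shows that
        its degree is 0 and its sign trivial.\<close>
      have "boundary_E2 (coprod (gen X)) = boundary_E2 (gen X \<otimes> gone) + boundary_E2 (gen gempty \<otimes> gen X :: 'k graph_space2)"
        by (simp add: coprod_connected[OF 2] olinearD(1)[OF boundary_E2_linear] flip: gone_def)
      also have "\<dots> = boundary_E (gen X) \<otimes> gone + gone \<otimes> boundary_E (gen X)"
        unfolding boundary_E2_homogeneous[OF homogeneous_gen]
        by (simp add: boundary_E_gone edges_empty tensor_simps1 tensor_simps2 flip: gone_def)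
      finally show ?thesis by (simp add: coprod_boundary_E_connected[OF 2])
    next
      case 3
      obtain S where S: "clos ?n ?M S" "S \<noteq> {}" "S \<noteq> {1..?n}" using disconnected_clos[OF 3] by blast
      let ?C = "{1..?n} - S"
      obtain c :: int where c: "genm ?n ?M = of_int c \<bullet> (part S ?M \<odot> part ?C ?M :: 'k graph_space)"
        using unshuffle[OF S(1) M, where 'k='k] by blast
      have sub: "S \<subseteq> {1..?n}" by (rule closD(2)[OF S(1)])
      have less': "card S < ?n" "card ?C < ?n"
        using psubset_card_mono[of "{1..?n}" S] psubset_card_mono[of "{1..?n}" ?C] sub S(2,3) by auto
      \<comment> \<open>The induction hypothesis concerns generators, whereas each factor is a value
        of \<open>genm\<close>, hence a generator or the default 0.\<close>
      have "coprod (boundary_E (part S ?M \<odot> part ?C ?M)) = boundary_E2 (coprod (part S ?M \<odot> part ?C ?M :: 'k graph_space))"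
        unfolding part_def
      proof (cases rule: genm_cases[of "card S" "subm S ?M", where 'k='k])
        case 1
        then show "coprod (boundary_E (genm (card S) (subm S ?M) \<odot> genm (card ?C) (subm ?C ?M))) =
          boundary_E2 (coprod (genm (card S) (subm S ?M) \<odot> genm (card ?C) (subm ?C ?M) :: 'k graph_space))"
          by (simp add: olinearD(3)[OF gprod_linear1] olinearD(3)[OF lin(1)] olinearD(3)[OF lin(2)])
      next
        case (2 Y)
        show "coprod (boundary_E (genm (card S) (subm S ?M) \<odot> genm (card ?C) (subm ?C ?M))) =
          boundary_E2 (coprod (genm (card S) (subm S ?M) \<odot> genm (card ?C) (subm ?C ?M) :: 'k graph_space))"
        proof (cases rule: genm_cases[of "card ?C" "subm ?C ?M", where 'k='k])
          case 1
          then show ?thesis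
            by (simp add: olinearD(3)[OF gprod_linear2] olinearD(3)[OF lin(1)] olinearD(3)[OF lin(2)])
        next
          case (2 W)
          then show ?thesis unfolding \<open>genm (card S) _ = gen Y\<close> 2(3)
            by (intro coprod_boundary_E_gprod less) (use less' \<open>nverts Y = _\<close> in auto)
        qed
      qed
      then show ?thesis unfolding gen_genm[of X] c
        by (simp add: olinearD(2)[OF lin(1)] olinearD(2)[OF lin(2)])
    qed
  qed
  then have "(\<lambda>x. coprod (boundary_E x)) = (\<lambda>x. boundary_E2 (coprod (x :: 'k graph_space)))"
    by (intro olinear_eqI lin)
  then show ?thesis by metis
qed

section \<open>Regluing on the tensor square and the conclusion\<close>

lemma regluing_homogeneous: "homogeneous nverts (nverts X) (regluing (gen X) :: 'k::field_char_0 graph_space)"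
proof -
  have *: "homogeneous nverts n (reglue F e f)" if "\<And>p q. homogeneous nverts n (F p q)"
    for n e f and F :: "nat \<times> nat \<Rightarrow> nat \<times> nat \<Rightarrow> 'k graph_space"
    unfolding reglue_def using that by (intro homogeneous_sum homogeneous_scale)
  show ?thesis
    unfolding gen_genm[of X] regluing_genm reglue_sum_def by (intro homogeneous_sum_mset * genm_homogeneous)
qed

theorem proposition7p5:
  fixes X :: "'k::field_char_0 graph_space"
  assumes "boundary_E X = 0"
  shows "\<exists>Z. cobracket X = boundary_E2 Z"
proof -
  \<comment> \<open>\<open>R\<close> will reglue in one factor at a time. It carries no sign because
    regluing preserves the number of vertices.\<close>
  have "olinear (\<lambda>x. regluing x \<otimes> y + x \<otimes> regluing y)" "olinear (\<lambda>y. regluing x \<otimes> y + x \<otimes> regluing y)"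
    for x y :: "'k graph_space"
    by (intro olinear_add tensor_linear1 tensor_linear2 olinear_compose[OF regluing_linear tensor_linear1]
        olinear_compose[OF regluing_linear tensor_linear2])+
  then obtain R :: "'k graph_space2 \<Rightarrow> 'k graph_space2" where R: "olinear R"
    and Rt: "\<And>x y. R (x \<otimes> y) = regluing x \<otimes> y + x \<otimes> regluing y"
    using tensor_universal[of "\<lambda>x y. regluing x \<otimes> y + x \<otimes> regluing y :: 'k graph_space2"] by blast
  \<comment> \<open>Terms with the boundary in one factor and regluing in the other occur equally on
    both sides; within a single factor the identity is \<open>boundary_E_regluing\<close>.\<close>
  have "(\<lambda>p. boundary_E2 (R p)) = (\<lambda>p. 4 \<bullet> boundary_H2 p + R (boundary_E2 p))"
  proof (rule olinear_eqI)
    fix A :: "lgraph \<times> lgraph"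
    obtain X Y where A: "A = (X, Y)" by fastforce
    show "boundary_E2 (R (gen A)) = 4 \<bullet> boundary_H2 (gen A) + R (boundary_E2 (gen A))"
      unfolding A tensor_gen[symmetric] Rt boundary_E2_homogeneous[OF homogeneous_gen] boundary_H2_tensor
        olinearD(1)[OF boundary_E2_linear] boundary_E2_homogeneous[OF regluing_homogeneous] boundary_E_regluing
        olinearD(1,2)[OF R]
      by (simp add: tensor_simps1 tensor_simps2 os.scale_right_distrib mult.commute add_ac)
  qed (intro olinear_add olinear_scale olinear_compose[OF R boundary_E2_linear]
      olinear_compose[OF boundary_E2_linear R] boundary_H2_linear)+
  then have H2: "4 \<bullet> boundary_H2 p = boundary_E2 (R p) - R (boundary_E2 p)" for p
    by (metis add_diff_cancel_right')
  have H: "4 \<bullet> boundary_H X = boundary_E (regluing X)"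
    using boundary_E_regluing[of X] assms by (simp add: olinearD(3)[OF regluing_linear])
  have "boundary_E2 (coprod X) = 0"
    using coprod_boundary_E[of X] assms by (simp add: olinearD(3)[OF coprod_linear])
  \<comment> \<open>The chain map property turns \<open>H\<close> into a boundary after
    \<open>coprod\<close>. In \<open>H2\<close> at \<open>coprod X\<close> the term outside the
    image of \<open>boundary_E2\<close> vanishes.\<close>
  then have "4 \<bullet> cobracket X = boundary_E2 (coprod (regluing X) - R (coprod X))"
    unfolding cobracket_def os.scale_right_diff_distrib H2 olinearD(2)[OF coprod_linear, symmetric] H coprod_boundary_E
    by (simp add: olinearD(3)[OF R] olinearD(5)[OF boundary_E2_linear])
  then have "inverse 4 \<bullet> 4 \<bullet> cobracket X = boundary_E2 (inverse 4 \<bullet> (coprod (regluing X) - R (coprod X)))"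
    by (simp only: olinearD(2)[OF boundary_E2_linear])
  \<comment> \<open>The fourfold counting is removed; 4 is invertible in characteristic
    zero.\<close>
  moreover have "inverse 4 \<bullet> 4 \<bullet> cobracket X = cobracket X" by simp
  ultimately show ?thesis by metis
qed

end
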